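(* Let $M$ be an oriented closed connected manifold. Then its simplicial volume $\|M\|$ is a right-computable real number.
   Context: The simplicial volume $\|M\|$ is the $\ell^1$-semi-norm of the real fundamental class of $M$. That is, it is the infimum of $\sum_i|a_i|$ over singular real cycles $\sum_i a_i\sigma_i$ representing $[M]_\mathbb{R}$. A real number $\beta$ is right-computable if the set $\{x\in\mathbb{Q}\mid\beta<x\}$ is recursively enumerable. *)

theory Defs
  imports "HOL-Analysis.Analysis" "HOL-Homology.Homology" "HOL-Library.Nat_Bijection"
begin

definition locally_Euclidean :: "nat \<Rightarrow> 'a topology \<Rightarrow> bool" where
  "locally_Euclidean n M \<longleftrightarrow>
     (\<forall>x\<in>topspace M. \<exists>U V. openin M U \<and> x \<in> U \<and> openin (Euclidean_space n) V \<and>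
        subtopology M U homeomorphic_space subtopology (Euclidean_space n) V)"

definition closed_manifold :: "nat \<Rightarrow> 'a topology \<Rightarrow> bool" where
  "closed_manifold n M \<longleftrightarrow> Hausdorff_space M \<and> second_countable M \<and>
     locally_Euclidean n M \<and> compact_space M"

text \<open>An orientation of a closed n-manifold M is given by an integral fundamental
  cycle z: an integral singular n-cycle whose class restricts, for every point x,
  to a generator of the local homology group H_n(M, M - x; Z).\<close>
definition fundamental_cycle :: "nat \<Rightarrow> 'a topology \<Rightarrow> 'a chain \<Rightarrow> bool" where
  "fundamental_cycle n M z \<longleftrightarrow> singular_relcycle n M {} z \<and>
     (\<forall>x\<in>topspace M.
        carrier (relative_homology_group (int n) M (topspace M - {x})) =
        generate (relative_homology_group (int n) M (topspace M - {x}))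
                 {homologous_rel_set n M (topspace M - {x}) z})"

type_synonym 'a rchain = "((nat \<Rightarrow> real) \<Rightarrow> 'a) \<Rightarrow>\<^sub>0 real"

definition real_singular_chain :: "nat \<Rightarrow> 'a topology \<Rightarrow> 'a rchain \<Rightarrow> bool" where
  "real_singular_chain p X c \<longleftrightarrow> Poly_Mapping.keys c \<subseteq> singular_simplex_set p X"

definition real_chain_boundary :: "nat \<Rightarrow> 'a rchain \<Rightarrow> 'a rchain" where
  "real_chain_boundary p c =
     (if p = 0 then 0 else
      (\<Sum>f\<in>Poly_Mapping.keys c. \<Sum>k\<le>p.
          Poly_Mapping.single (singular_face p k f) ((-1) ^ k * Poly_Mapping.lookup c f)))"

definition real_of_chain :: "'a chain \<Rightarrow> 'a rchain" where
  "real_of_chain c = Poly_Mapping.map real_of_int c"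

definition l1_norm :: "'a rchain \<Rightarrow> real" where
  "l1_norm c = (\<Sum>f\<in>Poly_Mapping.keys c. \<bar>Poly_Mapping.lookup c f\<bar>)"

definition simplicial_volume :: "nat \<Rightarrow> 'a topology \<Rightarrow> 'a chain \<Rightarrow> real" where
  "simplicial_volume n M z =
     Inf {l1_norm c | c. real_singular_chain n M c \<and>
            (\<exists>b. real_singular_chain (Suc n) M b \<and>
                 c = real_of_chain z + real_chain_boundary (Suc n) b)}"

datatype recf = Zero | Succ | Proj nat | Comp recf "recf list" | Prec recf recf | Mu recf

inductive evalr :: "recf \<Rightarrow> nat list \<Rightarrow> nat \<Rightarrow> bool" where
  zero: "evalr Zero xs 0"
| succ: "evalr Succ (x # xs) (Suc x)"
| proj: "i < length xs \<Longrightarrow> evalr (Proj i) xs (xs ! i)"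
| comp: "length ys = length gs \<Longrightarrow> (\<forall>i<length gs. evalr (gs ! i) xs (ys ! i)) \<Longrightarrow>
         evalr f ys z \<Longrightarrow> evalr (Comp f gs) xs z"
| prec0: "evalr f xs y \<Longrightarrow> evalr (Prec f g) (0 # xs) y"
| precS: "evalr (Prec f g) (m # xs) y \<Longrightarrow> evalr g (m # y # xs) z \<Longrightarrow>
          evalr (Prec f g) (Suc m # xs) z"
| mu: "evalr f (m # xs) 0 \<Longrightarrow> (\<forall>k<m. \<exists>y. evalr f (k # xs) (Suc y)) \<Longrightarrow>
       evalr (Mu f) xs m"

definition rec_enum :: "nat set \<Rightarrow> bool" where
  "rec_enum A \<longleftrightarrow> (\<exists>f. A = {x. \<exists>y. evalr f [x] y})"

text \<open>Standard (computable, surjective) coding of rationals by naturals.\<close>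
definition rat_of_code :: "nat \<Rightarrow> rat" where
  "rat_of_code n = (case prod_decode n of (a, b) \<Rightarrow> of_int (int_decode a) / of_nat (Suc b))"

definition rec_enum_rat :: "rat set \<Rightarrow> bool" where
  "rec_enum_rat Q \<longleftrightarrow> rec_enum {n. rat_of_code n \<in> Q}"

definition right_computable :: "real \<Rightarrow> bool" where
  "right_computable \<beta> \<longleftrightarrow> rec_enum_rat {x. \<beta> < of_rat x}"

end

theory Submission
  imports Defs
begin

text \<open>Every point of a closed manifold \<open>M\<close> lies in a chart, and contracting successively in finitely many
  charts turns a weighted family of nearby points into a single point, continuously and without
  regard to points of weight zero. Hence a labelling of the points with barycentric coordinates in
  \<open>(1/m)\<nat>\<close> of a standard simplex by a finite net of \<open>M\<close>, with neighbouring points carrying nearby labels,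
  spans a singular simplex of \<open>M\<close>, compatibly with faces. Conversely, labelling the simplices of a
  chain is a chain map that does not increase the norm, and the labels of a cycle span a homologous
  cycle. So the simplicial volume is below \<open>x\<close> iff some integral combination of labelled simplices
  is homologous, through labelled simplices, to \<open>D\<close> times the labelled fundamental cycle and has norm
  below \<open>D x\<close>. This is a search over finite data with a decidable test; all choices made for \<open>M\<close> only
  enter through finite tables.\<close>

section \<open>Mixing nearby points of a manifold\<close>

text \<open>The infimum ranges over arbitrary continuous simplices, and a topological manifold comes
  with no triangulation to enumerate. The net is fixed once, but the grid level \<open>m\<close>
  must grow with the competing chain, and label tables for all levels are not finite data. So the
  labels of the fundamental cycle at level \<open>m\<close> are searched for as well: any labels
  that stay near the cycle, as tested against its labels at one fixed level \<open>m0\<close>, and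
  that agree wherever its faces coincide, span a homologous cycle. Equality of simplices in
  \<open>M\<close> is never tested either. A guessed partition may merge only entries with equal
  labels; this can overestimate the norm of the spanned chain, but for labels read off an actual
  chain the cost does not exceed the norm of that chain. Hat functions instead of a subdivision make
  the face of a spanned simplex literally the simplex spanned by the face labels. The constants form
  one budget: net and mesh errors of 1/100 add up to 3/100 for labels of neighbours, this stays
  below the 1/8 required for spanning, and four errors of 1/8 stay within the unit balls of
  \<open>d\<close> in which mixing works.\<close>

record 'a chart =
  cdom :: "'a set"
  ccl :: "'a set"
  cin :: "'a set"
  cmap :: "'a \<Rightarrow> nat \<Rightarrow> real"
  cinv :: "(nat \<Rightarrow> real) \<Rightarrow> 'a"
  cut :: "'a \<Rightarrow> real"

definition cvx :: "(nat \<Rightarrow> real) set \<Rightarrow> bool" where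
  "cvx C \<longleftrightarrow> (\<forall>I::nat set. \<forall>w y. finite I \<longrightarrow> (\<forall>i\<in>I. 0 \<le> w i \<and> y i \<in> C) \<longrightarrow> sum w I = 1 \<longrightarrow>
     (\<lambda>c. \<Sum>i\<in>I. w i * y i c) \<in> C)"

text \<open>The bump \<open>cut\<close> lives on the closed set \<open>ccl\<close> inside the open
  domain, so the chart motion extends by rest to all of \<open>X\<close>. The last clause supplies
  arbitrarily small neighbourhoods that the motion maps into themselves; they keep a family small
  until it reaches a chart that collapses it.\<close>

definition convex_chart :: "'a topology \<Rightarrow> 'a chart \<Rightarrow> bool" where
  "convex_chart X ch \<longleftrightarrow>
     openin X (cdom ch) \<and> closedin X (ccl ch) \<and> openin X (cin ch) \<and>
     cin ch \<subseteq> ccl ch \<and> ccl ch \<subseteq> cdom ch \<and>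
     continuous_map X euclideanreal (cut ch) \<and>
     (\<forall>x\<in>topspace X. 0 \<le> cut ch x \<and> cut ch x \<le> 1) \<and>
     (\<forall>x\<in>topspace X - ccl ch. cut ch x = 0) \<and> (\<forall>x\<in>cin ch. cut ch x = 1) \<and>
     continuous_map (subtopology X (cdom ch)) (powertop_real UNIV) (cmap ch) \<and>
     continuous_map (subtopology (powertop_real UNIV) (cmap ch ` cdom ch)) X (cinv ch) \<and>
     (\<forall>x\<in>cdom ch. cinv ch (cmap ch x) = x) \<and>
     cvx (cmap ch ` cdom ch) \<and>
     (\<forall>x\<in>cdom ch. \<forall>W. openin X W \<and> x \<in> W \<longrightarrow>
        (\<exists>B. openin X B \<and> x \<in> B \<and> B \<subseteq> W \<and> B \<subseteq> cdom ch \<and> cvx (cmap ch ` B)))"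

lemma convex_chartD:
  assumes "convex_chart X ch"
  shows "openin X (cdom ch)" "closedin X (ccl ch)" "openin X (cin ch)"
    "cin ch \<subseteq> ccl ch" "ccl ch \<subseteq> cdom ch" "cin ch \<subseteq> cdom ch" "cdom ch \<subseteq> topspace X"
    "continuous_map X euclideanreal (cut ch)"
    "\<And>x. x \<in> topspace X \<Longrightarrow> 0 \<le> cut ch x" "\<And>x. x \<in> topspace X \<Longrightarrow> cut ch x \<le> 1"
    "\<And>x. x \<in> topspace X \<Longrightarrow> x \<notin> ccl ch \<Longrightarrow> cut ch x = 0" "\<And>x. x \<in> cin ch \<Longrightarrow> cut ch x = 1"
    "continuous_map (subtopology X (cdom ch)) (powertop_real UNIV) (cmap ch)"
    "continuous_map (subtopology (powertop_real UNIV) (cmap ch ` cdom ch)) X (cinv ch)"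
    "\<And>x. x \<in> cdom ch \<Longrightarrow> cinv ch (cmap ch x) = x"
    "cvx (cmap ch ` cdom ch)"
    "\<And>x W. x \<in> cdom ch \<Longrightarrow> openin X W \<Longrightarrow> x \<in> W \<Longrightarrow> \<exists>B. openin X B \<and> x \<in> B \<and> B \<subseteq> W \<and> B \<subseteq> cdom ch \<and> cvx (cmap ch ` B)"
proof -
  note c = assms[unfolded convex_chart_def]
  show "cin ch \<subseteq> cdom ch" using c by (elim conjE) (rule subset_trans)
  show "cdom ch \<subseteq> topspace X" using c openin_subset by (elim conjE) simp
  show "\<And>x W. x \<in> cdom ch \<Longrightarrow> openin X W \<Longrightarrow> x \<in> W \<Longrightarrow> \<exists>B. openin X B \<and> x \<in> B \<and> B \<subseteq> W \<and> B \<subseteq> cdom ch \<and> cvx (cmap ch ` B)"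
    using c by (elim conjE) simp
qed (use assms in \<open>simp_all add: convex_chart_def\<close>)

definition mean_cut :: "'a chart \<Rightarrow> nat set \<Rightarrow> (nat \<Rightarrow> real) \<Rightarrow> (nat \<Rightarrow> 'a) \<Rightarrow> real" where
  "mean_cut ch I w y = (\<Sum>i\<in>I. w i * cut ch (y i))"

text \<open>The points move towards their barycentre in the chart, by the mean value of the bump function.
  A family inside \<open>cin\<close> therefore collapses to a point, and points outside \<open>ccl\<close> do not move.\<close>

definition contract :: "'a chart \<Rightarrow> nat set \<Rightarrow> (nat \<Rightarrow> real) \<Rightarrow> (nat \<Rightarrow> 'a) \<Rightarrow> nat \<Rightarrow> 'a" where
  "contract ch I w y i = (let s = mean_cut ch I w y in
     if s = 0 then y i
     else cinv ch (\<lambda>c. (1 - s) * cmap ch (y i) c + s * (\<Sum>j\<in>I. w j * cmap ch (y j) c)))"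

primrec mix :: "'a chart list \<Rightarrow> nat set \<Rightarrow> (nat \<Rightarrow> real) \<Rightarrow> (nat \<Rightarrow> 'a) \<Rightarrow> nat \<Rightarrow> 'a" where
  "mix [] I w y = y"
| "mix (ch # chs) I w y = mix chs I w (contract ch I w y)"

text \<open>The disjunction excludes families that straddle the edge of a chart, where
  \<open>contract\<close> would evaluate \<open>cmap\<close> outside its domain.\<close>

primrec mixable :: "'a chart list \<Rightarrow> nat set \<Rightarrow> (nat \<Rightarrow> real) \<Rightarrow> (nat \<Rightarrow> 'a) \<Rightarrow> bool" where
  "mixable [] I w y \<longleftrightarrow> (\<forall>i\<in>I. \<forall>j\<in>I. y i = y j)"
| "mixable (ch # chs) I w y \<longleftrightarrow> (y ` I \<subseteq> cdom ch \<or> y ` I \<inter> ccl ch = {}) \<and> mixable chs I w (contract ch I w y)"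

definition weights :: "nat set \<Rightarrow> (nat \<Rightarrow> real) \<Rightarrow> bool" where
  "weights I w \<longleftrightarrow> (\<forall>i\<in>I. 0 \<le> w i) \<and> sum w I = 1"

lemma weights_finite: "weights I w \<Longrightarrow> finite I"
  unfolding weights_def using sum.infinite by force

lemma weights_pos: "weights I w \<Longrightarrow> \<exists>i\<in>I. 0 < w i"
  unfolding weights_def by (metis sum_nonpos not_le zero_less_one)

text \<open>A point of weight zero enters the mean bump and the barycentre with factor 0, so it is
  moved by the others without influencing them. Continuity at changing supports and the homotopy
  \<open>slide\<close> both rest on this.\<close>

lemma contract_drop:
  assumes "finite I" "I' \<subseteq> I" "\<And>i. i \<in> I - I' \<Longrightarrow> w i = 0"
    and "\<And>i. i \<in> I' \<Longrightarrow> w' i = w i" "\<And>i. i \<in> I' \<Longrightarrow> y' i = y i" and "i \<in> I'"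
  shows "contract ch I' w' y' i = contract ch I w y i"
proof -
  have "mean_cut ch I' w' y' = mean_cut ch I w y"
    unfolding mean_cut_def using assms by (intro sum.mono_neutral_cong_left) auto
  moreover have "(\<Sum>j\<in>I'. w' j * cmap ch (y' j) c) = (\<Sum>j\<in>I. w j * cmap ch (y j) c)" for c
    using assms by (intro sum.mono_neutral_cong_left) auto
  ultimately show ?thesis
    using assms unfolding contract_def Let_def by auto
qed

lemma mix_drop:
  assumes "finite I" "I' \<subseteq> I" "\<And>i. i \<in> I - I' \<Longrightarrow> w i = 0"
    and "\<And>i. i \<in> I' \<Longrightarrow> w' i = w i" "\<And>i. i \<in> I' \<Longrightarrow> y' i = y i" and "i \<in> I'"
  shows "mix chs I' w' y' i = mix chs I w y i"
  using assms
proof (induction chs arbitrary: y y')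
  case (Cons ch chs)
  have "contract ch I' w' y' i = contract ch I w y i" if "i \<in> I'" for i
    by (rule contract_drop[OF Cons.prems(1-5) that])
  then show ?case
    using Cons.IH[OF Cons.prems(1-4) _ Cons.prems(6)] by simp
qed simp

lemma mixable_imp_eq:
  assumes "mixable chs I w y" "i \<in> I" "j \<in> I"
  shows "mix chs I w y i = mix chs I w y j"
  using assms
proof (induction chs arbitrary: y)
  case Nil
  then show ?case by (metis mix.simps(1) mixable.simps(1))
next
  case (Cons ch chs)
  then show ?case by (metis mix.simps(2) mixable.simps(2))
qed

lemma cut_zero_if:
  assumes "convex_chart X ch" "y ` I \<subseteq> topspace X" "y ` I \<inter> ccl ch = {}"
  shows "mean_cut ch I w y = 0"
  unfolding mean_cut_def
proof (intro sum.neutral ballI)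
  fix i assume "i \<in> I"
  then have "y i \<in> topspace X" "y i \<notin> ccl ch" using assms by auto
  then show "w i * cut ch (y i) = 0" using convex_chartD(11)[OF assms(1)] by simp
qed

lemma mean_cut_01:
  assumes "convex_chart X ch" "y ` I \<subseteq> topspace X" "weights I w"
  shows "0 \<le> mean_cut ch I w y" "mean_cut ch I w y \<le> 1"
proof -
  have c: "\<And>i. i \<in> I \<Longrightarrow> 0 \<le> cut ch (y i) \<and> cut ch (y i) \<le> 1"
    using assms(2) convex_chartD(9,10)[OF assms(1)] by blast
  show "0 \<le> mean_cut ch I w y"
    unfolding mean_cut_def using c assms(3) by (intro sum_nonneg) (auto simp: weights_def)
  have "mean_cut ch I w y \<le> sum w I"
    unfolding mean_cut_def using c assms(3) by (intro sum_mono) (auto simp: weights_def mult_left_le)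
  then show "mean_cut ch I w y \<le> 1" using assms(3) by (simp add: weights_def)
qed

lemma cvx_contract:
  assumes "cvx C" "weights I w" "\<And>i. i \<in> I \<Longrightarrow> y i \<in> C" "i \<in> I" "0 \<le> s" "s \<le> 1"
  shows "(\<lambda>c. (1 - s) * y i c + s * (\<Sum>j\<in>I. w j * y j c)) \<in> C"
proof -
  have fin: "finite I" using assms(2) weights_finite by blast
  \<comment> \<open>Moving point \<open>i\<close> by the fraction \<open>s\<close> towards the
    barycentre is a single convex combination, with the extra weight 1 - s at
    \<open>i\<close>.\<close>
  let ?w = "\<lambda>j. s * w j + (if j = i then 1 - s else 0)"
  have "sum ?w I = 1"
    using assms fin by (simp add: sum.distrib weights_def flip: sum_distrib_left)
  moreover have "\<forall>j\<in>I. 0 \<le> ?w j \<and> y j \<in> C"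
    using assms by (auto simp: weights_def)
  ultimately have "(\<lambda>c. \<Sum>j\<in>I. ?w j * y j c) \<in> C"
    using assms(1)[unfolded cvx_def, rule_format, of I ?w y] fin by simp
  moreover have "(\<Sum>j\<in>I. ?w j * y j c) = (1 - s) * y i c + s * (\<Sum>j\<in>I. w j * y j c)" for c
  proof -
    have "(\<Sum>j\<in>I. ?w j * y j c) = (\<Sum>j\<in>I. s * (w j * y j c) + (if j = i then (1 - s) * y i c else 0))"
      by (intro sum.cong) (auto simp: algebra_simps)
    also have "\<dots> = (1 - s) * y i c + s * (\<Sum>j\<in>I. w j * y j c)"
      using assms(4) fin by (simp add: sum.distrib sum_distrib_left)
    finally show ?thesis .
  qed
  ultimately show ?thesis by simp
qed

text \<open>Stated for a general \<open>B\<close> because it serves twice: for the whole domain and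
  for the small convex neighbourhoods in \<open>mixable_nbhd\<close>.\<close>

lemma contract_mem:
  assumes "convex_chart X ch" "weights I w" "y ` I \<subseteq> B" "B \<subseteq> cdom ch" "cvx (cmap ch ` B)" "i \<in> I"
  shows "contract ch I w y i \<in> B"
proof -
  have top: "y ` I \<subseteq> topspace X"
    using assms convex_chartD(7)[OF assms(1)] by blast
  let ?s = "mean_cut ch I w y"
  have "(\<lambda>c. (1 - ?s) * cmap ch (y i) c + ?s * (\<Sum>j\<in>I. w j * cmap ch (y j) c)) \<in> cmap ch ` B"
    by (rule cvx_contract[where y = "\<lambda>i. cmap ch (y i)", OF assms(5,2) _ assms(6) mean_cut_01[OF assms(1) top assms(2)]])
       (use assms(3) in auto)
  then obtain b where b: "b \<in> B" "(\<lambda>c. (1 - ?s) * cmap ch (y i) c + ?s * (\<Sum>j\<in>I. w j * cmap ch (y j) c)) = cmap ch b"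
    by blast
  then have "contract ch I w y i = (if ?s = 0 then y i else b)"
    using assms(4) convex_chartD(15)[OF assms(1)] unfolding contract_def Let_def by auto
  then show ?thesis using b(1) assms(3,6) by auto
qed

lemma contract_in_cdom:
  assumes "convex_chart X ch" "weights I w" "y ` I \<subseteq> cdom ch" "i \<in> I"
  shows "contract ch I w y i \<in> cdom ch"
    "cmap ch (contract ch I w y i) = (\<lambda>c. (1 - mean_cut ch I w y) * cmap ch (y i) c + mean_cut ch I w y * (\<Sum>j\<in>I. w j * cmap ch (y j) c))"
proof -
  show "contract ch I w y i \<in> cdom ch"
    using contract_mem[OF assms(1-3) _ _ assms(4)] convex_chartD(16)[OF assms(1)] by blast
  have top: "y ` I \<subseteq> topspace X"
    using assms convex_chartD(7)[OF assms(1)] by blast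
  let ?s = "mean_cut ch I w y"
  have "(\<lambda>c. (1 - ?s) * cmap ch (y i) c + ?s * (\<Sum>j\<in>I. w j * cmap ch (y j) c)) \<in> cmap ch ` cdom ch"
    by (rule cvx_contract[where y = "\<lambda>i. cmap ch (y i)", OF convex_chartD(16)[OF assms(1)] assms(2) _ assms(4) mean_cut_01[OF assms(1) top assms(2)]])
       (use assms(3) in auto)
  then obtain b where b: "b \<in> cdom ch" "(\<lambda>c. (1 - ?s) * cmap ch (y i) c + ?s * (\<Sum>j\<in>I. w j * cmap ch (y j) c)) = cmap ch b"
    by blast
  then have "contract ch I w y i = (if ?s = 0 then y i else b)"
    using assms(3,4) convex_chartD(15)[OF assms(1)] unfolding contract_def Let_def by auto
  then show "cmap ch (contract ch I w y i) = (\<lambda>c. (1 - ?s) * cmap ch (y i) c + ?s * (\<Sum>j\<in>I. w j * cmap ch (y j) c))"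
    using b by auto
qed

text \<open>For s = 0 the formula gives \<open>cinv ch (cmap ch (y i))\<close>, which is
  \<open>y i\<close>. Inside the chart the case distinction of \<open>contract\<close> thus
  disappears, and with it any doubt about continuity where the mean bump reaches 0.\<close>

lemma contract_chart_formula:
  assumes "convex_chart X ch" "y ` I \<subseteq> cdom ch" "i \<in> I"
  shows "contract ch I w y i = cinv ch (\<lambda>c. (1 - mean_cut ch I w y) * cmap ch (y i) c + mean_cut ch I w y * (\<Sum>j\<in>I. w j * cmap ch (y j) c))"
  using assms(2,3) convex_chartD(15)[OF assms(1)] unfolding contract_def Let_def by auto

lemma contract_off:
  assumes "convex_chart X ch" "y ` I \<subseteq> topspace X" "y ` I \<inter> ccl ch = {}"
  shows "contract ch I w y = y"
  using cut_zero_if[OF assms] by (simp add: contract_def fun_eq_iff)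

lemma contract_const:
  assumes "convex_chart X ch" "weights I w" "x \<in> topspace X" "\<And>i. i \<in> I \<Longrightarrow> y i = x" "i \<in> I"
  shows "contract ch I w y i = x"
proof (cases "x \<in> cdom ch")
  case True
  have "(\<Sum>j\<in>I. w j * cmap ch (y j) c) = cmap ch x c" for c
    using assms by (simp add: weights_def flip: sum_distrib_right)
  then have "contract ch I w y i = cinv ch (\<lambda>c. cmap ch x c)"
    using contract_chart_formula[OF assms(1) _ assms(5), of y w] assms(4,5) True
    by (auto simp: algebra_simps)
  then show ?thesis using True convex_chartD(15)[OF assms(1)] by auto
next
  case False
  then have "y ` I \<inter> ccl ch = {}" using assms(4) convex_chartD(5)[OF assms(1)] by auto
  moreover have "y ` I \<subseteq> topspace X" using assms by auto
  ultimately show ?thesis using contract_off[OF assms(1), of y I w] assms by simp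
qed

text \<open>A collapsed family survives the remaining charts: the barycentre of equal points is that
  point, and a chart whose domain misses the point has bump 0 there.\<close>

lemma const_mixable:
  assumes "\<And>ch. ch \<in> set chs \<Longrightarrow> convex_chart X ch" "weights I w" "x \<in> topspace X" "\<And>i. i \<in> I \<Longrightarrow> y i = x"
  shows "mixable chs I w y \<and> (\<forall>i\<in>I. mix chs I w y i = x)"
  using assms
proof (induction chs arbitrary: y)
  case (Cons ch chs)
  have "contract ch I w y i = x" if "i \<in> I" for i
    using contract_const[of X ch I w x y i] Cons.prems that by simp
  moreover have "y ` I \<subseteq> cdom ch \<or> y ` I \<inter> ccl ch = {}"
    using convex_chartD(5)[of X ch] Cons.prems(1)[of ch] Cons.prems(4) by auto
  ultimately show ?case using Cons by simp
qed simp

text \<open>On \<open>cin\<close> the bump is 1, so the mean bump is the total weight 1 and every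
  point moves all the way to the barycentre.\<close>

lemma contract_collapse:
  assumes "convex_chart X ch" "weights I w" "y ` I \<subseteq> cin ch"
  shows "\<exists>x\<in>topspace X. \<forall>i\<in>I. contract ch I w y i = x"
proof -
  have sub: "y ` I \<subseteq> cdom ch" using assms(3) convex_chartD(6)[OF assms(1)] by blast
  have "mean_cut ch I w y = sum w I"
    unfolding mean_cut_def using assms(3) convex_chartD(12)[OF assms(1)] by (intro sum.cong) auto
  then have 1: "mean_cut ch I w y = 1" using assms(2) by (simp add: weights_def)
  have eq: "contract ch I w y i = cinv ch (\<lambda>c. (\<Sum>j\<in>I. w j * cmap ch (y j) c))" if "i \<in> I" for i
    using contract_chart_formula[OF assms(1) sub that, of w] 1 by simp
  obtain i where "i \<in> I" using weights_pos[OF assms(2)] by blast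
  then have "contract ch I w y i \<in> topspace X"
    using contract_in_cdom(1)[OF assms(1,2) sub] convex_chartD(7)[OF assms(1)] by blast
  then show ?thesis using eq \<open>i \<in> I\<close> by metis
qed

text \<open>The first chart with \<open>x\<close> in \<open>cin\<close> collapses the family, and
  \<open>const_mixable\<close> handles the charts after it. Each earlier chart either has
  \<open>x\<close> in its domain, where a small neighbourhood with convex image is preserved, or can
  be avoided by removing \<open>ccl\<close>. The neighbourhood is uniform in the family and its
  weights.\<close>

lemma mixable_nbhd:
  assumes "\<And>ch. ch \<in> set chs \<Longrightarrow> convex_chart X ch" "ch \<in> set chs" "x \<in> cin ch"
  shows "\<exists>B. openin X B \<and> x \<in> B \<and> (\<forall>I w y. weights I w \<longrightarrow> y ` I \<subseteq> B \<longrightarrow> mixable chs I w y)"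
  using assms
proof (induction chs)
  case (Cons c cs)
  have c: "convex_chart X c" using Cons by simp
  show ?case
  proof (cases "x \<in> cin c")
    case True
    have "mixable (c # cs) I w y" if yI: "weights I w" "y ` I \<subseteq> cin c" for I w y
    proof -
      obtain x' where x': "x' \<in> topspace X" "\<forall>i\<in>I. contract c I w y i = x'"
        using contract_collapse[OF c yI] by blast
      then have "mixable cs I w (contract c I w y)"
        using const_mixable[of cs X I w x'] Cons.prems(1) that by auto
      then show ?thesis using that convex_chartD(6)[OF c] by auto
    qed
    then show ?thesis using True convex_chartD(3)[OF c] by blast
  next
    case False
    then have "ch \<in> set cs" using Cons by auto
    then obtain B where B: "openin X B" "x \<in> B" "\<And>I w y. weights I w \<Longrightarrow> y ` I \<subseteq> B \<Longrightarrow> mixable cs I w y"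
      using Cons.IH Cons.prems(1,3) by (metis list.set_intros(2))
    show ?thesis
    proof (cases "x \<in> cdom c")
      case True
      then obtain B' where B': "openin X B'" "x \<in> B'" "B' \<subseteq> B" "B' \<subseteq> cdom c" "cvx (cmap c ` B')"
        using convex_chartD(17)[OF c True B(1,2)] by blast
      have "mixable (c # cs) I w y" if "weights I w" "y ` I \<subseteq> B'" for I w y
      proof -
        have "contract c I w y ` I \<subseteq> B'"
          using contract_mem[OF c that B'(4,5)] by blast
        then show ?thesis using B(3)[OF that(1)] B' that by auto
      qed
      then show ?thesis using B' by blast
    next
      case False
      let ?B = "B - ccl c"
      have "openin X ?B" using B convex_chartD(2)[OF c] by blast
      moreover have "x \<in> ?B" using False B convex_chartD(5)[OF c] by blast
      moreover have "mixable (c # cs) I w y" if "weights I w" "y ` I \<subseteq> ?B" for I w y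
      proof -
        have "contract c I w y = y"
          by (rule contract_off[OF c]) (use that openin_subset[OF \<open>openin X ?B\<close>] in blast)+
        then show ?thesis using B(3)[OF that(1), of y] that by auto
      qed
      ultimately show ?thesis by blast
    qed
  qed
qed simp

lemma continuous_map_local:
  assumes "\<And>x. x \<in> topspace X \<Longrightarrow> \<exists>N. openin X N \<and> x \<in> N \<and> continuous_map (subtopology X N) Y f"
  shows "continuous_map X Y f"
proof -
  obtain N where N: "\<And>x. x \<in> topspace X \<Longrightarrow> openin X (N x) \<and> x \<in> N x \<and> continuous_map (subtopology X (N x)) Y f"
    using assms by metis
  have "continuous_map X Y f \<longleftrightarrow> (\<forall>i\<in>topspace X. continuous_map (subtopology X (N i)) Y f)"
  proof -
    have "continuous_map X Y f" if "\<forall>i\<in>topspace X. continuous_map (subtopology X (N i)) Y f"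
      by (rule pasting_lemma[where I="topspace X" and T=N and f="\<lambda>_. f" and g=f])
         (use that N in auto)
    then show ?thesis using continuous_map_from_subtopology by blast
  qed
  then show ?thesis using N by blast
qed

text \<open>Both alternatives of \<open>good\<close> are open conditions on the parameter, as
  \<open>I\<close> is finite. Near a parameter with the family in the domain the chart formula
  applies; near one with the family off \<open>ccl\<close> nothing moves.\<close>

lemma contract_continuous:
  assumes c: "convex_chart X ch"
    and w: "\<And>i. i \<in> I \<Longrightarrow> continuous_map Z euclideanreal (\<lambda>z. w z i)"
    and y: "\<And>i. i \<in> I \<Longrightarrow> continuous_map Z X (\<lambda>z. y z i)"
    and W: "\<And>z. z \<in> topspace Z \<Longrightarrow> weights I (w z)"
    and good: "\<And>z. z \<in> topspace Z \<Longrightarrow> y z ` I \<subseteq> cdom ch \<or> y z ` I \<inter> ccl ch = {}"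
    and "i \<in> I"
  shows "continuous_map Z X (\<lambda>z. contract ch I (w z) (y z) i)"
proof (rule continuous_map_local)
  fix z0 assume z0: "z0 \<in> topspace Z"
  have fin: "finite I" using W z0 weights_finite by blast
  have top: "y z ` I \<subseteq> topspace X" if "z \<in> topspace Z" for z
    using y that continuous_map_image_subset_topspace by blast
  show "\<exists>N. openin Z N \<and> z0 \<in> N \<and> continuous_map (subtopology Z N) X (\<lambda>z. contract ch I (w z) (y z) i)"
  proof (cases "y z0 ` I \<subseteq> cdom ch")
    case True
    let ?N = "topspace Z \<inter> (\<Inter>j\<in>I. {z \<in> topspace Z. y z j \<in> cdom ch})"
    have opN: "openin Z ?N"
      using fin \<open>i \<in> I\<close>
      by (intro openin_Int openin_INT) (auto intro!: openin_continuous_map_preimage[OF y convex_chartD(1)[OF c]])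
    have sub: "y z ` I \<subseteq> cdom ch" if "z \<in> ?N" for z using that by auto
    let ?Z = "subtopology Z ?N"
    have topZ: "topspace ?Z = ?N" using opN by (auto)
    have yd: "continuous_map ?Z (subtopology X (cdom ch)) (\<lambda>z. y z j)" if "j \<in> I" for j
      using y[OF that] that by (auto simp: continuous_map_in_subtopology intro: continuous_map_from_subtopology)
    have cm: "continuous_map ?Z euclideanreal (\<lambda>z. cmap ch (y z j) c)" if "j \<in> I" for j c
    proof -
      have "continuous_map ?Z (powertop_real UNIV) (cmap ch \<circ> (\<lambda>z. y z j))"
        by (rule continuous_map_compose[OF yd[OF that]]) (use convex_chartD[OF c] in auto)
      then show ?thesis by (simp add: continuous_map_componentwise_UNIV o_def)
    qed
    have wc: "continuous_map ?Z euclideanreal (\<lambda>z. w z j)" if "j \<in> I" for j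
      using w[OF that] continuous_map_from_subtopology by blast
    have cc: "continuous_map ?Z euclideanreal (\<lambda>z. cut ch (y z j))" if "j \<in> I" for j
      using continuous_map_compose[OF continuous_map_from_subtopology[OF y[OF that]], of euclideanreal "cut ch"] convex_chartD(8)[OF c]
      by (simp add: o_def)
    have mc: "continuous_map ?Z euclideanreal (\<lambda>z. mean_cut ch I (w z) (y z))"
      unfolding mean_cut_def by (intro continuous_map_sum continuous_map_real_mult fin wc cc)
    let ?F = "\<lambda>z c. (1 - mean_cut ch I (w z) (y z)) * cmap ch (y z i) c + mean_cut ch I (w z) (y z) * (\<Sum>j\<in>I. w z j * cmap ch (y z j) c)"
    have F: "continuous_map ?Z (powertop_real UNIV) ?F"
      unfolding continuous_map_componentwise_UNIV
      by (intro allI continuous_map_add continuous_map_real_mult continuous_map_diff continuous_map_sum fin mc wc cm \<open>i \<in> I\<close>) auto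
    have "?F z \<in> cmap ch ` cdom ch" if "z \<in> ?N" for z
    proof -
      have zt: "z \<in> topspace Z" using that by auto
      show ?thesis
        using contract_in_cdom[OF c W[OF zt] sub[OF that] \<open>i \<in> I\<close>] by (metis (no_types, lifting) imageI)
    qed
    then have "continuous_map ?Z (subtopology (powertop_real UNIV) (cmap ch ` cdom ch)) ?F"
      using F by (auto simp: continuous_map_in_subtopology)
    then have "continuous_map ?Z X (cinv ch \<circ> ?F)"
      by (rule continuous_map_compose) (use convex_chartD[OF c] in auto)
    moreover have "(cinv ch \<circ> ?F) z = contract ch I (w z) (y z) i" if "z \<in> topspace ?Z" for z
    proof -
      have zN: "z \<in> ?N" using that topZ by (rule subst[rotated])
      show ?thesis
        unfolding o_def by (rule contract_chart_formula[OF c sub[OF zN] \<open>i \<in> I\<close>, symmetric])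
    qed
    ultimately have "continuous_map ?Z X (\<lambda>z. contract ch I (w z) (y z) i)"
      by (rule continuous_map_eq)
    then show ?thesis using opN z0 True by auto
  next
    case False
    let ?N = "topspace Z \<inter> (\<Inter>j\<in>I. {z \<in> topspace Z. y z j \<in> topspace X - ccl ch})"
    have opN: "openin Z ?N"
    proof (subst Int_commute, rule openin_INT)
      show "openin Z {z \<in> topspace Z. y z j \<in> topspace X - ccl ch}" if "j \<in> I" for j
        using openin_continuous_map_preimage[OF y[OF that]] convex_chartD(2)[OF c] by blast
    qed (rule fin)
    have off: "y z0 ` I \<inter> ccl ch = {}" using False good z0 by blast
    have "continuous_map (subtopology Z ?N) X (\<lambda>z. contract ch I (w z) (y z) i)"
    proof (rule continuous_map_eq)
      show "continuous_map (subtopology Z ?N) X (\<lambda>z. y z i)"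
        using y[OF \<open>i \<in> I\<close>] continuous_map_from_subtopology by blast
      fix z assume "z \<in> topspace (subtopology Z ?N)"
      then have "z \<in> topspace Z" "y z ` I \<inter> ccl ch = {}" by auto
      then show "y z i = contract ch I (w z) (y z) i"
        using contract_off[OF c top] by metis
    qed
    moreover have "z0 \<in> ?N" using off top[OF z0] z0 by auto
    ultimately show ?thesis using opN by blast
  qed
qed

lemma mix_continuous:
  assumes c: "\<And>ch. ch \<in> set chs \<Longrightarrow> convex_chart X ch"
    and w: "\<And>i. i \<in> I \<Longrightarrow> continuous_map Z euclideanreal (\<lambda>z. w z i)"
    and y: "\<And>i. i \<in> I \<Longrightarrow> continuous_map Z X (\<lambda>z. y z i)"
    and W: "\<And>z. z \<in> topspace Z \<Longrightarrow> weights I (w z)"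
    and good: "\<And>z. z \<in> topspace Z \<Longrightarrow> mixable chs I (w z) (y z)"
    and "i \<in> I"
  shows "continuous_map Z X (\<lambda>z. mix chs I (w z) (y z) i)"
  using assms
proof (induction chs arbitrary: y)
  case (Cons ch chs)
  have "continuous_map Z X (\<lambda>z. contract ch I (w z) (y z) i)" if "i \<in> I" for i
    by (rule contract_continuous) (use Cons.prems that in auto)
  then show ?case
    using Cons.IH[of "\<lambda>z. contract ch I (w z) (y z)"] Cons.prems by auto
qed simp

section \<open>Coordinate boxes and the existence of convex charts\<close>

definition coord_box :: "nat \<Rightarrow> (nat \<Rightarrow> real) \<Rightarrow> real \<Rightarrow> (nat \<Rightarrow> real) set" where
  "coord_box n p e = {q. (\<forall>i\<ge>n. q i = 0) \<and> (\<forall>i<n. q i \<in> {p i - e<..<p i + e})}"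

lemma openin_coord_box: "openin (Euclidean_space n) (coord_box n p e)"
proof -
  have "coord_box n p e = topspace (Euclidean_space n) \<inter>
      (\<Inter>i\<in>{..<n}. {q \<in> topspace (Euclidean_space n). q i \<in> {p i - e<..<p i + e}})"
    by (auto simp: coord_box_def topspace_Euclidean_space)
  moreover have "openin (Euclidean_space n) {q \<in> topspace (Euclidean_space n). q i \<in> {p i - e<..<p i + e}}" for i
  proof (rule openin_continuous_map_preimage)
    show "continuous_map (Euclidean_space n) euclideanreal (\<lambda>q. q i)"
      unfolding Euclidean_space_def
      by (intro continuous_map_from_subtopology continuous_map_product_projection) auto
  qed auto
  ultimately show ?thesis
    using openin_INT[of "{..<n}" "Euclidean_space n"] by (simp add: Int_commute)
qed

lemma cvx_coord_box: "cvx (coord_box n p e)"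
  unfolding cvx_def
proof (intro allI impI)
  fix I :: "nat set" and w y
  assume I: "finite I" "\<forall>i\<in>I. 0 \<le> w i \<and> y i \<in> coord_box n p e" "sum w I = (1::real)"
  have "(\<Sum>i\<in>I. w i * y i c) \<in> {p c - e<..<p c + e}" if "c < n" for c
    using convex_sum[of I "{p c - e<..<p c + e}" w "\<lambda>i. y i c"] I that
    by (auto simp: coord_box_def)
  moreover have "(\<Sum>i\<in>I. w i * y i c) = 0" if "c \<ge> n" for c
    using I that by (intro sum.neutral) (auto simp: coord_box_def)
  ultimately show "(\<lambda>c. \<Sum>i\<in>I. w i * y i c) \<in> coord_box n p e"
    by (auto simp: coord_box_def)
qed

lemma coord_box_subset:
  assumes "openin (Euclidean_space n) V" "p \<in> V"
  obtains e where "e > 0" "coord_box n p e \<subseteq> V" "p \<in> coord_box n p e"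
proof -
  obtain T where T: "openin (powertop_real UNIV) T" "V = T \<inter> {x. \<forall>i\<ge>n. x i = 0}"
    using assms by (auto simp: Euclidean_space_def openin_subtopology)
  then obtain U where U: "finite {i. U i \<noteq> (UNIV::real set)}" "\<And>i. open (U i)" "p \<in> Pi\<^sub>E UNIV U" "Pi\<^sub>E UNIV U \<subseteq> T"
    using assms(2) unfolding openin_product_topology_alt by fastforce
  have "\<exists>e>0. ball (p i) e \<subseteq> U i" for i
    using U(2)[of i] U(3) by (simp add: open_contains_ball PiE_iff)
  then obtain r where r: "\<And>i. r i > 0" "\<And>i. ball (p i) (r i) \<subseteq> U i" by metis
  \<comment> \<open>A basic open set of the product topology restricts only finitely many
    coordinates; the 1 covers the case that it restricts none. Coordinates from \<open>n\<close> on
    agree because both points vanish there.\<close>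
  define e where "e = Min (insert 1 (r ` {i. U i \<noteq> UNIV}))"
  have e0: "e > 0" unfolding e_def using U(1) r(1) by (subst Min_gr_iff) auto
  have er: "e \<le> r i" if "U i \<noteq> UNIV" for i unfolding e_def using U(1) that by (intro Min_le) auto
  have p0: "\<forall>i\<ge>n. p i = 0" using assms(2) T(2) by auto
  have "coord_box n p e \<subseteq> V"
  proof
    fix q assume q: "q \<in> coord_box n p e"
    have "q i \<in> U i" for i
    proof (cases "U i = UNIV")
      case False
      have "dist (p i) (q i) < e"
        using q p0 e0 by (cases "i < n") (auto simp: coord_box_def dist_real_def abs_less_iff)
      then have "q i \<in> ball (p i) (r i)" using er[OF False] by simp
      then show ?thesis using r(2) by blast
    qed simp
    then have "q \<in> T" using U(4) by auto
    then show "q \<in> V" using T(2) q by (auto simp: coord_box_def)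
  qed
  moreover have "p \<in> coord_box n p e" using p0 e0 by (auto simp: coord_box_def)
  ultimately show ?thesis using that e0 by blast
qed

lemma closed_nbhd:
  assumes "regular_space X" "openin X W" "x \<in> W"
  obtains P C where "openin X P" "closedin X C" "x \<in> P" "P \<subseteq> C" "C \<subseteq> W"
  using assms by (metis neighbourhood_base_of neighbourhood_base_of_closedin)

text \<open>Regularity nests P' in C' in P in C in a box neighbourhood D of \<open>x\<close>. A
  Urysohn function that is 1 on C' and 0 off P is then the bump, with P' as \<open>cin\<close> and C
  as \<open>ccl\<close>.\<close>

lemma convex_chart_exists:
  assumes M: "closed_manifold n M" and x: "x \<in> topspace M"
  shows "\<exists>ch. convex_chart M ch \<and> x \<in> cin ch"
proof -
  obtain U V where UV: "openin M U" "x \<in> U" "openin (Euclidean_space n) V"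
      "subtopology M U homeomorphic_space subtopology (Euclidean_space n) V"
    using M x unfolding closed_manifold_def locally_Euclidean_def by blast
  then obtain f g where fg: "homeomorphic_maps (subtopology M U) (subtopology (Euclidean_space n) V) f g"
    unfolding homeomorphic_space_def by blast
  have Usub: "U \<subseteq> topspace M" using UV openin_subset by blast
  have Vsub: "V \<subseteq> topspace (Euclidean_space n)" using UV openin_subset by blast
  have cf: "continuous_map (subtopology M U) (Euclidean_space n) f" and fV: "\<And>y. y \<in> U \<Longrightarrow> f y \<in> V"
    using fg Usub unfolding homeomorphic_maps_def continuous_map_in_subtopology by auto
  have cg: "continuous_map (subtopology (Euclidean_space n) V) M g" and gU: "\<And>q. q \<in> V \<Longrightarrow> g q \<in> U"
    using fg Vsub unfolding homeomorphic_maps_def continuous_map_in_subtopology by auto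
  have gf: "\<And>y. y \<in> U \<Longrightarrow> g (f y) = y" and fg': "\<And>q. q \<in> V \<Longrightarrow> f (g q) = q"
    using fg Usub Vsub unfolding homeomorphic_maps_def by auto
  \<comment> \<open>Preimages of coordinate boxes are used twice: one is the chart domain, whose
    image must be convex, and the small ones form the convex neighbourhoods of the last
    clause.\<close>
  have box: "\<exists>B e. openin M B \<and> y \<in> B \<and> B \<subseteq> W \<and> f ` B = coord_box n (f y) e"
    if W: "openin M W" "W \<subseteq> U" "y \<in> W" for W y
  proof -
    let ?Q = "{q \<in> V. g q \<in> W}"
    have "topspace (subtopology (Euclidean_space n) V) = V"
      using Vsub by auto
    then have "openin (subtopology (Euclidean_space n) V) ?Q"
      using openin_continuous_map_preimage[OF cg W(1)] by (simp only:)
    then have "openin (Euclidean_space n) ?Q"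
      using UV(3) openin_open_subtopology by blast
    moreover have "f y \<in> ?Q" using W fV gf by auto
    ultimately obtain e where e: "e > 0" "coord_box n (f y) e \<subseteq> ?Q" "f y \<in> coord_box n (f y) e"
      using coord_box_subset by blast
    let ?B = "{y' \<in> U. f y' \<in> coord_box n (f y) e}"
    have "topspace (subtopology M U) = U" using Usub by auto
    then have "openin (subtopology M U) ?B"
      using openin_continuous_map_preimage[OF cf openin_coord_box, of "f y" e] by (simp only:)
    then have "openin M ?B" using UV(1) openin_open_subtopology by blast
    moreover have "?B \<subseteq> W"
    proof
      fix y' assume "y' \<in> ?B"
      then have "y' \<in> U" "g (f y') \<in> W" using e(2) by auto
      then show "y' \<in> W" using gf by simp
    qed
    moreover have "f ` ?B = coord_box n (f y) e"
    proof
      show "coord_box n (f y) e \<subseteq> f ` ?B"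
      proof
        fix q assume q: "q \<in> coord_box n (f y) e"
        then have "q \<in> V" using e(2) by auto
        then have "g q \<in> ?B" "q = f (g q)" using gU fg' q by auto
        then show "q \<in> f ` ?B" by blast
      qed
    qed auto
    moreover have "y \<in> ?B" using e(3) W by auto
    ultimately show ?thesis by blast
  qed
  obtain D e where D: "openin M D" "x \<in> D" "D \<subseteq> U" "f ` D = coord_box n (f x) e"
    using box[OF UV(1) subset_refl UV(2)] by blast
  have Hc: "compact_space M" "Hausdorff_space M" using M by (auto simp: closed_manifold_def)
  then have nor: "normal_space M" and reg: "regular_space M"
    using compact_Hausdorff_or_regular_imp_normal_space compact_Hausdorff_imp_regular_space by blast+
  obtain P C where PC: "openin M P" "closedin M C" "x \<in> P" "P \<subseteq> C" "C \<subseteq> D"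
    using closed_nbhd[OF reg D(1,2)] by metis
  obtain P' C' where PC': "openin M P'" "closedin M C'" "x \<in> P'" "P' \<subseteq> C'" "C' \<subseteq> P"
    using closed_nbhd[OF reg PC(1,3)] by metis
  have "closedin M (topspace M - P)" "disjnt (topspace M - P) C'"
    using PC(1) PC'(5) by (auto simp: disjnt_def)
  then obtain h where h: "continuous_map M (top_of_set {0..1::real}) h" "h ` (topspace M - P) \<subseteq> {0}" "h ` C' \<subseteq> {1}"
    using Urysohn_lemma[OF nor _ PC'(2), of "topspace M - P" 0 1] by auto
  define ch where "ch = \<lparr>cdom = D, ccl = C, cin = P', cmap = f, cinv = g, cut = h\<rparr>"
  have h01: "\<forall>x\<in>topspace M. 0 \<le> h x \<and> h x \<le> 1" and hc: "continuous_map M euclideanreal h"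
    using h(1) by (auto simp: continuous_map_in_subtopology)
  have "continuous_map (subtopology M D) (powertop_real UNIV) f"
    using continuous_map_from_subtopology_mono[OF _ D(3)] cf
    unfolding Euclidean_space_def continuous_map_in_subtopology by blast
  moreover have "continuous_map (subtopology (powertop_real UNIV) (f ` D)) M g"
  proof -
    have "f ` D \<subseteq> V" using D(3) fV by auto
    moreover have "subtopology (Euclidean_space n) V = subtopology (powertop_real UNIV) V"
      using Vsub unfolding Euclidean_space_def subtopology_subtopology
      by (metis Euclidean_space_def Int_absorb1 inf_top_left topspace_Euclidean_space)
    ultimately show ?thesis
      using cg continuous_map_from_subtopology_mono by metis
  qed
  moreover have "\<forall>x\<in>D. \<forall>W. openin M W \<and> x \<in> W \<longrightarrow>
        (\<exists>B. openin M B \<and> x \<in> B \<and> B \<subseteq> W \<and> B \<subseteq> D \<and> cvx (f ` B))"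
  proof (intro ballI allI impI)
    fix y W assume y: "y \<in> D" "openin M W \<and> y \<in> W"
    then obtain B e' where "openin M B" "y \<in> B" "B \<subseteq> W \<inter> D" "f ` B = coord_box n (f y) e'"
    proof -
      have "openin M (W \<inter> D)" "W \<inter> D \<subseteq> U" "y \<in> W \<inter> D" using y D by auto
      then show thesis using box that by blast
    qed
    then show "\<exists>B. openin M B \<and> y \<in> B \<and> B \<subseteq> W \<and> B \<subseteq> D \<and> cvx (f ` B)"
      using cvx_coord_box by (metis le_inf_iff)
  qed
  moreover have "\<forall>y\<in>topspace M - C. h y = 0" "\<forall>y\<in>P'. h y = 1"
    using h(2,3) PC(4) PC'(4) by blast+
  moreover have "P' \<subseteq> C" "\<forall>y\<in>D. g (f y) = y" "cvx (f ` D)"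
    using PC PC' D gf cvx_coord_box[of n "f x" e] by auto
  ultimately have "convex_chart M ch"
    unfolding convex_chart_def ch_def chart.select_convs
    using D(1) PC(2,5) PC'(1) h01 hc by (intro conjI) assumption+
  then show ?thesis using PC' by (auto simp: ch_def)
qed

text \<open>A finite family of bump functions yields a continuous pseudometric whose unit balls are small.\<close>

lemma closed_manifold_mixing:
  assumes M: "closed_manifold n M"
  obtains chs :: "'a chart list" and d :: "'a \<Rightarrow> 'a \<Rightarrow> real"
  where "\<And>ch. ch \<in> set chs \<Longrightarrow> convex_chart M ch"
    "\<And>x. d x x = 0" "\<And>x y. d x y = d y x" "\<And>x y z. d x z \<le> d x y + d y z"
    "continuous_map (prod_topology M M) euclideanreal (\<lambda>(x, y). d x y)"
    "\<And>x I w y. x \<in> topspace M \<Longrightarrow> weights I w \<Longrightarrow> y ` I \<subseteq> {y \<in> topspace M. d x y < 1} \<Longrightarrow> mixable chs I w y"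
proof -
  have Hc: "compact_space M" "Hausdorff_space M" using M by (auto simp: closed_manifold_def)
  then have nor: "normal_space M"
    using compact_Hausdorff_or_regular_imp_normal_space by blast
  obtain C where C: "\<And>x. x \<in> topspace M \<Longrightarrow> convex_chart M (C x) \<and> x \<in> cin (C x)"
    using convex_chart_exists[OF M] by metis
  have "\<forall>U\<in>(cin \<circ> C) ` topspace M. openin M U" using C convex_chartD(3) by fastforce
  moreover have "topspace M \<subseteq> \<Union>((cin \<circ> C) ` topspace M)" using C by fastforce
  ultimately obtain F where F: "finite F" "F \<subseteq> topspace M" "topspace M \<subseteq> \<Union>((cin \<circ> C) ` F)"
    using Hc(1)[unfolded compact_space_alt] by (metis finite_subset_image)
  obtain fs where fs: "set fs = F" using F(1) finite_list by blast
  define chs where "chs = map C fs"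
  have chs: "convex_chart M ch" if "ch \<in> set chs" for ch
    using that C F(2) fs by (auto simp: chs_def)
  have "\<exists>B. openin M B \<and> x \<in> B \<and> (\<forall>I w y. weights I w \<longrightarrow> y ` I \<subseteq> B \<longrightarrow> mixable chs I w y)"
    if x: "x \<in> topspace M" for x
  proof -
    obtain p where "p \<in> F" "x \<in> cin (C p)" using F(3) x by auto
    then show ?thesis using mixable_nbhd[of chs M "C p" x] chs fs by (auto simp: chs_def)
  qed
  then have "\<forall>x\<in>topspace M. \<exists>B. openin M B \<and> x \<in> B \<and> (\<forall>I w y. weights I w \<longrightarrow> y ` I \<subseteq> B \<longrightarrow> mixable chs I w y)"
    by (rule ballI)
  then obtain B where B0: "\<forall>x\<in>topspace M. openin M (B x) \<and> x \<in> B x \<and> (\<forall>I w y. weights I w \<longrightarrow> y ` I \<subseteq> B x \<longrightarrow> mixable chs I w y)"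
    by (rule bchoice[THEN exE])
  then have B: "\<And>x. x \<in> topspace M \<Longrightarrow> openin M (B x) \<and> x \<in> B x"
    "\<And>x I w y. x \<in> topspace M \<Longrightarrow> weights I w \<Longrightarrow> y ` I \<subseteq> B x \<Longrightarrow> mixable chs I w y"
    by simp_all
  have "\<exists>h. continuous_map M euclideanreal h \<and> h x = 1 \<and> (\<forall>y\<in>topspace M - B x. h y = 0)"
    if x: "x \<in> topspace M" for x
  proof -
    have "closedin M {x}" using Hc(2) x by (simp add: closedin_Hausdorff_singleton)
    moreover have "closedin M (topspace M - B x)" "disjnt (topspace M - B x) {x}"
      using B0 x by (simp_all add: disjnt_def closedin_diff)
    ultimately obtain h where "continuous_map M euclideanreal h" "h ` (topspace M - B x) \<subseteq> {0}" "h ` {x} \<subseteq> {1}"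
      using Urysohn_lemma_alt[OF nor] by metis
    then show ?thesis by auto
  qed
  then have "\<forall>x\<in>topspace M. \<exists>h. continuous_map M euclideanreal h \<and> h x = 1 \<and> (\<forall>y\<in>topspace M - B x. h y = 0)"
    by (rule ballI)
  then obtain h where h: "\<forall>x\<in>topspace M. continuous_map M euclideanreal (h x) \<and> h x x = (1::real) \<and> (\<forall>y\<in>topspace M - B x. h x y = 0)"
    by (rule bchoice[THEN exE])
  let ?N = "\<lambda>x. {y \<in> topspace M. h x y \<in> {1/2<..}}"
  have "\<forall>U\<in>?N ` topspace M. openin M U"
    using h by (auto intro!: openin_continuous_map_preimage simp del: greaterThan_iff)
  moreover have "topspace M \<subseteq> \<Union>(?N ` topspace M)" using h by fastforce
  ultimately obtain G where G: "finite G" "G \<subseteq> topspace M" "topspace M \<subseteq> \<Union>(?N ` G)"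
    using Hc(1)[unfolded compact_space_alt] by (metis (no_types, lifting) finite_subset_image)
  \<comment> \<open>If h p x > 1/2 and y lies outside B p, where h p vanishes, the term for
    \<open>p\<close> alone exceeds 1/2. The factor 2 therefore puts the unit ball about x inside B
    p.\<close>
  define d where "d = (\<lambda>x y. 2 * (\<Sum>p\<in>G. \<bar>h p x - h p y\<bar>))"
  have "mixable chs I w y" if x: "x \<in> topspace M" "weights I w" "y ` I \<subseteq> {y \<in> topspace M. d x y < 1}" for x I w y
  proof -
    obtain p where p: "p \<in> G" "h p x > 1/2" using G(3) x(1) by auto
    have "y i \<in> B p" if "i \<in> I" for i
    proof (rule ccontr)
      have yi: "y i \<in> topspace M" "d x (y i) < 1" using x(3) that by auto
      assume "y i \<notin> B p"
      then have "h p (y i) = 0" using h p(1) G(2) yi by blast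
      moreover have "\<bar>h p x - h p (y i)\<bar> \<le> (\<Sum>p\<in>G. \<bar>h p x - h p (y i)\<bar>)"
        by (rule member_le_sum) (use p(1) G in auto)
      ultimately show False using yi(2) p(2) by (simp add: d_def)
    qed
    then show ?thesis using B(2)[of p I w y] p(1) G(2) x(2) by blast
  qed
  moreover have "continuous_map (prod_topology M M) euclideanreal (\<lambda>(x, y). d x y)"
  proof -
    have "continuous_map (prod_topology M M) euclideanreal (\<lambda>z. h p (fst z))"
         "continuous_map (prod_topology M M) euclideanreal (\<lambda>z. h p (snd z))" if "p \<in> G" for p
      using h that G(2) continuous_map_compose[OF continuous_map_fst, of M euclideanreal "h p" M]
        continuous_map_compose[OF continuous_map_snd, of M euclideanreal "h p" M] by (auto simp: o_def)
    then show ?thesis unfolding d_def case_prod_unfold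
      by (intro continuous_map_real_mult_left continuous_map_sum continuous_map_real_abs continuous_map_diff G)
  qed
  moreover have "d x z \<le> d x y + d y z" for x y z
  proof -
    have "(\<Sum>p\<in>G. \<bar>h p x - h p z\<bar>) \<le> (\<Sum>p\<in>G. \<bar>h p x - h p y\<bar> + \<bar>h p y - h p z\<bar>)"
      by (intro sum_mono) linarith
    then show ?thesis by (simp add: d_def sum.distrib)
  qed
  moreover have "d x y = d y x" "d x x = 0" for x y
    by (auto simp: d_def abs_minus_commute)
  ultimately show ?thesis using that[of chs d] chs by blast
qed

section \<open>Mixing points whose support varies\<close>

locale mixing_space =
  fixes M :: "'a topology" and chs :: "'a chart list" and d :: "'a \<Rightarrow> 'a \<Rightarrow> real"
    and v :: nat and a :: "nat \<Rightarrow> 'a"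
  assumes charts: "\<And>ch. ch \<in> set chs \<Longrightarrow> convex_chart M ch"
    and d_refl [simp]: "\<And>x. d x x = 0" and d_sym: "\<And>x y. d x y = d y x"
    and d_triangle: "\<And>x y z. d x z \<le> d x y + d y z"
    and d_continuous: "continuous_map (prod_topology M M) euclideanreal (\<lambda>(x, y). d x y)"
    and ball_mixable: "\<And>x I w y. x \<in> topspace M \<Longrightarrow> weights I w \<Longrightarrow> y ` I \<subseteq> {y \<in> topspace M. d x y < 1} \<Longrightarrow> mixable chs I w y"
    and a_in: "\<And>u. u < v \<Longrightarrow> a u \<in> topspace M"
begin

text \<open>The chosen index must carry positive weight: only such points are assumed close together
  and end at the common mixture. Among them the choice is immaterial.\<close>

definition mix_point :: "nat set \<Rightarrow> (nat \<Rightarrow> real) \<Rightarrow> (nat \<Rightarrow> 'a) \<Rightarrow> 'a" where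
  "mix_point I w y = mix chs I w y (SOME i. i \<in> I \<and> 0 < w i)"

text \<open>The subfamily may be any mixable one that contains the support, not just the support. A
  fixed subfamily can hence be kept while parameters vary and weights reach 0.\<close>

lemma mix_point_eq:
  assumes "I' \<subseteq> I" "weights I w" "\<And>i. i \<in> I - I' \<Longrightarrow> w i = 0"
    and "\<And>i. i \<in> I' \<Longrightarrow> w' i = w i" "\<And>i. i \<in> I' \<Longrightarrow> y' i = y i" "mixable chs I' w' y'" "i \<in> I'"
  shows "mix_point I w y = mix chs I' w' y' i"
proof -
  let ?i = "SOME i. i \<in> I \<and> 0 < w i"
  have "?i \<in> I \<and> 0 < w ?i"
    using weights_pos[OF assms(2)] by (metis (mono_tags, lifting) someI_ex)
  then have i: "?i \<in> I'" using assms(3) by force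
  have "mix_point I w y = mix chs I' w' y' ?i"
    unfolding mix_point_def
    by (rule mix_drop[symmetric]) (use assms i weights_finite in auto)
  then show ?thesis using mixable_imp_eq[OF assms(6) i assms(7)] by simp
qed

lemma weights_subset:
  assumes "weights I w" "I' \<subseteq> I" "\<And>i. i \<in> I - I' \<Longrightarrow> w i = 0" "\<And>i. i \<in> I' \<Longrightarrow> w' i = w i"
  shows "weights I' w'"
proof -
  have "sum w' I' = sum w I"
    using assms weights_finite by (intro sum.mono_neutral_cong_left) auto
  then show ?thesis using assms unfolding weights_def by auto
qed

lemma mix_point_const:
  assumes "weights I w" "x \<in> topspace M" "\<And>i. i \<in> I \<Longrightarrow> 0 < w i \<Longrightarrow> y i = x"
  shows "mix_point I w y = x"
proof -
  let ?I = "{i \<in> I. 0 < w i}"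
  have w: "weights ?I w"
    by (rule weights_subset[OF assms(1)]) (use assms(1) in \<open>auto simp: weights_def less_le\<close>)
  then obtain i where i: "i \<in> ?I" using weights_pos by blast
  have c: "mixable chs ?I w y \<and> (\<forall>i\<in>?I. mix chs ?I w y i = x)"
    by (rule const_mixable[where X=M]) (use charts w assms in auto)
  have "mix_point I w y = mix chs ?I w y i"
    by (rule mix_point_eq) (use assms c i in \<open>auto simp: weights_def less_le\<close>)
  then show ?thesis using c i by auto
qed

lemma d_continuous_compose:
  assumes "continuous_map Z M f" "continuous_map Z M g"
  shows "continuous_map Z euclideanreal (\<lambda>z. d (f z) (g z))"
proof -
  have "continuous_map Z (prod_topology M M) (\<lambda>z. (f z, g z))"
    using assms by (simp add: continuous_map_paired)
  then show ?thesis
    using continuous_map_compose[OF _ d_continuous] by (fastforce simp: o_def)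
qed

text \<open>Near \<open>z0\<close> the mixture is computed over the fixed subfamily I' of points
  within 1/2 of an active point i0. Each point moves by less than 1/8, and active points are within
  1/8 of a common centre, so a newly active point was within 4/8 of i0 at \<open>z0\<close> and
  belongs to I'. Points of I' stay within 1/2 + 1/8 < 1, hence remain mixable.\<close>

lemma mix_point_continuous:
  assumes w: "\<And>i. i \<in> I \<Longrightarrow> continuous_map Z euclideanreal (\<lambda>z. w z i)"
    and y: "\<And>i. i \<in> I \<Longrightarrow> continuous_map Z M (\<lambda>z. y z i)"
    and W: "\<And>z. z \<in> topspace Z \<Longrightarrow> weights I (w z)"
    and small: "\<And>z. z \<in> topspace Z \<Longrightarrow> \<exists>c. \<forall>i\<in>I. 0 < w z i \<longrightarrow> d c (y z i) < 1/8"
  shows "continuous_map Z M (\<lambda>z. mix_point I (w z) (y z))"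
proof (rule continuous_map_local)
  fix z0 assume z0: "z0 \<in> topspace Z"
  have fin: "finite I" using W z0 weights_finite by blast
  have top: "y z i \<in> topspace M" if "z \<in> topspace Z" "i \<in> I" for z i
    using y[OF that(2)] that(1) continuous_map_image_subset_topspace by blast
  obtain i0 where i0: "i0 \<in> I" "0 < w z0 i0" using weights_pos[OF W[OF z0]] by blast
  define I' where "I' = {i \<in> I. d (y z0 i0) (y z0 i) < 1/2}"
  define N where "N = {z \<in> topspace Z. w z i0 \<in> {0<..}} \<inter> ((\<Inter>i\<in>I. {z \<in> topspace Z. d (y z0 i) (y z i) \<in> {..<1/8}}) \<inter> topspace Z)"
  have o1: "openin Z {z \<in> topspace Z. w z i0 \<in> {0<..}}"
    by (rule openin_continuous_map_preimage[OF w[OF i0(1)]]) auto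
  have o2: "openin Z {z \<in> topspace Z. d (y z0 i) (y z i) \<in> {..<1/8}}" if "i \<in> I" for i
  proof (rule openin_continuous_map_preimage)
    show "continuous_map Z euclideanreal (\<lambda>z. d (y z0 i) (y z i))"
      using that z0 top y by (intro d_continuous_compose) auto
  qed auto
  have "openin Z N" unfolding N_def by (rule openin_Int[OF o1 openin_INT[OF fin o2]])
  moreover have "z0 \<in> N" using z0 i0 by (auto simp: N_def)
  moreover have "continuous_map (subtopology Z N) M (\<lambda>z. mix_point I (w z) (y z))"
  proof (rule continuous_map_eq)
    have sub: "z \<in> topspace Z" if "z \<in> N" for z using that by (auto simp: N_def)
    have zero: "w z i = 0" if z: "z \<in> N" and i: "i \<in> I - I'" for z i
    proof (rule ccontr)
      assume "w z i \<noteq> 0"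
      then have "0 < w z i" using W[OF sub[OF z]] i by (force simp: weights_def)
      obtain c where c: "\<forall>i\<in>I. 0 < w z i \<longrightarrow> d c (y z i) < 1/8" using small[OF sub[OF z]] by blast
      have "d c (y z i) < 1/8" "d c (y z i0) < 1/8" using c i i0 \<open>0 < w z i\<close> z by (auto simp: N_def)
      moreover have "d (y z0 i0) (y z i0) < 1/8" "d (y z0 i) (y z i) < 1/8"
        using z i i0 by (auto simp: N_def)
      moreover have "d (y z0 i0) (y z0 i) \<le> d (y z0 i0) (y z i0) + (d (y z i0) c + (d c (y z i) + d (y z i) (y z0 i)))"
        using d_triangle[of "y z0 i0" "y z0 i" "y z i0"] d_triangle[of "y z i0" "y z0 i" c]
          d_triangle[of c "y z0 i" "y z i"] by linarith
      ultimately have "d (y z0 i0) (y z0 i) < 1/2"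
        using d_sym[of "y z i0" c] d_sym[of "y z i" "y z0 i"] by linarith
      then show False using i by (auto simp: I'_def)
    qed
    have W': "weights I' (w z)" if "z \<in> N" for z
      by (rule weights_subset[OF W[OF sub[OF that]]]) (use zero that in \<open>auto simp: I'_def\<close>)
    have mx: "mixable chs I' (w z) (y z)" if z: "z \<in> N" for z
    proof (rule ball_mixable[OF top[OF z0 i0(1)] W'[OF z]])
      have "d (y z0 i0) (y z i) < 1" if "i \<in> I'" for i
      proof -
        have "d (y z0 i0) (y z0 i) < 1/2" "d (y z0 i) (y z i) < 1/8"
          using that z by (auto simp: N_def I'_def)
        then show ?thesis using d_triangle[of "y z0 i0" "y z i" "y z0 i"] by linarith
      qed
      then show "y z ` I' \<subseteq> {x \<in> topspace M. d (y z0 i0) x < 1}"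
        using top[OF sub[OF z]] by (auto simp: I'_def)
    qed
    have i0': "i0 \<in> I'" using i0 by (simp add: I'_def)
    show "continuous_map (subtopology Z N) M (\<lambda>z. mix chs I' (w z) (y z) i0)"
    proof (rule mix_continuous[OF charts])
      fix i assume "i \<in> I'"
      then have "i \<in> I" by (auto simp: I'_def)
      then show "continuous_map (subtopology Z N) euclideanreal (\<lambda>z. w z i)"
        "continuous_map (subtopology Z N) M (\<lambda>z. y z i)"
        using w y continuous_map_from_subtopology by blast+
    qed (use W' mx i0' in auto)
    show "mix chs I' (w z) (y z) i0 = mix_point I (w z) (y z)" if "z \<in> topspace (subtopology Z N)" for z
      by (rule mix_point_eq[symmetric, OF _ W zero _ _ mx i0'])
        (use that sub in \<open>auto simp: I'_def\<close>)
  qed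
  ultimately show "\<exists>N. openin Z N \<and> z0 \<in> N \<and> continuous_map (subtopology Z N) M (\<lambda>z. mix_point I (w z) (y z))"
    by blast
qed

definition wspace :: "(nat \<Rightarrow> real) set" where
  "wspace = {W. weights {..<v} W \<and> (\<forall>u\<ge>v. W u = 0)}"

definition near_weights :: "(nat \<Rightarrow> real) set" where
  "near_weights = {W \<in> wspace. \<exists>c. \<forall>u<v. 0 < W u \<longrightarrow> d c (a u) < 1/8}"

definition near_pairs :: "('a \<times> (nat \<Rightarrow> real)) set" where
  "near_pairs = {(x, W). x \<in> topspace M \<and> W \<in> wspace \<and> (\<forall>u<v. 0 < W u \<longrightarrow> d x (a u) < 1/8)}"

definition pt :: "(nat \<Rightarrow> real) \<Rightarrow> 'a" where
  "pt W = mix_point {..<v} W a"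

definition slide :: "real \<times> 'a \<times> (nat \<Rightarrow> real) \<Rightarrow> 'a" where
  "slide = (\<lambda>(s, x, W). mix_point {..v} (\<lambda>u. if u < v then s * W u else 1 - s) (\<lambda>u. if u < v then a u else x))"

lemma pt_continuous: "continuous_map (subtopology (powertop_real UNIV) near_weights) M pt"
  unfolding pt_def
  by (rule mix_point_continuous)
     (auto simp: near_weights_def wspace_def a_in intro: continuous_map_from_subtopology continuous_map_product_projection)

lemma slide_weights:
  assumes "W \<in> wspace" "0 \<le> s" "s \<le> 1"
  shows "weights {..v} (\<lambda>u. if u < v then s * W u else 1 - s)"
proof -
  have "(\<Sum>u\<le>v. if u < v then s * W u else 1 - s) = (\<Sum>u<v. s * W u) + (1 - s)"
    by (simp add: lessThan_Suc_atMost[symmetric])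
  then show ?thesis using assms by (auto simp: wspace_def weights_def simp flip: sum_distrib_left)
qed

text \<open>The point x is itself the common centre that \<open>mix_point_continuous\<close> asks
  for, since the net points of positive weight in a near pair lie within 1/8 of it.\<close>

lemma slide_continuous:
  "continuous_map (prod_topology (top_of_set {0..1}) (subtopology (prod_topology M (powertop_real UNIV)) near_pairs)) M slide"
proof -
  let ?Z = "prod_topology (top_of_set {0..1::real}) (subtopology (prod_topology M (powertop_real UNIV)) near_pairs)"
  have top: "topspace ?Z = {0..1} \<times> near_pairs"
    by (auto simp: near_pairs_def)
  have s: "continuous_map ?Z euclideanreal fst"
    by (rule continuous_map_into_fulltopology[OF continuous_map_fst])
  have snd: "continuous_map ?Z (prod_topology M (powertop_real UNIV)) snd"
    by (rule continuous_map_into_fulltopology[OF continuous_map_snd])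
  have x: "continuous_map ?Z M (\<lambda>z. fst (snd z))" and W: "continuous_map ?Z (powertop_real UNIV) (\<lambda>z. snd (snd z))"
    using continuous_map_compose[OF snd continuous_map_fst] continuous_map_compose[OF snd continuous_map_snd]
    by (simp_all add: o_def)
  have Wu: "continuous_map ?Z euclideanreal (\<lambda>z. snd (snd z) u)" for u
    using W by (simp add: continuous_map_componentwise_UNIV)
  have "continuous_map ?Z M (\<lambda>z. mix_point {..v} (\<lambda>u. if u < v then fst z * snd (snd z) u else 1 - fst z)
         (\<lambda>u. if u < v then a u else fst (snd z)))"
  proof (rule mix_point_continuous)
    show "continuous_map ?Z euclideanreal (\<lambda>z. if i < v then fst z * snd (snd z) i else 1 - fst z)" for i
      by (cases "i < v") (auto intro!: continuous_map_real_mult continuous_map_diff s Wu)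
    show "continuous_map ?Z M (\<lambda>z. if i < v then a i else fst (snd z))" for i
      by (cases "i < v") (auto intro!: x a_in)
    show "weights {..v} (\<lambda>u. if u < v then fst z * snd (snd z) u else 1 - fst z)" if "z \<in> topspace ?Z" for z
      by (rule slide_weights) (use that in \<open>auto simp: top near_pairs_def\<close>)
    show "\<exists>c. \<forall>i\<in>{..v}. 0 < (if i < v then fst z * snd (snd z) i else 1 - fst z)
              \<longrightarrow> d c (if i < v then a i else fst (snd z)) < 1 / 8" if "z \<in> topspace ?Z" for z
      using that unfolding top
      by (intro exI[of _ "fst (snd z)"]) (auto simp: near_pairs_def zero_less_mult_iff)
  qed
  then show ?thesis by (simp add: slide_def case_prod_unfold)
qed

lemma slide_0:
  assumes "(x, W) \<in> near_pairs"
  shows "slide (0, x, W) = x"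
  unfolding slide_def prod.case
  by (rule mix_point_const[OF slide_weights]) (use assms in \<open>auto simp: near_pairs_def split: if_splits\<close>)

text \<open>Both sides reduce to the mixture over the support of \<open>W\<close>, which is mixable
  because it lies in the unit ball about \<open>x\<close>.\<close>

lemma slide_1:
  assumes "(x, W) \<in> near_pairs"
  shows "slide (1, x, W) = pt W"
proof -
  let ?I = "{u. u < v \<and> 0 < W u}"
  have W: "W \<in> wspace" and x: "x \<in> topspace M" and near: "\<And>u. u < v \<Longrightarrow> 0 < W u \<Longrightarrow> d x (a u) < 1/8"
    using assms by (auto simp: near_pairs_def)
  have w: "weights {..<v} W" using W by (simp add: wspace_def)
  have w': "weights ?I W"
    by (rule weights_subset[OF w]) (use w in \<open>auto simp: weights_def less_le\<close>)
  then obtain i where i: "i \<in> ?I" using weights_pos by blast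
  have mx: "mixable chs ?I W a"
    by (rule ball_mixable[OF x w']) (use near a_in in force)
  have "pt W = mix chs ?I W a i" unfolding pt_def
    by (rule mix_point_eq[OF _ w _ _ _ mx i]) (use w in \<open>auto simp: weights_def less_le\<close>)
  moreover have "slide (1, x, W) = mix chs ?I W a i" unfolding slide_def prod.case
    by (rule mix_point_eq[OF _ slide_weights[OF W] _ _ _ mx i]) (use w in \<open>auto simp: weights_def less_le\<close>)
  ultimately show ?thesis by simp
qed

end

section \<open>Simplices from labelled grids\<close>

text \<open>The increasing map that omits the value \<open>k\<close>;
  \<open>simplical_face k\<close> is the unique way to pull a point back along it with a 0 at
  \<open>k\<close>.\<close>

definition skip :: "nat \<Rightarrow> nat \<Rightarrow> nat" where
  "skip k i = (if i < k then i else Suc i)"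

lemma inj_skip: "inj_on (skip k) A"
  by (auto simp: inj_on_def skip_def split: if_splits)

lemma atMost_Suc_skip: "k \<le> Suc p \<Longrightarrow> {..Suc p} = insert k (skip k ` {..p})"
proof -
  assume k: "k \<le> Suc p"
  have "i \<in> skip k ` {..p}" if "i \<le> Suc p" "i \<noteq> k" for i
    using that k by (intro image_eqI[of _ _ "if i < k then i else i - 1"]) (auto simp: skip_def)
  then show ?thesis using k by (auto simp: skip_def)
qed

lemma notin_skip: "k \<notin> skip k ` A"
  by (auto simp: skip_def split: if_splits)

lemma face_skip [simp]: "simplical_face k x (skip k i) = x i" "simplical_face k x k = 0"
  by (auto simp: simplical_face_def skip_def)

lemma face_of_skip: "x k = 0 \<Longrightarrow> simplical_face k (x \<circ> skip k) = x"
  by (force simp: simplical_face_def skip_def fun_eq_iff)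

lemma inj_simplical_face: "inj_on (simplical_face k) A"
  by (rule inj_onI) (metis face_skip(1) ext)

text \<open>Division by \<open>m\<close> turns these into barycentric coordinates. Coordinates
  beyond \<open>p\<close> vanish as in \<open>standard_simplex\<close>, so
  \<open>simplical_face\<close> acts on grids and simplices alike.\<close>

definition grid :: "nat \<Rightarrow> nat \<Rightarrow> (nat \<Rightarrow> nat) set" where
  "grid p m = {\<alpha>. (\<forall>i>p. \<alpha> i = 0) \<and> (\<Sum>i\<le>p. \<alpha> i) = m}"

lemma grid_le: "\<alpha> \<in> grid p m \<Longrightarrow> \<alpha> i \<le> m"
  by (cases "i \<le> p") (auto simp: grid_def intro: member_le_sum)

lemma finite_grid: "finite (grid p m)"
proof (rule finite_subset)
  show "grid p m \<subseteq> {f. \<forall>x. (x \<in> {..p} \<longrightarrow> f x \<in> {..m}) \<and> (x \<notin> {..p} \<longrightarrow> f x = 0)}"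
    using grid_le by (auto simp: grid_def)
qed (rule finite_set_of_finite_funs, auto)

lemma grid_face_iff:
  assumes "k \<le> Suc p"
  shows "simplical_face k \<alpha> \<in> grid (Suc p) m \<longleftrightarrow> \<alpha> \<in> grid p m"
proof -
  have "(\<Sum>i\<le>Suc p. simplical_face k \<alpha> i) = (\<Sum>i\<le>p. \<alpha> i)"
    unfolding atMost_Suc_skip[OF assms] by (simp add: notin_skip sum.reindex inj_skip)
  moreover have "(\<forall>i>Suc p. simplical_face k \<alpha> i = 0) \<longleftrightarrow> (\<forall>i>p. \<alpha> i = 0)"
  proof
    assume h: "\<forall>i>Suc p. simplical_face k \<alpha> i = 0"
    show "\<forall>i>p. \<alpha> i = 0"
    proof (intro allI impI)
      fix i assume "i > p"
      then have "skip k i > Suc p" using assms by (auto simp: skip_def)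
      then have "simplical_face k \<alpha> (skip k i) = 0" using h by blast
      then show "\<alpha> i = 0" by simp
    qed
  qed (use assms in \<open>auto simp: simplical_face_def\<close>)
  ultimately show ?thesis unfolding grid_def by simp
qed

lemma grid_face:
  assumes k: "k \<le> Suc p"
  shows "{\<alpha> \<in> grid (Suc p) m. \<alpha> k = 0} = simplical_face k ` grid p m"
proof (rule subset_antisym; rule subsetI)
  fix \<alpha> assume "\<alpha> \<in> {\<alpha> \<in> grid (Suc p) m. \<alpha> k = 0}"
  then have "\<alpha> \<in> grid (Suc p) m" "simplical_face k (\<alpha> \<circ> skip k) = \<alpha>" using face_of_skip by auto
  then show "\<alpha> \<in> simplical_face k ` grid p m"
    using grid_face_iff[OF k, of "\<alpha> \<circ> skip k"] by (metis imageI)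
qed (use grid_face_iff[OF k] in auto)

text \<open>Products of hat functions are compatible with faces, so no triangulation of the grid is needed.\<close>

definition hat :: "nat \<Rightarrow> nat \<Rightarrow> (nat \<Rightarrow> nat) \<Rightarrow> (nat \<Rightarrow> real) \<Rightarrow> real" where
  "hat p m \<alpha> t = (\<Prod>i\<le>p. max 0 (1 - \<bar>m * t i - \<alpha> i\<bar>))"

lemma hat_nonneg: "0 \<le> hat p m \<alpha> t"
  unfolding hat_def by (rule prod_nonneg) auto

lemma hat_pos_iff: "0 < hat p m \<alpha> t \<longleftrightarrow> (\<forall>i\<le>p. \<bar>m * t i - \<alpha> i\<bar> < 1)"
proof -
  have "hat p m \<alpha> t = 0 \<longleftrightarrow> \<not> (\<forall>i\<le>p. \<bar>m * t i - \<alpha> i\<bar> < 1)"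
  proof -
    have "hat p m \<alpha> t = 0 \<longleftrightarrow> (\<exists>i\<in>{..p}. max 0 (1 - \<bar>m * t i - \<alpha> i\<bar>) = 0)"
      unfolding hat_def by (rule prod_zero_iff) simp
    moreover have "max 0 x = 0 \<longleftrightarrow> \<not> 0 < x" for x :: real by (auto simp: max_def)
    ultimately show ?thesis by auto
  qed
  then show ?thesis using hat_nonneg[of p m \<alpha> t] by auto
qed

lemma hat_face:
  assumes "k \<le> Suc p"
  shows "hat (Suc p) m (simplical_face k \<alpha>) (simplical_face k t) = hat p m \<alpha> t"
  unfolding hat_def atMost_Suc_skip[OF assms]
  by (simp add: notin_skip prod.reindex inj_skip)

lemma hat_face_zero:
  assumes "k \<le> Suc p" "\<alpha> k \<noteq> 0"
  shows "hat (Suc p) m \<alpha> (simplical_face k t) = 0"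
  unfolding hat_def by (rule prod_zero) (use assms in \<open>auto intro!: bexI[of _ k] simp del: prod.atMost_Suc\<close>)

text \<open>Rounding the partial sums of the coordinates down gives a grid point near a given point.\<close>

lemma near_grid_point:
  fixes t :: "nat \<Rightarrow> real"
  assumes "t \<in> standard_simplex p"
  shows "\<exists>\<alpha>\<in>grid p m. \<forall>i. \<bar>real m * t i - real (\<alpha> i)\<bar> < 1"
proof -
  define X where "X = (\<lambda>i. m * (\<Sum>j<i. t j))"
  have t: "0 \<le> t i" "i > p \<Longrightarrow> t i = 0" "(\<Sum>i\<le>p. t i) = 1" for i
    using assms by (auto simp: standard_simplex_def)
  have X: "X (Suc i) = X i + m * t i" "X 0 = 0" for i
    by (simp_all add: X_def algebra_simps)
  have X3: "X (Suc p) = m" unfolding X_def lessThan_Suc_atMost using t(3) by simp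
  have mono: "\<lfloor>X i\<rfloor> \<le> \<lfloor>X (Suc i)\<rfloor>" for i using X(1) t(1) by (intro floor_mono) simp
  \<comment> \<open>The floors are monotone, so each difference is a natural number; the sum
    telescopes to \<lfloor>X (Suc p)\<rfloor> = m, and two floors change a difference by less than
    1.\<close>
  define \<alpha> where "\<alpha> = (\<lambda>i. nat (\<lfloor>X (Suc i)\<rfloor> - \<lfloor>X i\<rfloor>))"
  have "int (\<Sum>i<q. \<alpha> i) = \<lfloor>X q\<rfloor>" for q
    by (induction q) (use mono X(2) in \<open>auto simp: \<alpha>_def\<close>)
  from this[of "Suc p"] have "int (\<Sum>i\<le>p. \<alpha> i) = int m"
    unfolding X3 lessThan_Suc_atMost floor_of_nat .
  then have "(\<Sum>i\<le>p. \<alpha> i) = m" by (simp only: of_nat_eq_iff)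
  moreover have "\<alpha> i = 0" if "i > p" for i using X(1)[of i] t(2)[OF that] by (simp add: \<alpha>_def)
  moreover have "\<bar>real m * t i - real (\<alpha> i)\<bar> < 1" for i
  proof -
    have "real (\<alpha> i) = \<lfloor>X (Suc i)\<rfloor> - \<lfloor>X i\<rfloor>" using mono[of i] by (simp add: \<alpha>_def)
    then show ?thesis using X(1)[of i] floor_correct[of "X i"] floor_correct[of "X (Suc i)"] by linarith
  qed
  ultimately show ?thesis by (auto simp: grid_def)
qed

text \<open>Products of hats are not a partition of unity on the simplex, hence the division by
  their total, which \<open>near_grid_point\<close> keeps positive. Collecting the weight by label
  yields a point of the weight space of the net.\<close>

definition label_weight :: "nat \<Rightarrow> nat \<Rightarrow> ((nat \<Rightarrow> nat) \<Rightarrow> nat) \<Rightarrow> (nat \<Rightarrow> real) \<Rightarrow> nat \<Rightarrow> real" where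
  "label_weight p m \<tau> t u = (\<Sum>\<alpha>\<in>{\<alpha> \<in> grid p m. \<tau> \<alpha> = u}. hat p m \<alpha> t) / (\<Sum>\<alpha>\<in>grid p m. hat p m \<alpha> t)"

lemma sum_hat_pos: "t \<in> standard_simplex p \<Longrightarrow> 0 < (\<Sum>\<alpha>\<in>grid p m. hat p m \<alpha> t)"
  using near_grid_point[of t p m] by (metis finite_grid hat_nonneg hat_pos_iff sum_pos2)

text \<open>On the face opposite \<open>k\<close> a grid point with nonzero \<open>k\<close>-th
  coordinate is at distance at least 1 in that coordinate, so its hat vanishes; the other grid
  points are exactly the grid of the face.\<close>

lemma label_weight_face:
  assumes "k \<le> Suc p"
  shows "label_weight (Suc p) m \<tau> (simplical_face k t) = label_weight p m (\<tau> \<circ> simplical_face k) t"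
proof
  fix u
  have *: "(\<Sum>\<alpha>\<in>{\<alpha> \<in> grid (Suc p) m. P \<alpha>}. hat (Suc p) m \<alpha> (simplical_face k t))
      = (\<Sum>\<alpha>\<in>{\<alpha> \<in> grid p m. P (simplical_face k \<alpha>)}. hat p m \<alpha> t)" for P
  proof -
    have "(\<Sum>\<alpha>\<in>{\<alpha> \<in> grid (Suc p) m. P \<alpha>}. hat (Suc p) m \<alpha> (simplical_face k t))
      = (\<Sum>\<alpha>\<in>simplical_face k ` {\<alpha> \<in> grid p m. P (simplical_face k \<alpha>)}. hat (Suc p) m \<alpha> (simplical_face k t))"
    proof (rule sum.mono_neutral_right)
      show "\<forall>\<alpha>\<in>{\<alpha> \<in> grid (Suc p) m. P \<alpha>} - simplical_face k ` {\<alpha> \<in> grid p m. P (simplical_face k \<alpha>)}.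
          hat (Suc p) m \<alpha> (simplical_face k t) = 0"
      proof
        fix \<alpha> assume \<alpha>: "\<alpha> \<in> {\<alpha> \<in> grid (Suc p) m. P \<alpha>} - simplical_face k ` {\<alpha> \<in> grid p m. P (simplical_face k \<alpha>)}"
        have "\<alpha> k \<noteq> 0"
        proof
          assume "\<alpha> k = 0"
          then have "\<alpha> \<in> simplical_face k ` grid p m"
            using \<alpha> unfolding grid_face[OF assms, symmetric] by simp
          then obtain \<beta> where "\<beta> \<in> grid p m" "\<alpha> = simplical_face k \<beta>" by (rule imageE) simp
          then have "\<beta> \<in> {\<alpha> \<in> grid p m. P (simplical_face k \<alpha>)}" using \<alpha> by simp
          from imageI[OF this, of "simplical_face k"] show False
            using \<alpha> \<open>\<alpha> = simplical_face k \<beta>\<close> by simp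
        qed
        then show "hat (Suc p) m \<alpha> (simplical_face k t) = 0" by (rule hat_face_zero[OF assms])
      qed
    qed (use finite_grid grid_face_iff[OF assms] in auto)
    then show ?thesis by (simp add: sum.reindex inj_simplical_face hat_face[OF assms])
  qed
  from *[of "\<lambda>_. True"] *[of "\<lambda>\<alpha>. \<tau> \<alpha> = u"]
  show "label_weight (Suc p) m \<tau> (simplical_face k t) u = label_weight p m (\<tau> \<circ> simplical_face k) t u"
    by (simp add: label_weight_def)
qed

lemma label_weight_pos:
  fixes t :: "nat \<Rightarrow> real"
  assumes "t \<in> standard_simplex p" "0 < label_weight p m \<tau> t u"
  shows "\<exists>\<alpha>\<in>grid p m. \<tau> \<alpha> = u \<and> (\<forall>i. \<bar>real m * t i - real (\<alpha> i)\<bar> < 1)"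
proof -
  have "(\<Sum>\<alpha>\<in>{\<alpha> \<in> grid p m. \<tau> \<alpha> = u}. hat p m \<alpha> t) \<noteq> 0"
    using assms(2) by (auto simp: label_weight_def)
  then obtain \<alpha> where \<alpha>: "\<alpha> \<in> grid p m" "\<tau> \<alpha> = u" "hat p m \<alpha> t \<noteq> 0"
    by (metis (mono_tags, lifting) mem_Collect_eq sum.neutral)
  then have "\<bar>real m * t i - real (\<alpha> i)\<bar> < 1" for i
    using hat_pos_iff[of p m \<alpha> t] hat_nonneg[of p m \<alpha> t] assms(1)
    by (cases "i \<le> p") (auto simp: grid_def standard_simplex_def)
  then show ?thesis using \<alpha> by blast
qed

lemma label_weight_nonneg: "0 \<le> label_weight p m \<tau> t u"
  unfolding label_weight_def by (intro divide_nonneg_nonneg sum_nonneg hat_nonneg)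

lemma continuous_label_weight:
  "continuous_map (subtopology (powertop_real UNIV) (standard_simplex p)) (powertop_real UNIV) (label_weight p m \<tau>)"
proof -
  have "continuous_map (subtopology (powertop_real UNIV) (standard_simplex p)) euclideanreal (\<lambda>t. t i)" for i
    by (intro continuous_map_from_subtopology continuous_map_product_projection) auto
  then have hat: "continuous_map (subtopology (powertop_real UNIV) (standard_simplex p)) euclideanreal (hat p m \<alpha>)" for \<alpha>
    unfolding hat_def
    by (intro continuous_map_prod continuous_map_real_max continuous_map_diff continuous_map_real_abs continuous_map_real_mult_left) auto
  show ?thesis unfolding continuous_map_componentwise_UNIV label_weight_def
    by (intro allI continuous_map_real_divide continuous_map_sum hat)
      (use sum_hat_pos[THEN less_imp_neq, symmetric] in \<open>auto simp: finite_grid\<close>)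
qed

lemma label_weight_cong:
  assumes "\<And>\<alpha>. \<alpha> \<in> grid p m \<Longrightarrow> \<tau> \<alpha> = \<tau>' \<alpha>"
  shows "label_weight p m \<tau> = label_weight p m \<tau>'"
proof -
  have "{\<alpha> \<in> grid p m. \<tau> \<alpha> = u} = {\<alpha> \<in> grid p m. \<tau>' \<alpha> = u}" for u
    using assms by auto
  then show ?thesis by (simp add: label_weight_def fun_eq_iff)
qed

context mixing_space begin

lemma label_weight_wspace:
  assumes "t \<in> standard_simplex p" "\<And>\<alpha>. \<alpha> \<in> grid p m \<Longrightarrow> \<tau> \<alpha> < v"
  shows "label_weight p m \<tau> t \<in> wspace"
proof -
  have "(\<Sum>u<v. \<Sum>\<alpha>\<in>{\<alpha> \<in> grid p m. \<tau> \<alpha> = u}. hat p m \<alpha> t) = (\<Sum>\<alpha>\<in>grid p m. hat p m \<alpha> t)"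
    by (rule sum.group) (use assms(2) finite_grid in auto)
  then have "(\<Sum>u<v. label_weight p m \<tau> t u) = 1"
    using sum_hat_pos[OF assms(1), of m] by (simp add: label_weight_def flip: sum_divide_distrib)
  moreover have "label_weight p m \<tau> t u = 0" if "u \<ge> v" for u
    using label_weight_pos[OF assms(1), of m \<tau> u] label_weight_nonneg[of p m \<tau> t u] assms(2) that
    by fastforce
  ultimately show ?thesis by (simp add: wspace_def weights_def label_weight_nonneg)
qed

definition realize :: "nat \<Rightarrow> nat \<Rightarrow> ((nat \<Rightarrow> nat) \<Rightarrow> nat) \<Rightarrow> (nat \<Rightarrow> real) \<Rightarrow> 'a" where
  "realize p m \<tau> = restrict (pt \<circ> label_weight p m \<tau>) (standard_simplex p)"

definition small_labelling :: "nat \<Rightarrow> nat \<Rightarrow> ((nat \<Rightarrow> nat) \<Rightarrow> nat) \<Rightarrow> bool" where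
  "small_labelling p m \<tau> \<longleftrightarrow> (\<forall>\<alpha>\<in>grid p m. \<tau> \<alpha> < v) \<and>
     (\<forall>t\<in>standard_simplex p. \<exists>c. \<forall>\<alpha>\<in>grid p m. (\<forall>i. \<bar>m * t i - \<alpha> i\<bar> < 1) \<longrightarrow> d c (a (\<tau> \<alpha>)) < 1/8)"

text \<open>Labels of positive weight at t come from grid points less than one step from t in each
  coordinate. \<open>small_labelling\<close> puts them near a common centre, so the weights stay in
  \<open>near_weights\<close>, where \<open>pt\<close> is continuous.\<close>

lemma singular_simplex_realize:
  assumes "small_labelling p m \<tau>"
  shows "singular_simplex p M (realize p m \<tau>)"
proof -
  have "label_weight p m \<tau> t \<in> near_weights" if t: "t \<in> standard_simplex p" for t
  proof -
    obtain c where c: "\<forall>\<alpha>\<in>grid p m. (\<forall>i. \<bar>m * t i - \<alpha> i\<bar> < 1) \<longrightarrow> d c (a (\<tau> \<alpha>)) < 1/8"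
      using assms t unfolding small_labelling_def by blast
    have "d c (a u) < 1/8" if "0 < label_weight p m \<tau> t u" for u
      using label_weight_pos[OF t that] c by blast
    then show ?thesis
      using label_weight_wspace[OF t, of m \<tau>] assms unfolding near_weights_def small_labelling_def by blast
  qed
  then have "continuous_map (subtopology (powertop_real UNIV) (standard_simplex p))
      (subtopology (powertop_real UNIV) near_weights) (label_weight p m \<tau>)"
    using continuous_label_weight by (auto simp: continuous_map_in_subtopology)
  from continuous_map_compose[OF this pt_continuous]
  have "continuous_map (subtopology (powertop_real UNIV) (standard_simplex p)) M (realize p m \<tau>)"
    by (rule continuous_map_eq) (auto simp: realize_def)
  then show ?thesis by (simp add: singular_simplex_def realize_def)
qed

lemma singular_face_realize:
  assumes "k \<le> Suc p"
  shows "singular_face (Suc p) k (realize (Suc p) m \<tau>) = realize p m (\<tau> \<circ> simplical_face k)"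
proof
  fix t
  show "singular_face (Suc p) k (realize (Suc p) m \<tau>) t = realize p m (\<tau> \<circ> simplical_face k) t"
    using simplical_face_in_standard_simplex[of "Suc p" k t] assms
    by (auto simp: singular_face_def realize_def label_weight_face)
qed

lemma realize_cong:
  assumes "\<And>\<alpha>. \<alpha> \<in> grid p m \<Longrightarrow> \<tau> \<alpha> = \<tau>' \<alpha>"
  shows "realize p m \<tau> = realize p m \<tau>'"
  using label_weight_cong[OF assms] by (simp add: realize_def)

text \<open>The pairs of a simplex and its labels form a cycle in the space of nearby pairs, on which
  sliding every point towards the mixture of its labels is a homotopy.\<close>

lemma realize_homologous:
  fixes J :: nat and \<sigma> :: "nat \<Rightarrow> (nat \<Rightarrow> real) \<Rightarrow> 'a" and \<zeta> :: "nat \<Rightarrow> (nat \<Rightarrow> nat) \<Rightarrow> nat" and b :: "nat \<Rightarrow> int"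
  assumes \<sigma>: "\<And>j. j < J \<Longrightarrow> singular_simplex n M (\<sigma> j)"
    and cyc: "chain_boundary n (\<Sum>j<J. frag_cmul (b j) (frag_of (\<sigma> j))) = 0"
    and lab: "\<And>j \<alpha>. j < J \<Longrightarrow> \<alpha> \<in> grid n m \<Longrightarrow> \<zeta> j \<alpha> < v"
    and near: "\<And>j t \<alpha>. j < J \<Longrightarrow> t \<in> standard_simplex n \<Longrightarrow> \<alpha> \<in> grid n m \<Longrightarrow>
        (\<forall>i. \<bar>m * t i - \<alpha> i\<bar> < 1) \<Longrightarrow> d (\<sigma> j t) (a (\<zeta> j \<alpha>)) < 1/8"
    and cons: "\<And>j k j' k' \<alpha>. n \<noteq> 0 \<Longrightarrow> j < J \<Longrightarrow> j' < J \<Longrightarrow> k \<le> n \<Longrightarrow> k' \<le> n \<Longrightarrow>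
        singular_face n k (\<sigma> j) = singular_face n k' (\<sigma> j') \<Longrightarrow> \<alpha> \<in> grid (n - 1) m \<Longrightarrow>
        \<zeta> j (simplical_face k \<alpha>) = \<zeta> j' (simplical_face k' \<alpha>)"
  shows "\<exists>c. singular_chain (Suc n) M c \<and> chain_boundary (Suc n) c =
     (\<Sum>j<J. frag_cmul (b j) (frag_of (\<sigma> j))) - (\<Sum>j<J. frag_cmul (b j) (frag_of (realize n m (\<zeta> j))))"
proof -
  let ?S = "subtopology (prod_topology M (powertop_real UNIV)) near_pairs"
  define \<rho> where "\<rho> = (\<lambda>j. restrict (\<lambda>t. (\<sigma> j t, label_weight n m (\<zeta> j) t)) (standard_simplex n))"
  have np: "(\<sigma> j t, label_weight n m (\<zeta> j) t) \<in> near_pairs" if j: "j < J" and t: "t \<in> standard_simplex n" for j t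
  proof -
    have "\<sigma> j t \<in> topspace M" using \<sigma>[OF j] t
      by (metis continuous_map_image_subset_topspace image_subset_iff singular_simplex_def topspace_standard_simplex)
    then show ?thesis
      using label_weight_wspace[OF t lab[OF j]] label_weight_pos[OF t] near[OF j t]
      unfolding near_pairs_def by auto blast
  qed
  have \<rho>: "singular_simplex n ?S (\<rho> j)" if j: "j < J" for j
  proof -
    have "continuous_map (subtopology (powertop_real UNIV) (standard_simplex n)) (prod_topology M (powertop_real UNIV))
        (\<lambda>t. (\<sigma> j t, label_weight n m (\<zeta> j) t))"
      using \<sigma>[OF j] continuous_label_weight[of n m "\<zeta> j"] by (simp add: continuous_map_paired singular_simplex_def)
    then have "continuous_map (subtopology (powertop_real UNIV) (standard_simplex n)) ?S
        (\<lambda>t. (\<sigma> j t, label_weight n m (\<zeta> j) t))"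
      using np[OF j] by (auto simp: continuous_map_in_subtopology)
    then have "continuous_map (subtopology (powertop_real UNIV) (standard_simplex n)) ?S (\<rho> j)"
      by (rule continuous_map_eq) (auto simp: \<rho>_def)
    then show ?thesis by (simp add: singular_simplex_def \<rho>_def)
  qed
  let ?c = "\<Sum>j<J. frag_cmul (b j) (frag_of (\<rho> j))"
  have chn: "singular_chain n ?S ?c"
    by (intro singular_chain_sum singular_chain_cmul) (simp add: \<rho> singular_chain_of)
  have bd: "chain_boundary n ?c = 0"
  proof (cases n)
    case 0
    then show ?thesis by (simp add: chain_boundary_def)
  next
    case (Suc p)
    \<comment> \<open>Sends a face of some \<sigma> j to the face of \<rho> j above it. By
      \<open>cons\<close> equal faces carry equal labels, so this is well defined, and the boundary
      of the lifted chain is the image under R of the vanishing boundary below.\<close>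
    define R where "R = (\<lambda>f. SOME g. \<exists>j<J. \<exists>k\<le>n. f = singular_face n k (\<sigma> j) \<and> g = singular_face n k (\<rho> j))"
    have R: "R (singular_face n k (\<sigma> j)) = singular_face n k (\<rho> j)" if jk: "j < J" "k \<le> n" for j k
    proof -
      have "\<exists>g. \<exists>j'<J. \<exists>k'\<le>n. singular_face n k (\<sigma> j) = singular_face n k' (\<sigma> j') \<and> g = singular_face n k' (\<rho> j')"
        using jk by blast
      from someI_ex[OF this] obtain j' k' where jk': "j' < J" "k' \<le> n"
          "singular_face n k (\<sigma> j) = singular_face n k' (\<sigma> j')" "R (singular_face n k (\<sigma> j)) = singular_face n k' (\<rho> j')"
        unfolding R_def by blast
      have "label_weight p m (\<zeta> j \<circ> simplical_face k) = label_weight p m (\<zeta> j' \<circ> simplical_face k')"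
        using cons[OF _ jk(1) jk'(1) jk(2) jk'(2,3)] Suc by (intro label_weight_cong) auto
      then have "label_weight n m (\<zeta> j) (simplical_face k t) = label_weight n m (\<zeta> j') (simplical_face k' t)" for t
        using label_weight_face jk(2) jk'(2) Suc by simp
      moreover have "\<sigma> j (simplical_face k t) = \<sigma> j' (simplical_face k' t)" if "t \<in> standard_simplex p" for t
        using fun_cong[OF jk'(3), of t] that Suc by (simp add: singular_face_def)
      ultimately have "singular_face n k (\<rho> j) = singular_face n k' (\<rho> j')"
        using simplical_face_in_standard_simplex[of n] jk jk' Suc
        by (auto simp: singular_face_def \<rho>_def fun_eq_iff restrict_def)
      then show ?thesis using jk' by simp
    qed
    have "chain_boundary n ?c = (\<Sum>j<J. frag_cmul (b j) (\<Sum>k\<le>n. frag_cmul ((-1)^k) (frag_of (singular_face n k (\<rho> j)))))"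
      using Suc by (simp add: chain_boundary_sum chain_boundary_cmul chain_boundary_of)
    also have "\<dots> = (\<Sum>j<J. frag_cmul (b j) (\<Sum>k\<le>n. frag_cmul ((-1)^k) (frag_of (R (singular_face n k (\<sigma> j))))))"
      using R by (intro sum.cong arg_cong2[where f=frag_cmul]) auto
    also have "\<dots> = frag_extend (frag_of \<circ> R) (\<Sum>j<J. frag_cmul (b j) (\<Sum>k\<le>n. frag_cmul ((-1)^k) (frag_of (singular_face n k (\<sigma> j)))))"
      by (simp add: frag_extend_sum frag_extend_cmul o_def)
    also have "(\<Sum>j<J. frag_cmul (b j) (\<Sum>k\<le>n. frag_cmul ((-1)^k) (frag_of (singular_face n k (\<sigma> j)))))
        = chain_boundary n (\<Sum>j<J. frag_cmul (b j) (frag_of (\<sigma> j)))"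
      using Suc by (simp add: chain_boundary_sum chain_boundary_cmul chain_boundary_of)
    finally show ?thesis using cyc by simp
  qed
  have cyc': "singular_relcycle n ?S {} ?c" using chn bd by (simp add: singular_cycle)
  have "homotopic_with (\<lambda>h. h \<in> {} \<rightarrow> {}) ?S M fst (\<lambda>xW. pt (snd xW))"
    unfolding homotopic_with_def
  proof (intro exI conjI)
    \<comment> \<open>The endpoint equations of the homotopy are demanded at all arguments, also
      outside \<open>near_pairs\<close>; the other two branches provide values there.\<close>
    show "continuous_map (prod_topology (top_of_set {0..1}) ?S) M (\<lambda>z. if snd z \<in> near_pairs then slide z else if fst z = 0 then fst (snd z) else pt (snd (snd z)))"
      by (rule continuous_map_eq[OF slide_continuous]) auto
  qed (auto simp: slide_0 slide_1)
  from homotopic_imp_homologous_rel_chain_maps[OF this cyc']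
  have "homologous_rel n M {} (chain_map n fst ?c) (chain_map n (\<lambda>xW. pt (snd xW)) ?c)" .
  moreover have "chain_map n fst ?c = (\<Sum>j<J. frag_cmul (b j) (frag_of (\<sigma> j)))"
  proof -
    have "simplex_map n fst (\<rho> j) = \<sigma> j" if "j < J" for j
      using \<sigma>[OF that] unfolding simplex_map_def \<rho>_def singular_simplex_def
      by (auto simp: fun_eq_iff restrict_def extensional_def)
    then show ?thesis by (simp add: chain_map_sum)
  qed
  moreover have "chain_map n (\<lambda>xW. pt (snd xW)) ?c = (\<Sum>j<J. frag_cmul (b j) (frag_of (realize n m (\<zeta> j))))"
  proof -
    have "simplex_map n (\<lambda>xW. pt (snd xW)) (\<rho> j) = realize n m (\<zeta> j)" for j
      unfolding simplex_map_def \<rho>_def realize_def by (auto simp: fun_eq_iff restrict_def)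
    then show ?thesis by (simp add: chain_map_sum)
  qed
  ultimately show ?thesis
    by (auto simp: homologous_rel_def singular_boundary)
qed

end

section \<open>The norm of integral chains\<close>

lemma lookup_real_of_chain [simp]: "Poly_Mapping.lookup (real_of_chain c) f = real_of_int (Poly_Mapping.lookup c f)"
  by (simp add: real_of_chain_def map.rep_eq when_def)

lemma keys_real_of_chain [simp]: "Poly_Mapping.keys (real_of_chain c) = Poly_Mapping.keys c"
  by (auto simp: in_keys_iff)

text \<open>The incidence number of \<open>g\<close> in the boundary of \<open>f\<close>. Several
  faces of \<open>f\<close> may equal \<open>g\<close>, so it need not be 0 or a sign.\<close>

definition face_sign :: "nat \<Rightarrow> ((nat \<Rightarrow> real) \<Rightarrow> 'a) \<Rightarrow> ((nat \<Rightarrow> real) \<Rightarrow> 'a) \<Rightarrow> int" where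
  "face_sign p f g = (\<Sum>k\<le>p. if singular_face p k f = g then (-1) ^ k else 0)"

lemma lookup_chain_boundary:
  assumes "finite A" "Poly_Mapping.keys c \<subseteq> A"
  shows "Poly_Mapping.lookup (chain_boundary (Suc p) c) g = (\<Sum>f\<in>A. Poly_Mapping.lookup c f * face_sign (Suc p) f g)"
proof -
  have "Poly_Mapping.lookup (chain_boundary (Suc p) c) g = (\<Sum>f\<in>Poly_Mapping.keys c. Poly_Mapping.lookup c f * face_sign (Suc p) f g)"
    unfolding chain_boundary_def frag_extend_def face_sign_def
    by (simp add: lookup_sum when_def if_distrib[of "\<lambda>x. _ * x"] del: sum.atMost_Suc cong: if_cong)
       (auto intro!: sum.cong)
  also have "\<dots> = (\<Sum>f\<in>A. Poly_Mapping.lookup c f * face_sign (Suc p) f g)"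
    using assms by (intro sum.mono_neutral_left) (auto simp: in_keys_iff)
  finally show ?thesis .
qed

lemma lookup_real_chain_boundary:
  assumes "finite A" "Poly_Mapping.keys c \<subseteq> A"
  shows "Poly_Mapping.lookup (real_chain_boundary (Suc p) c) g = (\<Sum>f\<in>A. Poly_Mapping.lookup c f * real_of_int (face_sign (Suc p) f g))"
proof -
  have "Poly_Mapping.lookup (real_chain_boundary (Suc p) c) g = (\<Sum>f\<in>Poly_Mapping.keys c. Poly_Mapping.lookup c f * real_of_int (face_sign (Suc p) f g))"
    unfolding real_chain_boundary_def face_sign_def
    by (simp add: lookup_sum lookup_single when_def sum_distrib_left if_distrib[of real_of_int]
        if_distrib[of "\<lambda>x. _ * x"] mult.commute del: sum.atMost_Suc cong: if_cong)
  also have "\<dots> = (\<Sum>f\<in>A. Poly_Mapping.lookup c f * real_of_int (face_sign (Suc p) f g))"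
    using assms by (intro sum.mono_neutral_left) (auto simp: in_keys_iff)
  finally show ?thesis .
qed

lemma l1_norm_eq:
  assumes "finite A" "Poly_Mapping.keys c \<subseteq> A"
  shows "l1_norm c = (\<Sum>f\<in>A. \<bar>Poly_Mapping.lookup c f\<bar>)"
  unfolding l1_norm_def using assms by (intro sum.mono_neutral_left) (auto simp: in_keys_iff)

lemma l1_norm_nonneg: "0 \<le> l1_norm c"
  by (simp add: l1_norm_def sum_nonneg)

definition face_set :: "nat \<Rightarrow> ((nat \<Rightarrow> real) \<Rightarrow> 'a) set \<Rightarrow> ((nat \<Rightarrow> real) \<Rightarrow> 'a) set" where
  "face_set p A = (\<Union>f\<in>A. (\<lambda>k. singular_face p k f) ` {..p})"

lemma face_sign_outside: "f \<in> A \<Longrightarrow> g \<notin> face_set p A \<Longrightarrow> face_sign p f g = 0"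
  unfolding face_sign_def face_set_def by (intro sum.neutral) auto

text \<open>The real coefficients of the bounding chain, not those of the cycle, are scaled by D and
  rounded down, so the result is automatically homologous to D times \<open>z\<close>. The rounding
  error of the norm is bounded independently of D, while the margin D (x - y) grows with it.
  Conversely, division by D returns a real chain.\<close>

lemma simplicial_volume_less_iff:
  fixes M :: "'a topology"
  assumes z: "singular_chain n M z"
  shows "simplicial_volume n M z < x \<longleftrightarrow>
    (\<exists>D b. 0 < D \<and> singular_chain (Suc n) M b \<and>
       l1_norm (real_of_chain (frag_cmul (int D) z + chain_boundary (Suc n) b)) < real D * x)" (is "_ \<longleftrightarrow> ?R")
proof -
  let ?N = "{l1_norm c | c. real_singular_chain n M c \<and>
            (\<exists>b. real_singular_chain (Suc n) M b \<and> c = real_of_chain z + real_chain_boundary (Suc n) b)}"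
  have bdd: "bdd_below ?N" using l1_norm_nonneg by (intro bdd_belowI[of _ 0]) auto
  have chain: "real_singular_chain n M (real_of_chain z + real_chain_boundary (Suc n) b)"
    if b: "real_singular_chain (Suc n) M b" for b
  proof -
    have "g \<in> singular_simplex_set n M" if g: "Poly_Mapping.lookup (real_of_chain z + real_chain_boundary (Suc n) b) g \<noteq> 0" for g
    proof (cases "Poly_Mapping.lookup z g = 0")
      case False
      then show ?thesis using z by (auto simp: singular_chain_def in_keys_iff)
    next
      case True
      then have "(\<Sum>f\<in>Poly_Mapping.keys b. Poly_Mapping.lookup b f * real_of_int (face_sign (Suc n) f g)) \<noteq> 0"
        using g by (auto simp: lookup_add lookup_real_chain_boundary[OF finite_keys subset_refl])
      then have "\<not> (\<forall>f\<in>Poly_Mapping.keys b. face_sign (Suc n) f g = 0)"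
        by (metis (no_types, lifting) mult_zero_right of_int_0 sum.neutral)
      then obtain f where f: "f \<in> Poly_Mapping.keys b" "face_sign (Suc n) f g \<noteq> 0" by blast
      then obtain k where "k \<le> Suc n" "g = singular_face (Suc n) k f"
        using face_sign_outside[of f "{f}" g "Suc n"] by (auto simp: face_set_def)
      then show ?thesis
        using singular_simplex_singular_face[of "Suc n" M f k] f b by (auto simp: real_singular_chain_def)
    qed
    then show ?thesis by (auto simp: real_singular_chain_def in_keys_iff)
  qed
  have "real_singular_chain (Suc n) M 0" by (simp add: real_singular_chain_def)
  with chain[OF this] have ne: "?N \<noteq> {}" by blast
  show ?thesis
  proof
    assume "simplicial_volume n M z < x"
    then obtain y where "y \<in> ?N" "y < x"
      unfolding simplicial_volume_def using cInf_lessD[OF ne] by blast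
    then obtain b where b: "real_singular_chain (Suc n) M b" and
      lt: "l1_norm (real_of_chain z + real_chain_boundary (Suc n) b) < x" by blast
    define K where "K = Poly_Mapping.keys b"
    define G where "G = Poly_Mapping.keys z \<union> face_set (Suc n) K"
    have fin: "finite K" "finite G" by (auto simp: K_def G_def face_set_def)
    \<comment> \<open>Bounds the norm of the boundary of any chain on K with coefficients of modulus
      at most 1; the rounding error is such a chain.\<close>
    define C where "C = (\<Sum>g\<in>G. \<Sum>f\<in>K. \<bar>real_of_int (face_sign (Suc n) f g)\<bar>)"
    define y where "y = l1_norm (real_of_chain z + real_chain_boundary (Suc n) b)"
    have lkr: "Poly_Mapping.lookup (real_of_chain z + real_chain_boundary (Suc n) b) g =
        real_of_int (Poly_Mapping.lookup z g) + (\<Sum>f\<in>K. Poly_Mapping.lookup b f * real_of_int (face_sign (Suc n) f g))" for g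
      by (simp add: lookup_add lookup_real_chain_boundary[OF fin(1)] K_def)
    have zero: "Poly_Mapping.lookup z g = 0 \<and> (\<forall>f\<in>K. face_sign (Suc n) f g = 0)" if "g \<notin> G" for g
      using that face_sign_outside[of _ K g "Suc n"] by (auto simp: G_def in_keys_iff)
    have "Poly_Mapping.keys (real_of_chain z + real_chain_boundary (Suc n) b) \<subseteq> G"
    proof
      fix g assume "g \<in> Poly_Mapping.keys (real_of_chain z + real_chain_boundary (Suc n) b)"
      then have "Poly_Mapping.lookup (real_of_chain z + real_chain_boundary (Suc n) b) g \<noteq> 0"
        by (simp add: in_keys_iff)
      then show "g \<in> G" unfolding lkr using zero by (metis (no_types, lifting) add_0 mult_zero_right of_int_0 sum.neutral)
    qed
    then have y: "y = (\<Sum>g\<in>G. \<bar>real_of_int (Poly_Mapping.lookup z g) + (\<Sum>f\<in>K. Poly_Mapping.lookup b f * real_of_int (face_sign (Suc n) f g))\<bar>)"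
      unfolding y_def by (subst l1_norm_eq[OF fin(2)]) (simp_all only: lkr)
    have "0 < x - y" using lt by (simp add: y_def)
    then obtain D :: nat where D: "C < real D * (x - y)"
      using reals_Archimedean3 by blast
    have "0 \<le> C" unfolding C_def by (intro sum_nonneg) auto
    then have D0: "0 < D" using D by (cases D) auto
    define b' where "b' = Poly_Mapping.map (\<lambda>r. \<lfloor>real D * r\<rfloor>) b"
    have lb': "Poly_Mapping.lookup b' f = \<lfloor>real D * Poly_Mapping.lookup b f\<rfloor>" for f
      by (simp add: b'_def map.rep_eq when_def)
    have kb': "Poly_Mapping.keys b' \<subseteq> K" by (auto simp: K_def in_keys_iff lb')
    let ?c = "frag_cmul (int D) z + chain_boundary (Suc n) b'"
    have lkc: "Poly_Mapping.lookup ?c g = int D * Poly_Mapping.lookup z g + (\<Sum>f\<in>K. Poly_Mapping.lookup b' f * face_sign (Suc n) f g)" for g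
      by (simp add: lookup_add lookup_chain_boundary[OF fin(1) kb'])
    have "Poly_Mapping.keys (real_of_chain ?c) \<subseteq> G"
    proof
      fix g assume "g \<in> Poly_Mapping.keys (real_of_chain ?c)"
      then have "Poly_Mapping.lookup ?c g \<noteq> 0"
        by (simp add: in_keys_iff)
      then show "g \<in> G" unfolding lkc using zero by (metis (no_types, lifting) add_0 mult_zero_right sum.neutral)
    qed
    then have "l1_norm (real_of_chain ?c) = (\<Sum>g\<in>G. \<bar>real_of_int (int D * Poly_Mapping.lookup z g + (\<Sum>f\<in>K. Poly_Mapping.lookup b' f * face_sign (Suc n) f g))\<bar>)"
      by (subst l1_norm_eq[OF fin(2)]) (simp_all only: lkc lookup_real_of_chain)
    also have "\<dots> \<le> (\<Sum>g\<in>G. real D * \<bar>real_of_int (Poly_Mapping.lookup z g) + (\<Sum>f\<in>K. Poly_Mapping.lookup b f * real_of_int (face_sign (Suc n) f g))\<bar>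
        + (\<Sum>f\<in>K. \<bar>real_of_int (face_sign (Suc n) f g)\<bar>))"
    proof (intro sum_mono)
      fix g :: "(nat \<Rightarrow> real) \<Rightarrow> 'a"
      let ?s = "\<lambda>f. real_of_int (face_sign (Suc n) f g)"
      let ?r = "\<lambda>f. real_of_int \<lfloor>real D * Poly_Mapping.lookup b f\<rfloor> - real D * Poly_Mapping.lookup b f"
      have "real_of_int (int D * Poly_Mapping.lookup z g + (\<Sum>f\<in>K. Poly_Mapping.lookup b' f * face_sign (Suc n) f g))
        = real D * (real_of_int (Poly_Mapping.lookup z g) + (\<Sum>f\<in>K. Poly_Mapping.lookup b f * ?s f)) + (\<Sum>f\<in>K. ?r f * ?s f)"
        by (simp add: lb' distrib_left sum_distrib_left mult.assoc left_diff_distrib sum_subtractf)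
      moreover have "\<bar>\<Sum>f\<in>K. ?r f * ?s f\<bar> \<le> (\<Sum>f\<in>K. \<bar>?s f\<bar>)"
      proof (rule order_trans[OF sum_abs], rule sum_mono)
        fix f
        have "\<bar>?r f\<bar> \<le> 1" using floor_correct[of "real D * Poly_Mapping.lookup b f"] by linarith
        then show "\<bar>?r f * ?s f\<bar> \<le> \<bar>?s f\<bar>" by (simp add: abs_mult mult_left_le_one_le)
      qed
      moreover have "\<bar>real D * (real_of_int (Poly_Mapping.lookup z g) + (\<Sum>f\<in>K. Poly_Mapping.lookup b f * ?s f))\<bar>
          = real D * \<bar>real_of_int (Poly_Mapping.lookup z g) + (\<Sum>f\<in>K. Poly_Mapping.lookup b f * ?s f)\<bar>"
        by (simp add: abs_mult)
      ultimately show "\<bar>real_of_int (int D * Poly_Mapping.lookup z g + (\<Sum>f\<in>K. Poly_Mapping.lookup b' f * face_sign (Suc n) f g))\<bar>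
         \<le> real D * \<bar>real_of_int (Poly_Mapping.lookup z g) + (\<Sum>f\<in>K. Poly_Mapping.lookup b f * ?s f)\<bar> + (\<Sum>f\<in>K. \<bar>?s f\<bar>)"
        by linarith
    qed
    also have "\<dots> = real D * y + C" by (simp add: y C_def sum.distrib sum_distrib_left)
    also have "\<dots> < real D * x" using D by (simp add: algebra_simps)
    finally have "l1_norm (real_of_chain ?c) < real D * x" .
    moreover have "singular_chain (Suc n) M b'"
      using kb' b by (auto simp: singular_chain_def K_def real_singular_chain_def)
    ultimately show ?R using D0 by blast
  next
    assume ?R
    then obtain D b where Db: "0 < D" "singular_chain (Suc n) M b"
       "l1_norm (real_of_chain (frag_cmul (int D) z + chain_boundary (Suc n) b)) < real D * x" by blast
    define b' where "b' = Poly_Mapping.map (\<lambda>k. real_of_int k / real D) b"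
    have lb': "Poly_Mapping.lookup b' f = real_of_int (Poly_Mapping.lookup b f) / real D" for f
      by (simp add: b'_def map.rep_eq when_def)
    have kb': "Poly_Mapping.keys b' = Poly_Mapping.keys b" using Db(1) by (auto simp: in_keys_iff lb')
    let ?c = "frag_cmul (int D) z + chain_boundary (Suc n) b"
    let ?c' = "real_of_chain z + real_chain_boundary (Suc n) b'"
    have lk: "Poly_Mapping.lookup (real_of_chain ?c) g = real D * Poly_Mapping.lookup ?c' g" for g
      using Db(1) by (simp add: lookup_add lookup_real_chain_boundary[OF finite_keys subset_refl]
          lookup_chain_boundary[OF finite_keys subset_refl] kb' lb' distrib_left sum_distrib_left)
    then have "Poly_Mapping.keys (real_of_chain ?c) = Poly_Mapping.keys ?c'"
      using Db(1) by (intro Set.set_eqI) (simp add: in_keys_iff lk del: lookup_real_of_chain keys_real_of_chain)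
    then have "l1_norm (real_of_chain ?c) = real D * l1_norm ?c'"
      by (simp add: l1_norm_def lk abs_mult sum_distrib_left del: lookup_real_of_chain keys_real_of_chain)
    then have "l1_norm ?c' < x" using Db(1,3) by simp
    moreover have b'c: "real_singular_chain (Suc n) M b'"
      using Db(2) kb' by (simp add: real_singular_chain_def singular_chain_def)
    then have "l1_norm ?c' \<in> ?N" using chain[OF b'c] by blast
    ultimately show "simplicial_volume n M z < x"
      unfolding simplicial_volume_def using cInf_lower[OF _ bdd] by fastforce
  qed
qed

text \<open>Since \<open>h\<close> factors through \<open>f\<close>, its fibres are unions of fibres
  of \<open>f\<close>, and coarser collection can only cancel more. Soundness and completeness of
  certificates both compare norms this way, in opposite directions.\<close>

lemma sum_abs_fibres_le:
  fixes c :: "'e \<Rightarrow> int"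
  assumes "finite E" "\<And>e. e \<in> E \<Longrightarrow> h e = g (f e)"
  shows "(\<Sum>y\<in>h ` E. \<bar>\<Sum>e\<in>{e \<in> E. h e = y}. c e\<bar>) \<le> (\<Sum>x\<in>f ` E. \<bar>\<Sum>e\<in>{e \<in> E. f e = x}. c e\<bar>)"
proof -
  have "\<bar>\<Sum>e\<in>{e \<in> E. h e = y}. c e\<bar> \<le> (\<Sum>x\<in>{x \<in> f ` E. g x = y}. \<bar>\<Sum>e\<in>{e \<in> E. f e = x}. c e\<bar>)" for y
  proof -
    have "(\<Sum>e\<in>{e \<in> E. h e = y}. c e) = (\<Sum>x\<in>{x \<in> f ` E. g x = y}. \<Sum>e\<in>{e \<in> {e \<in> E. h e = y}. f e = x}. c e)"
      by (rule sum.group[symmetric]) (use assms in auto)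
    also have "\<dots> = (\<Sum>x\<in>{x \<in> f ` E. g x = y}. \<Sum>e\<in>{e \<in> E. f e = x}. c e)"
      using assms by (intro sum.cong) auto
    finally show ?thesis by (simp only: sum_abs)
  qed
  then have "(\<Sum>y\<in>h ` E. \<bar>\<Sum>e\<in>{e \<in> E. h e = y}. c e\<bar>) \<le> (\<Sum>y\<in>h ` E. \<Sum>x\<in>{x \<in> f ` E. g x = y}. \<bar>\<Sum>e\<in>{e \<in> E. f e = x}. c e\<bar>)"
    by (rule sum_mono)
  also have "\<dots> = (\<Sum>x\<in>f ` E. \<bar>\<Sum>e\<in>{e \<in> E. f e = x}. c e\<bar>)"
    by (rule sum.group) (use assms in auto)
  finally show ?thesis .
qed

lemma sum_abs_fibres_le':
  fixes c :: "'e \<Rightarrow> int"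
  assumes "finite E" "\<And>e e'. e \<in> E \<Longrightarrow> e' \<in> E \<Longrightarrow> f e = f e' \<Longrightarrow> h e = h e'"
  shows "(\<Sum>y\<in>h ` E. \<bar>\<Sum>e\<in>{e \<in> E. h e = y}. c e\<bar>) \<le> (\<Sum>x\<in>f ` E. \<bar>\<Sum>e\<in>{e \<in> E. f e = x}. c e\<bar>)"
proof (rule sum_abs_fibres_le[where g = "\<lambda>x. h (SOME e. e \<in> E \<and> f e = x)", OF assms(1)])
  fix e assume e: "e \<in> E"
  have "(SOME e'. e' \<in> E \<and> f e' = f e) \<in> E \<and> f (SOME e'. e' \<in> E \<and> f e' = f e) = f e"
    by (rule someI[of _ e]) (use e in simp)
  then show "h e = h (SOME e'. e' \<in> E \<and> f e' = f e)" using assms(2) e by metis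
qed

lemma l1_norm_frag_sum:
  fixes c :: "'e \<Rightarrow> int"
  assumes "finite E"
  shows "l1_norm (real_of_chain (\<Sum>e\<in>E. frag_cmul (c e) (frag_of (f e)))) = real_of_int (\<Sum>x\<in>f ` E. \<bar>\<Sum>e\<in>{e \<in> E. f e = x}. c e\<bar>)"
proof -
  let ?c = "\<Sum>e\<in>E. frag_cmul (c e) (frag_of (f e))"
  have lk: "Poly_Mapping.lookup ?c x = (\<Sum>e\<in>{e \<in> E. f e = x}. c e)" for x
  proof -
    have "Poly_Mapping.lookup ?c x = (\<Sum>e\<in>E. if f e = x then c e else 0)"
      by (simp add: lookup_sum when_def if_distrib[of "\<lambda>x. _ * x"] cong: if_cong)
         (auto intro!: sum.cong)
    also have "\<dots> = (\<Sum>e\<in>{e \<in> E. f e = x}. c e)"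
      using assms by (intro sum.mono_neutral_cong_right) auto
    finally show ?thesis .
  qed
  have "Poly_Mapping.keys (real_of_chain ?c) \<subseteq> f ` E"
  proof
    fix x assume "x \<in> Poly_Mapping.keys (real_of_chain ?c)"
    then have "(\<Sum>e\<in>{e \<in> E. f e = x}. c e) \<noteq> 0" by (simp add: in_keys_iff lk)
    then show "x \<in> f ` E" by (metis (mono_tags, lifting) imageI mem_Collect_eq sum.neutral)
  qed
  then show ?thesis
    using assms by (subst l1_norm_eq[of "f ` E"]) (simp_all add: lk)
qed

lemma sum_entries:
  fixes g :: "nat \<Rightarrow> 'b::comm_monoid_add"
  shows "(\<Sum>r<J + R * K. g r) = (\<Sum>j<J. g j) + (\<Sum>i<R. \<Sum>k<K. g (J + i * K + k))"
proof (induction R)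
  case (Suc R)
  have "(\<Sum>r<a + b. g r) = (\<Sum>r<a. g r) + (\<Sum>k<b. g (a + k))" for a b
    by (induction b) (simp_all add: add.assoc)
  from this[of "J + R * K" K] show ?case using Suc by (simp add: ac_simps)
qed simp

section \<open>Combinatorial certificates\<close>

text \<open>An (n + 1)-simplex has n + 2 faces, so after the \<open>J\<close> simplices of the cycle
  the position J + i * (n + 2) + k stands for face \<open>k\<close> of the \<open>i\<close>-th
  simplex of the chain.\<close>

definition entry_label :: "nat \<Rightarrow> nat \<Rightarrow> (nat \<Rightarrow> (nat \<Rightarrow> nat) \<Rightarrow> nat) \<Rightarrow> (nat \<Rightarrow> (nat \<Rightarrow> nat) \<Rightarrow> nat) \<Rightarrow> nat \<Rightarrow> (nat \<Rightarrow> nat) \<Rightarrow> nat" where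
  "entry_label n J \<zeta> \<tau> r \<alpha> = (if r < J then \<zeta> r \<alpha>
     else \<tau> ((r - J) div (n + 2)) (simplical_face ((r - J) mod (n + 2)) \<alpha>))"

definition entry_coeff :: "nat \<Rightarrow> nat \<Rightarrow> nat \<Rightarrow> (nat \<Rightarrow> int) \<Rightarrow> (nat \<Rightarrow> int) \<Rightarrow> nat \<Rightarrow> int" where
  "entry_coeff n J D b e r = (if r < J then int D * b r
     else (-1) ^ ((r - J) mod (n + 2)) * e ((r - J) div (n + 2)))"

text \<open>The functions \<open>\<zeta> j\<close> label the simplices of a fixed fundamental cycle on the grid of level \<open>m\<close>; they
  are tied to its class by staying close to reference labels \<open>lam j\<close> of level \<open>m0\<close> and by agreeing on
  the faces that \<open>con\<close> identifies. The functions \<open>\<tau> i\<close> label the simplices of an \<open>n + 1\<close>-chain, and \<open>cls\<close>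
  may only identify entries (simplices of the cycle, then faces of the chain) with equal labels.\<close>

definition chain_certificate ::
  "nat \<Rightarrow> nat \<Rightarrow> (nat \<Rightarrow> nat \<Rightarrow> bool) \<Rightarrow> nat \<Rightarrow> nat \<Rightarrow> (nat \<Rightarrow> (nat \<Rightarrow> nat) \<Rightarrow> nat) \<Rightarrow> (nat \<Rightarrow> nat \<Rightarrow> nat \<Rightarrow> nat \<Rightarrow> bool) \<Rightarrow>
   nat \<Rightarrow> nat \<Rightarrow> (nat \<Rightarrow> (nat \<Rightarrow> nat) \<Rightarrow> nat) \<Rightarrow> (nat \<Rightarrow> (nat \<Rightarrow> nat) \<Rightarrow> nat) \<Rightarrow> (nat \<Rightarrow> nat) \<Rightarrow> bool" where
  "chain_certificate n v cl J m0 lam con m R \<zeta> \<tau> cls \<longleftrightarrow> m0 \<le> m \<and>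
    (\<forall>i<R. \<forall>\<alpha>\<in>grid (Suc n) m. \<tau> i \<alpha> < v \<and>
       (\<forall>\<beta>\<in>grid (Suc n) m. (\<forall>l\<le>Suc n. \<alpha> l \<le> \<beta> l + 1 \<and> \<beta> l \<le> \<alpha> l + 1) \<longrightarrow> cl (\<tau> i \<alpha>) (\<tau> i \<beta>))) \<and>
    (\<forall>j<J. \<forall>\<alpha>\<in>grid n m. \<zeta> j \<alpha> < v \<and>
       (\<forall>\<beta>\<in>grid n m0. (\<forall>l\<le>n. m0 * \<alpha> l \<le> m * \<beta> l + 3 * m \<and> m * \<beta> l \<le> m0 * \<alpha> l + 3 * m) \<longrightarrow> cl (lam j \<beta>) (\<zeta> j \<alpha>))) \<and>
    (n \<noteq> 0 \<longrightarrow> (\<forall>j<J. \<forall>k\<le>n. \<forall>j'<J. \<forall>k'\<le>n. con j k j' k' \<longrightarrow>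
       (\<forall>\<alpha>\<in>grid (n - 1) m. \<zeta> j (simplical_face k \<alpha>) = \<zeta> j' (simplical_face k' \<alpha>)))) \<and>
    (\<forall>r<J + R * (n + 2). cls r < J + R * (n + 2) \<and> (\<forall>s<J + R * (n + 2). cls r = cls s \<longrightarrow>
       (\<forall>\<alpha>\<in>grid n m. entry_label n J \<zeta> \<tau> r \<alpha> = entry_label n J \<zeta> \<tau> s \<alpha>)))"

text \<open>The norm of the list of entries if exactly the entries of one class were the same
  simplex. It bounds the norm of the spanned chain from above, because entries of one class do span
  the same simplex.\<close>

definition class_cost :: "nat \<Rightarrow> nat \<Rightarrow> nat \<Rightarrow> (nat \<Rightarrow> int) \<Rightarrow> (nat \<Rightarrow> int) \<Rightarrow> nat \<Rightarrow> (nat \<Rightarrow> nat) \<Rightarrow> int" where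
  "class_cost n J D b e R cls = (\<Sum>d<J + R * (n + 2). \<bar>\<Sum>r\<in>{r. r < J + R * (n + 2) \<and> cls r = d}. entry_coeff n J D b e r\<bar>)"

lemma class_cost_eq:
  assumes "\<forall>r<J + R * (n + 2). cls r < J + R * (n + 2)"
  shows "class_cost n J D b e R cls =
    (\<Sum>d\<in>cls ` {..<J + R * (n + 2)}. \<bar>\<Sum>r\<in>{r \<in> {..<J + R * (n + 2)}. cls r = d}. entry_coeff n J D b e r\<bar>)"
proof -
  let ?L = "J + R * (n + 2)"
  have "(\<Sum>r\<in>{r. r < ?L \<and> cls r = d}. entry_coeff n J D b e r) = 0" if "d \<notin> cls ` {..<?L}" for d
    using that by (intro sum.neutral) auto
  then show ?thesis
    unfolding class_cost_def using assms
    by (intro sum.mono_neutral_cong_right) (auto intro!: arg_cong[of _ _ abs] sum.cong)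
qed

lemma frag_cmul_diff_right: "frag_cmul k (x - y) = frag_cmul k x - frag_cmul k y"
  using frag_cmul_distrib2[of k "x - y" y] by (simp add: algebra_simps)

lemma entry_index:
  fixes K :: nat
  assumes "k < K"
  shows "(J + i * K + k - J) div K = i" "(J + i * K + k - J) mod K = k" "(J + i * K + k < J) = False"
proof -
  have J: "J + i * K + k - J = i * K + k" by simp
  show "(J + i * K + k - J) div K = i" "(J + i * K + k - J) mod K = k" "(J + i * K + k < J) = False"
    unfolding J using assms by auto
qed

lemma entry_sum:
  "(\<Sum>r<J + R * (n + 2). frag_cmul (entry_coeff n J D b e r) (frag_of (F r))) =
   frag_cmul (int D) (\<Sum>j<J. frag_cmul (b j) (frag_of (F j))) +
   (\<Sum>i<R. frag_cmul (e i) (\<Sum>k\<le>Suc n. frag_cmul ((-1) ^ k) (frag_of (F (J + i * (n + 2) + k)))))"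
proof -
  have coeff: "entry_coeff n J D b e (J + i * (n + 2) + k) = e i * (-1) ^ k" if "k < n + 2" for i k
    by (simp only: entry_coeff_def entry_index[OF that] if_False mult.commute)
  have set: "{..<n + 2} = {..Suc n}" by auto
  have A: "(\<Sum>j<J. frag_cmul (entry_coeff n J D b e j) (frag_of (F j))) = frag_cmul (int D) (\<Sum>j<J. frag_cmul (b j) (frag_of (F j)))"
    by (simp add: entry_coeff_def frag_cmul_sum)
  have B: "(\<Sum>k<n + 2. frag_cmul (entry_coeff n J D b e (J + i * (n + 2) + k)) (frag_of (F (J + i * (n + 2) + k))))
     = frag_cmul (e i) (\<Sum>k\<le>Suc n. frag_cmul ((-1) ^ k) (frag_of (F (J + i * (n + 2) + k))))" for i
    unfolding set[symmetric] frag_cmul_sum frag_cmul_cmul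
    by (rule sum.cong[OF refl]) (simp only: lessThan_iff coeff)
  show ?thesis unfolding sum_entries A B ..
qed

lemma entry_simplex:
  assumes "k \<le> Suc n"
  shows "entry_label n J \<zeta> \<tau> (J + i * (n + 2) + k) = \<tau> i \<circ> simplical_face k"
proof -
  have k: "k < n + 2" using assms by simp
  show ?thesis
    by (rule ext) (simp only: entry_label_def entry_index[OF k] if_False o_def)
qed

text \<open>The function sending (t, t') to d (f t) (f t') is uniformly continuous on the compact
  square of the simplex; it is compared with its value 0 at (t, t).\<close>

lemma simplex_uniformly_continuous:
  fixes d :: "'a \<Rightarrow> 'a \<Rightarrow> real"
  assumes d: "continuous_map (prod_topology M M) euclideanreal (\<lambda>(x, y). d x y)" "\<And>x. d x x = 0"
    and f: "singular_simplex p M f" and "0 < \<epsilon>"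
  shows "\<exists>\<delta>>0. \<forall>t\<in>standard_simplex p. \<forall>t'\<in>standard_simplex p. (\<forall>i. \<bar>t i - t' i\<bar> \<le> \<delta>) \<longrightarrow> d (f t) (f t') < \<epsilon>"
proof -
  let ?S = "standard_simplex p"
  have f': "continuous_map (top_of_set ?S) M f"
    using f by (simp add: singular_simplex_def euclidean_product_topology)
  have 1: "continuous_map (prod_topology (top_of_set ?S) (top_of_set ?S)) M (\<lambda>z. f (fst z))"
    using continuous_map_compose[OF continuous_map_fst f', of "top_of_set ?S"] by (simp add: o_def)
  have 2: "continuous_map (prod_topology (top_of_set ?S) (top_of_set ?S)) M (\<lambda>z. f (snd z))"
    using continuous_map_compose[OF continuous_map_snd f', of "top_of_set ?S"] by (simp add: o_def)
  have "continuous_map (prod_topology (top_of_set ?S) (top_of_set ?S)) euclideanreal (\<lambda>z. d (f (fst z)) (f (snd z)))"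
    using continuous_map_compose[OF continuous_map_pairedI[OF 1 2] d(1)] by (simp add: o_def)
  then have "continuous_on (?S \<times> ?S) (\<lambda>z. d (f (fst z)) (f (snd z)))"
    by simp
  moreover have "compact (?S \<times> ?S)"
    using compactin_standard_simplex[of p] by (intro compact_Times) (simp_all add: euclidean_product_topology)
  ultimately have "uniformly_continuous_on (?S \<times> ?S) (\<lambda>z. d (f (fst z)) (f (snd z)))"
    by (rule compact_uniformly_continuous)
  then obtain \<delta> where \<delta>: "\<delta> > 0" "\<And>z z'. z \<in> ?S \<times> ?S \<Longrightarrow> z' \<in> ?S \<times> ?S \<Longrightarrow> dist z' z < \<delta> \<Longrightarrow>
      dist (d (f (fst z')) (f (snd z'))) (d (f (fst z)) (f (snd z))) < \<epsilon>"
    using \<open>0 < \<epsilon>\<close> unfolding uniformly_continuous_on_def by metis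
  have "d (f t) (f t') < \<epsilon>" if t: "t \<in> ?S" "t' \<in> ?S" "\<forall>i. \<bar>t i - t' i\<bar> \<le> \<delta> / 4" for t t'
  proof -
    \<comment> \<open>The metric on functions sums coordinate distances, cut off at 1, with weights
      (1/2)^n of total 2. A coordinatewise bound \<delta>/4 thus gives \<delta>/2.\<close>
    have "dist t t' \<le> suminf (\<lambda>n. (1/2)^n * (\<delta> / 4))"
      unfolding dist_fun_def
    proof (rule suminf_le)
      show "(1/2)^n * min (dist (t (from_nat n)) (t' (from_nat n))) 1 \<le> (1/2)^n * (\<delta> / 4)" for n
        using t(3)[rule_format, of "from_nat n"] by (intro mult_left_mono min.coboundedI1) (simp_all add: dist_real_def)
      show "summable (\<lambda>n. (1/2)^n * (\<delta> / 4))" by (intro summable_mult2 summable_geometric) simp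
      show "summable (\<lambda>n. (1/2)^n * min (dist (t (from_nat n)) (t' (from_nat n))) 1)"
        by (rule summable_comparison_test'[of "\<lambda>n. (1/2)^n" 0]) (auto simp: summable_geometric abs_mult mult_left_le)
    qed
    also have "\<dots> = suminf (\<lambda>n. (1/2)^n) * (\<delta> / 4)"
      by (rule suminf_mult2[symmetric]) (simp add: summable_geometric)
    also have "\<dots> = \<delta> / 2" by (simp add: suminf_geometric)
    finally have "dist (t, t') (t, t) < \<delta>" using \<delta>(1) by (simp add: dist_Pair_Pair dist_commute)
    from \<delta>(2)[OF _ _ this] show ?thesis using t d(2) by (simp add: dist_real_def)
  qed
  then show ?thesis using \<delta>(1) by (intro exI[of _ "\<delta> / 4"]) auto
qed

lemma simplices_uniformly_continuous:
  fixes d :: "'a \<Rightarrow> 'a \<Rightarrow> real" and N :: nat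
  assumes d: "continuous_map (prod_topology M M) euclideanreal (\<lambda>(x, y). d x y)" "\<And>x. d x x = 0"
    and f: "\<And>i. i < N \<Longrightarrow> singular_simplex p M (f i)" and "0 < \<epsilon>"
  shows "\<exists>\<delta>>0. \<forall>i<N. \<forall>t\<in>standard_simplex p. \<forall>t'\<in>standard_simplex p. (\<forall>l. \<bar>t l - t' l\<bar> \<le> \<delta>) \<longrightarrow> d (f i t) (f i t') < \<epsilon>"
  using f
proof (induction N)
  case 0
  show ?case by (rule exI[of _ 1]) simp
next
  case (Suc N)
  obtain \<delta> where \<delta>: "\<delta> > 0" "\<forall>i<N. \<forall>t\<in>standard_simplex p. \<forall>t'\<in>standard_simplex p. (\<forall>l. \<bar>t l - t' l\<bar> \<le> \<delta>) \<longrightarrow> d (f i t) (f i t') < \<epsilon>"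
    using Suc.IH Suc.prems less_SucI by blast
  obtain \<delta>' where \<delta>': "\<delta>' > 0" "\<forall>t\<in>standard_simplex p. \<forall>t'\<in>standard_simplex p. (\<forall>l. \<bar>t l - t' l\<bar> \<le> \<delta>') \<longrightarrow> d (f N t) (f N t') < \<epsilon>"
    using simplex_uniformly_continuous[OF d Suc.prems[OF lessI] \<open>0 < \<epsilon>\<close>] by blast
  have "d (f i t) (f i t') < \<epsilon>" if "i < Suc N" "t \<in> standard_simplex p" "t' \<in> standard_simplex p" "\<forall>l. \<bar>t l - t' l\<bar> \<le> min \<delta> \<delta>'" for i t t'
    using that \<delta>(2) \<delta>'(2) by (cases "i = N") simp_all
  then show ?case using \<delta>(1) \<delta>'(1) by (intro exI[of _ "min \<delta> \<delta>'"]) simp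
qed

lemma grid_scaled:
  assumes "\<alpha> \<in> grid p m" "0 < m"
  shows "(\<lambda>i. real (\<alpha> i) / real m) \<in> standard_simplex p"
proof -
  have "(\<Sum>i\<le>p. real (\<alpha> i) / real m) = real (\<Sum>i\<le>p. \<alpha> i) / real m"
    by (simp add: sum_divide_distrib)
  then show ?thesis using assms grid_le[OF assms(1)] by (auto simp: standard_simplex_def grid_def)
qed

lemma simplical_face_scaled:
  "(\<lambda>i. real (simplical_face k \<alpha> i) / real m) = simplical_face k (\<lambda>i. real (\<alpha> i) / real m)"
  by (auto simp: simplical_face_def fun_eq_iff)

section \<open>Soundness and completeness of certificates for a labelled cycle\<close>

locale labelled_cycle = mixing_space M chs d v a
  for M :: "'a topology" and chs d v a +
  fixes n J :: nat and \<sigma> :: "nat \<Rightarrow> (nat \<Rightarrow> real) \<Rightarrow> 'a" and b :: "nat \<Rightarrow> int" and m0 :: nat and \<nu> :: "'a \<Rightarrow> nat"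
  assumes \<sigma>: "\<And>j. j < J \<Longrightarrow> singular_simplex n M (\<sigma> j)"
    and cyc: "chain_boundary n (\<Sum>j<J. frag_cmul (b j) (frag_of (\<sigma> j))) = 0"
    and m0: "0 < m0"
    and fine: "\<And>j t t'. j < J \<Longrightarrow> t \<in> standard_simplex n \<Longrightarrow> t' \<in> standard_simplex n \<Longrightarrow>
        (\<forall>i. \<bar>t i - t' i\<bar> \<le> 3 / real m0) \<Longrightarrow> d (\<sigma> j t) (\<sigma> j t') < 1/100"
    and \<nu>: "\<And>x. x \<in> topspace M \<Longrightarrow> \<nu> x < v" "\<And>x. x \<in> topspace M \<Longrightarrow> d x (a (\<nu> x)) < 1/100"
begin

definition vertex_label :: "nat \<Rightarrow> ((nat \<Rightarrow> real) \<Rightarrow> 'a) \<Rightarrow> (nat \<Rightarrow> nat) \<Rightarrow> nat" where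
  "vertex_label m f \<alpha> = \<nu> (f (\<lambda>i. real (\<alpha> i) / real m))"

text \<open>The bound 3/100 is net error plus mesh error plus net error. Both labels are below
  \<open>v\<close>, so the relation is a finite table whatever \<open>d\<close> is.\<close>

definition close_labels :: "nat \<Rightarrow> nat \<Rightarrow> bool" where
  "close_labels u u' \<longleftrightarrow> u < v \<and> u' < v \<and> d (a u) (a u') < 3/100"

definition same_face :: "nat \<Rightarrow> nat \<Rightarrow> nat \<Rightarrow> nat \<Rightarrow> bool" where
  "same_face j k j' k' \<longleftrightarrow> singular_face n k (\<sigma> j) = singular_face n k' (\<sigma> j')"

abbreviation "cert \<equiv> chain_certificate n v close_labels J m0 (\<lambda>j. vertex_label m0 (\<sigma> j)) same_face"

abbreviation "base_chain \<equiv> \<Sum>j<J. frag_cmul (b j) (frag_of (\<sigma> j))"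

lemma simplex_topspace:
  assumes "singular_simplex p M f" "t \<in> standard_simplex p"
  shows "f t \<in> topspace M"
  using assms by (metis continuous_map_image_subset_topspace image_subset_iff singular_simplex_def topspace_standard_simplex)

text \<open>All labels are spanned. The \<zeta> j span a cycle homologous to the base chain, the
  \<tau> i span an (n + 1)-chain, and faces of spanned simplices are spanned by the face labels. The
  total is the list of entries, and entries in one class span the same simplex, so collecting by
  class overestimates the norm.\<close>

lemma certificate_sound:
  assumes c: "cert m R \<zeta> \<tau> cls"
  shows "\<exists>b'. singular_chain (Suc n) M b' \<and>
    l1_norm (real_of_chain (frag_cmul (int D) base_chain + chain_boundary (Suc n) b')) \<le> real_of_int (class_cost n J D b e R cls)"
proof -
  let ?L = "J + R * (n + 2)"
  note c' = c[unfolded chain_certificate_def]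
  have mm: "m0 \<le> m" using c' by (elim conjE)
  then have m: "0 < m" using m0 by simp
  have \<tau>1: "\<tau> i \<alpha> < v" if "i < R" "\<alpha> \<in> grid (Suc n) m" for i \<alpha>
    using c' that by (elim conjE) simp
  have \<tau>2: "close_labels (\<tau> i \<alpha>) (\<tau> i \<beta>)" if "i < R" "\<alpha> \<in> grid (Suc n) m" "\<beta> \<in> grid (Suc n) m"
     "\<forall>l\<le>Suc n. \<alpha> l \<le> \<beta> l + 1 \<and> \<beta> l \<le> \<alpha> l + 1" for i \<alpha> \<beta>
    using c' that by (elim conjE) simp
  have \<zeta>1: "\<zeta> j \<alpha> < v" if "j < J" "\<alpha> \<in> grid n m" for j \<alpha>
    using c' that by (elim conjE) simp
  have \<zeta>2: "close_labels (vertex_label m0 (\<sigma> j) \<beta>) (\<zeta> j \<alpha>)" if "j < J" "\<alpha> \<in> grid n m" "\<beta> \<in> grid n m0"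
     "\<forall>l\<le>n. m0 * \<alpha> l \<le> m * \<beta> l + 3 * m \<and> m * \<beta> l \<le> m0 * \<alpha> l + 3 * m" for j \<alpha> \<beta>
    using c' that by (elim conjE) simp
  have same_face: "\<zeta> j (simplical_face k \<alpha>) = \<zeta> j' (simplical_face k' \<alpha>)"
    if "n \<noteq> 0" "j < J" "j' < J" "k \<le> n" "k' \<le> n" "same_face j k j' k'" "\<alpha> \<in> grid (n - 1) m" for j k j' k' \<alpha>
    using c' that by (elim conjE) simp
  have cls: "\<forall>r<?L. cls r < ?L"
    using c' by (elim conjE) simp
  have all: "\<forall>r<?L. cls r < ?L \<and> (\<forall>s<?L. cls r = cls s \<longrightarrow>
      (\<forall>\<alpha>\<in>grid n m. entry_label n J \<zeta> \<tau> r \<alpha> = entry_label n J \<zeta> \<tau> s \<alpha>))"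
    using c' by (elim conjE) assumption
  have same: "entry_label n J \<zeta> \<tau> r \<alpha> = entry_label n J \<zeta> \<tau> s \<alpha>" if "r < ?L" "s < ?L" "cls r = cls s" "\<alpha> \<in> grid n m" for r s \<alpha>
    using all[rule_format, OF that(1), THEN conjunct2, rule_format, OF that(2-4)] .
  have small: "small_labelling (Suc n) m (\<tau> i)" if i: "i < R" for i
    unfolding small_labelling_def
  proof (intro conjI ballI)
    fix t :: "nat \<Rightarrow> real" assume t: "t \<in> standard_simplex (Suc n)"
    obtain \<alpha> where \<alpha>: "\<alpha> \<in> grid (Suc n) m" "\<forall>i. \<bar>real m * t i - real (\<alpha> i)\<bar> < 1"
      using near_grid_point[OF t] by blast
    have "d (a (\<tau> i \<alpha>)) (a (\<tau> i \<beta>)) < 1/8" if \<beta>: "\<beta> \<in> grid (Suc n) m" "\<forall>i. \<bar>real m * t i - real (\<beta> i)\<bar> < 1" for \<beta>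
    proof -
      \<comment> \<open>Integers at distance less than 1 from the same real differ by at most 1. So
        one grid label near t can serve as centre, at distance 3/100 < 1/8 from the others.\<close>
      have "\<alpha> l \<le> \<beta> l + 1 \<and> \<beta> l \<le> \<alpha> l + 1" for l
        using \<alpha>(2)[rule_format, of l] \<beta>(2)[rule_format, of l] by linarith
      then show ?thesis using \<tau>2[OF i \<alpha>(1) \<beta>(1)] by (simp add: close_labels_def)
    qed
    then show "\<exists>c. \<forall>\<beta>\<in>grid (Suc n) m. (\<forall>i. \<bar>real m * t i - real (\<beta> i)\<bar> < 1) \<longrightarrow> d c (a (\<tau> i \<beta>)) < 1/8" by blast
  qed (use \<tau>1 i in simp)
  \<comment> \<open>The distance is split at a level \<open>m0\<close> grid point near t: mesh
    1/100, net 1/100 and closeness 3/100 add up to less than 1/8.\<close>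
  have near: "d (\<sigma> j t) (a (\<zeta> j \<alpha>)) < 1/8"
    if j: "j < J" and t: "t \<in> standard_simplex n" and \<alpha>: "\<alpha> \<in> grid n m" "\<forall>i. \<bar>real m * t i - real (\<alpha> i)\<bar> < 1" for j t \<alpha>
  proof -
    obtain \<beta> where \<beta>: "\<beta> \<in> grid n m0" "\<forall>i. \<bar>real m0 * t i - real (\<beta> i)\<bar> < 1"
      using near_grid_point[OF t] by blast
    let ?t = "\<lambda>i. real (\<beta> i) / real m0"
    have t': "?t \<in> standard_simplex n" using grid_scaled[OF \<beta>(1) m0] .
    have "\<bar>t i - ?t i\<bar> \<le> 3 / real m0" for i
    proof -
      have "\<bar>real m0 * t i - real (\<beta> i)\<bar> / real m0 \<le> 3 / real m0"
        using \<beta>(2)[rule_format, of i] by (intro divide_right_mono) auto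
      moreover have "\<bar>real m0 * t i - real (\<beta> i)\<bar> / real m0 = \<bar>t i - ?t i\<bar>"
      proof -
        have "t i - ?t i = (real m0 * t i - real (\<beta> i)) / real m0" using m0 by (simp add: diff_divide_distrib)
        then show ?thesis by simp
      qed
      ultimately show ?thesis by simp
    qed
    then have 1: "d (\<sigma> j t) (\<sigma> j ?t) < 1/100" using fine[OF j t t'] by blast
    have 2: "d (\<sigma> j ?t) (a (vertex_label m0 (\<sigma> j) \<beta>)) < 1/100"
      unfolding vertex_label_def by (rule \<nu>(2)[OF simplex_topspace[OF \<sigma>[OF j] t']])
    \<comment> \<open>The inequality \<bar>\<beta> l / m0 - \<alpha> l / m\<bar> \<le> 3 / m0
      without denominators. Both fractions approximate t l, with errors below 1/m0 and 1/m, and m0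
      \<le> m.\<close>
    have "m0 * \<alpha> l \<le> m * \<beta> l + 3 * m \<and> m * \<beta> l \<le> m0 * \<alpha> l + 3 * m" for l
    proof -
      have A: "\<bar>real m0 * (real m * t l) - real m0 * real (\<alpha> l)\<bar> \<le> real m0"
        using \<alpha>(2)[rule_format, of l] mult_left_mono[of "\<bar>real m * t l - real (\<alpha> l)\<bar>" 1 "real m0"]
        by (simp add: abs_mult flip: right_diff_distrib)
      have B: "\<bar>real m * (real m0 * t l) - real m * real (\<beta> l)\<bar> \<le> real m"
        using \<beta>(2)[rule_format, of l] mult_left_mono[of "\<bar>real m0 * t l - real (\<beta> l)\<bar>" 1 "real m"]
        by (simp add: abs_mult flip: right_diff_distrib)
      have C: "real m0 * (real m * t l) = real m * (real m0 * t l)" by simp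
      have D: "real m0 \<le> real m" using mm by simp
      have "real m0 * real (\<alpha> l) \<le> real m * real (\<beta> l) + 3 * real m" using A B D unfolding C by linarith
      moreover have "real m * real (\<beta> l) \<le> real m0 * real (\<alpha> l) + 3 * real m" using A B D unfolding C by linarith
      ultimately show ?thesis
        by (metis (mono_tags, lifting) of_nat_add of_nat_le_iff of_nat_mult of_nat_numeral)
    qed
    then have "close_labels (vertex_label m0 (\<sigma> j) \<beta>) (\<zeta> j \<alpha>)" using \<zeta>2[OF j \<alpha>(1) \<beta>(1)] by blast
    then have 3: "d (a (vertex_label m0 (\<sigma> j) \<beta>)) (a (\<zeta> j \<alpha>)) < 3/100" by (simp add: close_labels_def)
    show ?thesis
      using 1 2 3 d_triangle[of "\<sigma> j t" "a (\<zeta> j \<alpha>)" "\<sigma> j ?t"] d_triangle[of "\<sigma> j ?t" "a (\<zeta> j \<alpha>)" "a (vertex_label m0 (\<sigma> j) \<beta>)"]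
      by linarith
  qed
  have same_face': "\<zeta> j (simplical_face k \<alpha>) = \<zeta> j' (simplical_face k' \<alpha>)"
    if "n \<noteq> 0" "j < J" "j' < J" "k \<le> n" "k' \<le> n" "singular_face n k (\<sigma> j) = singular_face n k' (\<sigma> j')" "\<alpha> \<in> grid (n - 1) m" for j k j' k' \<alpha>
    using same_face[OF that(1-5) _ that(7)] that(6) by (simp add: same_face_def)
  obtain c0 where c0: "singular_chain (Suc n) M c0"
    "chain_boundary (Suc n) c0 = base_chain - (\<Sum>j<J. frag_cmul (b j) (frag_of (realize n m (\<zeta> j))))"
    using realize_homologous[where J = J and n = n and m = m and \<sigma> = \<sigma> and \<zeta> = \<zeta> and b = b, OF \<sigma> cyc \<zeta>1 near same_face'] by blast
  define B where "B = (\<Sum>i<R. frag_cmul (e i) (frag_of (realize (Suc n) m (\<tau> i))))"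
  have Bc: "singular_chain (Suc n) M B"
    unfolding B_def by (intro singular_chain_sum singular_chain_cmul) (simp add: singular_chain_of singular_simplex_realize small)
  define F where "F = (\<lambda>r. realize n m (entry_label n J \<zeta> \<tau> r))"
  have F1: "F j = realize n m (\<zeta> j)" if "j < J" for j
    unfolding F_def by (rule realize_cong) (simp add: entry_label_def that)
  have bdB: "chain_boundary (Suc n) B = (\<Sum>i<R. frag_cmul (e i) (\<Sum>k\<le>Suc n. frag_cmul ((-1) ^ k) (frag_of (F (J + i * (n + 2) + k)))))"
  proof -
    have "F (J + i * (n + 2) + k) = singular_face (Suc n) k (realize (Suc n) m (\<tau> i))" if "k \<le> Suc n" for i k
      unfolding F_def entry_simplex[OF that] singular_face_realize[OF that] ..
    then have "(\<Sum>k\<le>Suc n. frag_cmul ((-1) ^ k) (frag_of (F (J + i * (n + 2) + k))))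
        = chain_boundary (Suc n) (frag_of (realize (Suc n) m (\<tau> i)))" for i
      unfolding chain_boundary_of by (simp del: sum.atMost_Suc)
    then show ?thesis unfolding B_def by (simp add: chain_boundary_sum chain_boundary_cmul o_def)
  qed
  \<comment> \<open>Subtracting D c0 exchanges D times the base chain for D times its spanned
    labelling.\<close>
  let ?b = "B - frag_cmul (int D) c0"
  have "frag_cmul (int D) base_chain + chain_boundary (Suc n) ?b
      = frag_cmul (int D) (\<Sum>j<J. frag_cmul (b j) (frag_of (F j))) + chain_boundary (Suc n) B"
  proof -
    have "(\<Sum>j<J. frag_cmul (b j) (frag_of (F j))) = (\<Sum>j<J. frag_cmul (b j) (frag_of (realize n m (\<zeta> j))))"
      using F1 by simp
    then show ?thesis
      by (simp add: chain_boundary_diff chain_boundary_cmul c0(2) frag_cmul_diff_right algebra_simps)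
  qed
  also have "\<dots> = (\<Sum>r<?L. frag_cmul (entry_coeff n J D b e r) (frag_of (F r)))"
    unfolding entry_sum bdB ..
  finally have eq: "frag_cmul (int D) base_chain + chain_boundary (Suc n) ?b = \<dots>" .
  have FF: "F r = F s" if "r \<in> {..<?L}" "s \<in> {..<?L}" "cls r = cls s" for r s
    unfolding F_def by (rule realize_cong, rule same) (use that in simp_all)
  have "l1_norm (real_of_chain (frag_cmul (int D) base_chain + chain_boundary (Suc n) ?b)) \<le> real_of_int (class_cost n J D b e R cls)"
    unfolding eq l1_norm_frag_sum[OF finite_lessThan] of_int_le_iff class_cost_eq[OF cls]
    by (rule sum_abs_fibres_le'[OF finite_lessThan FF])
  moreover have "singular_chain (Suc n) M ?b"
    using Bc c0(1) by (intro singular_chain_diff singular_chain_cmul)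
  ultimately show ?thesis by blast
qed

lemma vertex_label_face:
  assumes "\<alpha> \<in> grid p m" "0 < m"
  shows "vertex_label m f (simplical_face k \<alpha>) = vertex_label m (singular_face (Suc p) k f) \<alpha>"
  using grid_scaled[OF assms] by (simp add: vertex_label_def singular_face_def simplical_face_scaled)

lemma vertex_label_lt:
  assumes "singular_simplex p M f" "\<alpha> \<in> grid p m" "0 < m"
  shows "vertex_label m f \<alpha> < v"
  unfolding vertex_label_def by (rule \<nu>(1)[OF simplex_topspace[OF assms(1) grid_scaled[OF assms(2,3)]]])

lemma vertex_label_close:
  assumes f: "singular_simplex p M f" and \<alpha>: "\<alpha> \<in> grid p m" "0 < m" and \<beta>: "\<beta> \<in> grid p m'" "0 < m'"
    and "d (f (\<lambda>i. real (\<alpha> i) / real m)) (f (\<lambda>i. real (\<beta> i) / real m')) < 1/100"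
  shows "close_labels (vertex_label m f \<alpha>) (vertex_label m' f \<beta>)"
proof -
  let ?x = "f (\<lambda>i. real (\<alpha> i) / real m)" and ?y = "f (\<lambda>i. real (\<beta> i) / real m')"
  have "d ?x (a (\<nu> ?x)) < 1/100" "d ?y (a (\<nu> ?y)) < 1/100"
    using \<nu>(2) simplex_topspace[OF f] grid_scaled \<alpha> \<beta> by blast+
  then have "d (a (\<nu> ?x)) (a (\<nu> ?y)) < 3/100"
    using d_triangle[of "a (\<nu> ?x)" "a (\<nu> ?y)" ?x] d_triangle[of ?x "a (\<nu> ?y)" ?y] d_sym[of ?x "a (\<nu> ?x)"] assms(6)
    by linarith
  then show ?thesis using vertex_label_lt[OF f \<alpha>] vertex_label_lt[OF f \<beta>] by (simp add: close_labels_def vertex_label_def)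
qed

text \<open>Labels are read off the images of grid points, at a level fine enough for neighbours to
  have close labels. Equal simplices receive equal labels, so classes of equal labels are unions of
  classes of equal simplices and the cost does not exceed the norm.\<close>

lemma certificate_complete:
  assumes b': "singular_chain (Suc n) M b'"
  shows "\<exists>m R \<zeta> \<tau> cls e. cert m R \<zeta> \<tau> cls \<and>
     real_of_int (class_cost n J D b e R cls) \<le> l1_norm (real_of_chain (frag_cmul (int D) base_chain + chain_boundary (Suc n) b'))"
proof -
  define R where "R = card (Poly_Mapping.keys b')"
  obtain \<rho> where \<rho>: "bij_betw \<rho> {..<R} (Poly_Mapping.keys b')"
    using ex_bij_betw_nat_finite[OF finite_keys, of b'] unfolding R_def atLeast0LessThan by blast
  define e where "e = (\<lambda>i. Poly_Mapping.lookup b' (\<rho> i))"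
  have beq: "b' = (\<Sum>i<R. frag_cmul (e i) (frag_of (\<rho> i)))"
  proof -
    have "b' = (\<Sum>f\<in>Poly_Mapping.keys b'. frag_cmul (Poly_Mapping.lookup b' f) (frag_of f))"
      using frag_expansion[of b'] by (simp add: frag_extend_def)
    also have "\<dots> = (\<Sum>i<R. frag_cmul (e i) (frag_of (\<rho> i)))"
      unfolding e_def by (rule sum.reindex_bij_betw[OF \<rho>, symmetric])
    finally show ?thesis .
  qed
  have \<rho>s: "singular_simplex (Suc n) M (\<rho> i)" if "i < R" for i
    using b' bij_betwE[OF \<rho>] that by (auto simp: singular_chain_def)
  obtain \<delta> where \<delta>: "\<delta> > 0" "\<forall>i<R. \<forall>t\<in>standard_simplex (Suc n). \<forall>t'\<in>standard_simplex (Suc n).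
      (\<forall>l. \<bar>t l - t' l\<bar> \<le> \<delta>) \<longrightarrow> d (\<rho> i t) (\<rho> i t') < 1/100"
    using simplices_uniformly_continuous[where N = R and f = \<rho> and \<epsilon> = "1/100", OF d_continuous d_refl \<rho>s] by auto
  obtain m1 :: nat where m1: "1 / \<delta> < real m1" using reals_Archimedean2 by blast
  \<comment> \<open>The certificate requires m0 \<le> m, and m1 makes one grid step at most
    \<delta>.\<close>
  define m where "m = max m0 m1"
  have m: "m0 \<le> m" "0 < m" using m0 by (auto simp: m_def)
  have m\<delta>: "1 / real m \<le> \<delta>"
  proof -
    have "1 / \<delta> < real m" using m1 by (simp add: m_def)
    then show ?thesis using \<delta>(1) m(2) by (simp add: field_simps)
  qed
  let ?L = "J + R * (n + 2)"
  define \<zeta> where "\<zeta> = (\<lambda>j. vertex_label m (\<sigma> j))"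
  define \<tau> where "\<tau> = (\<lambda>i. vertex_label m (\<rho> i))"
  define F where "F = (\<lambda>r. if r < J then \<sigma> r else singular_face (Suc n) ((r - J) mod (n + 2)) (\<rho> ((r - J) div (n + 2))))"
  have FL: "entry_label n J \<zeta> \<tau> r \<alpha> = vertex_label m (F r) \<alpha>" if "\<alpha> \<in> grid n m" for r \<alpha>
    using vertex_label_face[OF that m(2)] by (simp add: entry_label_def F_def \<zeta>_def \<tau>_def)
  \<comment> \<open>The least entry with the same labels represents its class; being at most r, it
    is again a valid entry number.\<close>
  define cls where "cls = (\<lambda>r. LEAST s. \<forall>\<alpha>\<in>grid n m. vertex_label m (F s) \<alpha> = vertex_label m (F r) \<alpha>)"
  have cls_le: "cls r \<le> r" for r unfolding cls_def by (rule Least_le) simp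
  have cls_same: "\<forall>\<alpha>\<in>grid n m. vertex_label m (F (cls r)) \<alpha> = vertex_label m (F r) \<alpha>" for r
    unfolding cls_def by (rule LeastI[of _ r]) simp
  have "cert m R \<zeta> \<tau> cls"
    unfolding chain_certificate_def
  proof (intro conjI allI impI ballI)
    fix i \<alpha> assume i: "i < R" and \<alpha>: "\<alpha> \<in> grid (Suc n) m"
    show "\<tau> i \<alpha> < v" unfolding \<tau>_def by (rule vertex_label_lt[OF \<rho>s[OF i] \<alpha> m(2)])
    fix \<beta> assume \<beta>: "\<beta> \<in> grid (Suc n) m" and close: "\<forall>l\<le>Suc n. \<alpha> l \<le> \<beta> l + 1 \<and> \<beta> l \<le> \<alpha> l + 1"
    have "\<bar>real (\<alpha> l) / real m - real (\<beta> l) / real m\<bar> \<le> \<delta>" for l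
    proof -
      have "\<alpha> l \<le> \<beta> l + 1 \<and> \<beta> l \<le> \<alpha> l + 1"
        using close \<alpha> \<beta> by (cases "l \<le> Suc n") (auto simp: grid_def)
      then have "\<bar>real (\<alpha> l) - real (\<beta> l)\<bar> \<le> 1" by linarith
      then have "\<bar>real (\<alpha> l) / real m - real (\<beta> l) / real m\<bar> \<le> 1 / real m"
        using m(2) by (simp add: divide_right_mono flip: diff_divide_distrib)
      then show ?thesis using m\<delta> by linarith
    qed
    then have "d (\<rho> i (\<lambda>l. real (\<alpha> l) / real m)) (\<rho> i (\<lambda>l. real (\<beta> l) / real m)) < 1/100"
      using \<delta>(2) i grid_scaled[OF \<alpha> m(2)] grid_scaled[OF \<beta> m(2)] by simp
    then show "close_labels (\<tau> i \<alpha>) (\<tau> i \<beta>)" unfolding \<tau>_def by (rule vertex_label_close[OF \<rho>s[OF i] \<alpha> m(2) \<beta> m(2)])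
  next
    fix j \<alpha> assume j: "j < J" and \<alpha>: "\<alpha> \<in> grid n m"
    show "\<zeta> j \<alpha> < v" unfolding \<zeta>_def by (rule vertex_label_lt[OF \<sigma>[OF j] \<alpha> m(2)])
    fix \<beta> assume \<beta>: "\<beta> \<in> grid n m0" and close: "\<forall>l\<le>n. m0 * \<alpha> l \<le> m * \<beta> l + 3 * m \<and> m * \<beta> l \<le> m0 * \<alpha> l + 3 * m"
    \<comment> \<open>Here the bound 3/m0 of \<open>fine\<close> meets the factor 3 in the
      certificate.\<close>
    have "\<bar>real (\<beta> l) / real m0 - real (\<alpha> l) / real m\<bar> \<le> 3 / real m0" for l
    proof -
      have "m0 * \<alpha> l \<le> m * \<beta> l + 3 * m \<and> m * \<beta> l \<le> m0 * \<alpha> l + 3 * m"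
        using close \<alpha> \<beta> by (cases "l \<le> n") (auto simp: grid_def)
      then have "real m0 * real (\<alpha> l) \<le> real m * real (\<beta> l) + 3 * real m \<and> real m * real (\<beta> l) \<le> real m0 * real (\<alpha> l) + 3 * real m"
        by (metis (mono_tags, lifting) of_nat_add of_nat_le_iff of_nat_mult of_nat_numeral)
      then have "\<bar>real m * real (\<beta> l) - real m0 * real (\<alpha> l)\<bar> \<le> 3 * real m" by linarith
      moreover have "real (\<beta> l) / real m0 - real (\<alpha> l) / real m = (real m * real (\<beta> l) - real m0 * real (\<alpha> l)) / (real m0 * real m)"
        using m(2) m0 by (simp add: field_simps)
      ultimately have "\<bar>real (\<beta> l) / real m0 - real (\<alpha> l) / real m\<bar> \<le> 3 * real m / \<bar>real m0 * real m\<bar>"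
        by (simp only: abs_divide divide_right_mono abs_ge_zero)
      then show ?thesis using m(2) m0 by simp
    qed
    then have "d (\<sigma> j (\<lambda>l. real (\<beta> l) / real m0)) (\<sigma> j (\<lambda>l. real (\<alpha> l) / real m)) < 1/100"
      using fine[OF j grid_scaled[OF \<beta> m0] grid_scaled[OF \<alpha> m(2)]] by simp
    then show "close_labels (vertex_label m0 (\<sigma> j) \<beta>) (\<zeta> j \<alpha>)" unfolding \<zeta>_def by (rule vertex_label_close[OF \<sigma>[OF j] \<beta> m0 \<alpha> m(2)])
  next
    fix j k j' k' \<alpha> assume "n \<noteq> 0" "same_face j k j' k'" and \<alpha>: "\<alpha> \<in> grid (n - 1) m"
    then have n: "Suc (n - 1) = n" and "singular_face n k (\<sigma> j) = singular_face n k' (\<sigma> j')" by (auto simp: same_face_def)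
    then show "\<zeta> j (simplical_face k \<alpha>) = \<zeta> j' (simplical_face k' \<alpha>)"
      unfolding \<zeta>_def vertex_label_face[OF \<alpha> m(2)] n by simp
  next
    fix r assume r: "r < ?L"
    then show "cls r < ?L" using cls_le[of r] by linarith
    fix s \<alpha> assume "cls r = cls s" "\<alpha> \<in> grid n m"
    then show "entry_label n J \<zeta> \<tau> r \<alpha> = entry_label n J \<zeta> \<tau> s \<alpha>"
      using cls_same[of r] cls_same[of s] FL by simp
  qed (rule m(1))
  moreover have "real_of_int (class_cost n J D b e R cls) \<le> l1_norm (real_of_chain (frag_cmul (int D) base_chain + chain_boundary (Suc n) b'))"
  proof -
    have F2: "F (J + i * (n + 2) + k) = singular_face (Suc n) k (\<rho> i)" if "k \<le> Suc n" for i k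
    proof -
      have k: "k < n + 2" using that by simp
      show ?thesis by (simp only: F_def entry_index[OF k] if_False)
    qed
    have "(\<Sum>k\<le>Suc n. frag_cmul ((-1) ^ k) (frag_of (F (J + i * (n + 2) + k)))) = chain_boundary (Suc n) (frag_of (\<rho> i))" for i
      unfolding chain_boundary_of using F2 by (simp del: sum.atMost_Suc)
    then have bd: "chain_boundary (Suc n) b' = (\<Sum>i<R. frag_cmul (e i) (\<Sum>k\<le>Suc n. frag_cmul ((-1) ^ k) (frag_of (F (J + i * (n + 2) + k)))))"
      unfolding beq by (simp add: chain_boundary_sum chain_boundary_cmul o_def)
    have base_chain: "base_chain = (\<Sum>j<J. frag_cmul (b j) (frag_of (F j)))" by (simp add: F_def)
    have eq: "frag_cmul (int D) base_chain + chain_boundary (Suc n) b' = (\<Sum>r<?L. frag_cmul (entry_coeff n J D b e r) (frag_of (F r)))"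
      unfolding entry_sum bd base_chain ..
    have cls_lt: "\<forall>r<?L. cls r < ?L" using cls_le by (meson le_less_trans)
    show ?thesis
      unfolding eq l1_norm_frag_sum[OF finite_lessThan] of_int_le_iff class_cost_eq[OF cls_lt]
      by (rule sum_abs_fibres_le'[OF finite_lessThan]) (simp add: cls_def)
  qed
  ultimately show ?thesis by blast
qed

end

lemma finite_net:
  assumes d: "continuous_map (prod_topology M M) euclideanreal (\<lambda>(x, y). d x y)" "\<And>x. d x x = 0" "\<And>x y. d x y = d y x"
    and M: "compact_space M" and "0 < (\<epsilon>::real)"
  shows "\<exists>(v::nat) a \<nu>. (\<forall>u<v. a u \<in> topspace M) \<and> (\<forall>x\<in>topspace M. \<nu> x < v \<and> d x (a (\<nu> x)) < \<epsilon>)"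
proof -
  let ?B = "\<lambda>p. {x \<in> topspace M. d x p \<in> {..<\<epsilon>}}"
  have "openin M (?B p)" if p: "p \<in> topspace M" for p
  proof (rule openin_continuous_map_preimage)
    have "continuous_map M (prod_topology M M) (\<lambda>x. (x, p))"
      using p by (simp add: continuous_map_paired)
    from continuous_map_compose[OF this d(1)] show "continuous_map M euclideanreal (\<lambda>x. d x p)"
      by (simp add: o_def)
  qed auto
  then have "\<forall>U\<in>?B ` topspace M. openin M U" by blast
  moreover have "topspace M \<subseteq> \<Union>(?B ` topspace M)" using d(2) \<open>0 < \<epsilon>\<close> by auto
  ultimately have "\<exists>F. finite F \<and> F \<subseteq> ?B ` topspace M \<and> topspace M \<subseteq> \<Union>F"
    using M[unfolded compact_space_alt] by blast
  then obtain G where G: "finite G" "G \<subseteq> topspace M" "topspace M \<subseteq> \<Union>(?B ` G)"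
    by (metis (no_types, lifting) finite_subset_image)
  obtain a where a: "bij_betw a {..<card G} G"
    using ex_bij_betw_nat_finite[OF G(1)] unfolding atLeast0LessThan by blast
  have "\<exists>u<card G. d x (a u) < \<epsilon>" if x: "x \<in> topspace M" for x
  proof -
    obtain p where "p \<in> G" "d x p < \<epsilon>" using G(3) x by blast
    then show ?thesis using bij_betw_imp_surj_on[OF a] by (metis imageE lessThan_iff)
  qed
  then have "\<forall>x\<in>topspace M. \<exists>u. u < card G \<and> d x (a u) < \<epsilon>" by blast
  then obtain \<nu> where "\<forall>x\<in>topspace M. \<nu> x < card G \<and> d x (a (\<nu> x)) < \<epsilon>"
    by (rule bchoice[THEN exE])
  moreover have "\<forall>u<card G. a u \<in> topspace M" using a G(2) by (auto simp: bij_betw_def)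
  ultimately show ?thesis by blast
qed

text \<open>The data of \<open>M\<close> are quantified before x: one choice serves all thresholds.
  The condition on \<open>cl\<close> is what makes this relation a finite table; the other data are
  consulted only at finitely many arguments.\<close>

theorem simplicial_volume_less_iff_certificate:
  fixes M :: "'a topology" and z :: "'a chain"
  assumes M: "closed_manifold n M" and z: "singular_relcycle n M {} z"
  shows "\<exists>v cl J m0 lam con b. (\<forall>u u'. cl u u' \<longrightarrow> u < v \<and> u' < v) \<and> (\<forall>x. simplicial_volume n M z < x \<longleftrightarrow>
    (\<exists>D m R \<zeta> \<tau> cls e. 0 < D \<and> chain_certificate n v cl J m0 lam con m R \<zeta> \<tau> cls \<and>
       real_of_int (class_cost n J D b e R cls) < real D * x))"
proof (rule closed_manifold_mixing[OF M])
  fix chs :: "'a chart list" and d assume chs: "\<And>ch. ch \<in> set chs \<Longrightarrow> convex_chart M ch"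
    and d: "\<And>x. d x x = 0" "\<And>x y. d x y = d y x" "\<And>x y z. d x z \<le> d x y + d y z"
      "continuous_map (prod_topology M M) euclideanreal (\<lambda>(x, y). d x y)"
    and mix: "\<And>x I w y. x \<in> topspace M \<Longrightarrow> weights I w \<Longrightarrow> y ` I \<subseteq> {y \<in> topspace M. d x y < 1} \<Longrightarrow> mixable chs I w y"
  have "compact_space M" using M by (simp add: closed_manifold_def)
  then obtain v :: nat and a \<nu> where a: "\<forall>u<v. a u \<in> topspace M"
    and \<nu>: "\<forall>x\<in>topspace M. \<nu> x < v \<and> d x (a (\<nu> x)) < 1/100"
    using finite_net[OF d(4,1,2), of "1/100"] by auto
  have zc: "singular_chain n M z" "chain_boundary n z = 0" using z by (auto simp: singular_cycle)
  define J where "J = card (Poly_Mapping.keys z)"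
  obtain \<sigma> where \<sigma>: "bij_betw \<sigma> {..<J} (Poly_Mapping.keys z)"
    using ex_bij_betw_nat_finite[OF finite_keys, of z] unfolding J_def atLeast0LessThan by blast
  define b where "b = (\<lambda>j. Poly_Mapping.lookup z (\<sigma> j))"
  have zeq: "z = (\<Sum>j<J. frag_cmul (b j) (frag_of (\<sigma> j)))"
  proof -
    have "z = (\<Sum>f\<in>Poly_Mapping.keys z. frag_cmul (Poly_Mapping.lookup z f) (frag_of f))"
      using frag_expansion[of z] by (simp add: frag_extend_def)
    also have "\<dots> = (\<Sum>j<J. frag_cmul (b j) (frag_of (\<sigma> j)))"
      unfolding b_def by (rule sum.reindex_bij_betw[OF \<sigma>, symmetric])
    finally show ?thesis .
  qed
  have \<sigma>s: "singular_simplex n M (\<sigma> j)" if "j < J" for j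
    using zc(1) bij_betwE[OF \<sigma>] that by (auto simp: singular_chain_def)
  obtain \<delta> where \<delta>: "\<delta> > 0" "\<forall>j<J. \<forall>t\<in>standard_simplex n. \<forall>t'\<in>standard_simplex n.
      (\<forall>i. \<bar>t i - t' i\<bar> \<le> \<delta>) \<longrightarrow> d (\<sigma> j t) (\<sigma> j t') < 1/100"
    using simplices_uniformly_continuous[where N = J and f = \<sigma> and \<epsilon> = "1/100", OF d(4,1) \<sigma>s] by auto
  obtain m1 :: nat where m1: "3 / \<delta> < real m1" using reals_Archimedean2 by blast
  define m0 where "m0 = Suc m1"
  have m\<delta>: "3 / real m0 \<le> \<delta>"
  proof -
    have "3 / \<delta> < real m0" using m1 by (simp add: m0_def)
    then show ?thesis using \<delta>(1) by (simp add: field_simps m0_def)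
  qed
  interpret labelled_cycle M chs d v a n J \<sigma> b m0 \<nu>
  proof
    fix j t t' assume j: "j < J" and t: "t \<in> standard_simplex n" "t' \<in> standard_simplex n" "\<forall>i. \<bar>t i - t' i\<bar> \<le> 3 / real m0"
    have "\<forall>i. \<bar>t i - t' i\<bar> \<le> \<delta>" using t(3) m\<delta> by (meson order_trans)
    then show "d (\<sigma> j t) (\<sigma> j t') < 1/100" using \<delta>(2) j t by simp
  next
    show "d x z \<le> d x y + d y z" for x y z by (rule d(3))
    show "mixable chs I w y" if "x \<in> topspace M" "weights I w" "y ` I \<subseteq> {y \<in> topspace M. d x y < 1}" for x I w y
      using mix that by blast
    show "chain_boundary n (\<Sum>j<J. frag_cmul (b j) (frag_of (\<sigma> j))) = 0" using zc(2) zeq by simp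
  qed (use chs d(1,2,4) a \<nu> \<sigma>s in \<open>simp_all add: m0_def\<close>)
  have "simplicial_volume n M z < x \<longleftrightarrow>
    (\<exists>D m R \<zeta> \<tau> cls e. 0 < D \<and> chain_certificate n v close_labels J m0 (\<lambda>j. vertex_label m0 (\<sigma> j)) same_face m R \<zeta> \<tau> cls \<and>
       real_of_int (class_cost n J D b e R cls) < real D * x)" for x
    unfolding simplicial_volume_less_iff[OF zc(1)]
  proof
    assume "\<exists>D b'. 0 < D \<and> singular_chain (Suc n) M b' \<and>
       l1_norm (real_of_chain (frag_cmul (int D) z + chain_boundary (Suc n) b')) < real D * x"
    then obtain D b' where Db: "0 < D" "singular_chain (Suc n) M b'"
       "l1_norm (real_of_chain (frag_cmul (int D) z + chain_boundary (Suc n) b')) < real D * x" by blast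
    obtain m R \<zeta> \<tau> cls e where "cert m R \<zeta> \<tau> cls"
     "real_of_int (class_cost n J D b e R cls) \<le> l1_norm (real_of_chain (frag_cmul (int D) base_chain + chain_boundary (Suc n) b'))"
      using certificate_complete[OF Db(2), of D] by blast
    moreover from this(2) have "real_of_int (class_cost n J D b e R cls) < real D * x"
      using Db(3) unfolding zeq[symmetric] by linarith
    ultimately show "\<exists>D m R \<zeta> \<tau> cls e. 0 < D \<and> cert m R \<zeta> \<tau> cls \<and>
       real_of_int (class_cost n J D b e R cls) < real D * x" using Db(1) by blast
  next
    assume "\<exists>D m R \<zeta> \<tau> cls e. 0 < D \<and> cert m R \<zeta> \<tau> cls \<and>
       real_of_int (class_cost n J D b e R cls) < real D * x"
    then obtain D m R \<zeta> \<tau> cls e where c: "0 < D" "cert m R \<zeta> \<tau> cls"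
       "real_of_int (class_cost n J D b e R cls) < real D * x" by blast
    obtain b' where "singular_chain (Suc n) M b'"
      "l1_norm (real_of_chain (frag_cmul (int D) base_chain + chain_boundary (Suc n) b')) \<le> real_of_int (class_cost n J D b e R cls)"
      using certificate_sound[OF c(2), of D e] by blast
    moreover from this(2) have "l1_norm (real_of_chain (frag_cmul (int D) z + chain_boundary (Suc n) b')) < real D * x"
      using c(3) unfolding zeq[symmetric] by linarith
    ultimately show "\<exists>D b'. 0 < D \<and> singular_chain (Suc n) M b' \<and>
       l1_norm (real_of_chain (frag_cmul (int D) z + chain_boundary (Suc n) b')) < real D * x"
      using c(1) by blast
  qed
  moreover have "\<forall>u u'. close_labels u u' \<longrightarrow> u < v \<and> u' < v" by (simp add: close_labels_def)
  ultimately show ?thesis by blast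
qed

section \<open>Total recursive functions\<close>

inductive_cases evalr_Zero: "evalr Zero xs y"
inductive_cases evalr_Succ: "evalr Succ xs y"
inductive_cases evalr_Proj: "evalr (Proj i) xs y"
inductive_cases evalr_Comp: "evalr (Comp f gs) xs y"
inductive_cases evalr_Prec0: "evalr (Prec f g) (0 # xs) y"
inductive_cases evalr_PrecS: "evalr (Prec f g) (Suc m # xs) y"
inductive_cases evalr_Mu: "evalr (Mu f) xs y"

text \<open>The default 0 gives variables beyond the argument list a harmless value, so
  \<open>total_rec_var\<close> holds for every index.\<close>

definition env :: "nat list \<Rightarrow> nat \<Rightarrow> nat" where
  "env xs i = (if i < length xs then xs ! i else 0)"

text \<open>Recursive functions of \<open>k\<close> arguments, seen as functions of an environment, so that a bound
  variable is a shift of the environment.\<close>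

definition total_rec :: "nat \<Rightarrow> ((nat \<Rightarrow> nat) \<Rightarrow> nat) \<Rightarrow> bool" where
  "total_rec k f \<longleftrightarrow> (\<exists>g. \<forall>xs. length xs = k \<longrightarrow> (\<forall>y. evalr g xs y \<longleftrightarrow> y = f (env xs)))"

lemma env_Cons [simp]: "env (x # xs) 0 = x" "env (x # xs) (Suc i) = env xs i"
  by (auto simp: env_def)

lemma env_shift: "(\<lambda>i. env (x # xs) (Suc i)) = env xs" "(\<lambda>i. env (x # y # xs) (Suc (Suc i))) = env xs"
  by auto

lemma evalr_Comp_total:
  assumes gs: "list_all2 (\<lambda>g y. \<forall>y'. evalr g xs y' \<longleftrightarrow> y' = y) gs ys"
    and f: "\<And>z. evalr f ys z \<longleftrightarrow> z = w"
  shows "evalr (Comp f gs) xs z \<longleftrightarrow> z = w"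
proof
  assume "evalr (Comp f gs) xs z"
  then obtain ys' where ys': "length ys' = length gs" "\<forall>i<length gs. evalr (gs ! i) xs (ys' ! i)" "evalr f ys' z"
    by (rule evalr_Comp)
  have "ys' = ys"
    by (rule nth_equalityI) (use ys' gs in \<open>auto simp: list_all2_conv_all_nth\<close>)
  then show "z = w" using f ys'(3) by simp
next
  assume "z = w"
  then show "evalr (Comp f gs) xs z"
    by (intro evalr.comp[of ys]) (use gs f in \<open>auto simp: list_all2_conv_all_nth\<close>)
qed

lemma total_rec_comp:
  assumes h: "total_rec (length fs) h" and fs: "\<And>f. f \<in> set fs \<Longrightarrow> total_rec k f"
  shows "total_rec k (\<lambda>e. h (env (map (\<lambda>f. f e) fs)))"
proof -
  obtain g where g: "\<And>xs y. length xs = length fs \<Longrightarrow> evalr g xs y \<longleftrightarrow> y = h (env xs)"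
    using h unfolding total_rec_def by blast
  have "\<forall>f\<in>set fs. \<exists>g. \<forall>xs. length xs = k \<longrightarrow> (\<forall>y. evalr g xs y \<longleftrightarrow> y = f (env xs))"
    using fs unfolding total_rec_def by blast
  then obtain G where G: "\<forall>f\<in>set fs. \<forall>xs. length xs = k \<longrightarrow> (\<forall>y. evalr (G f) xs y \<longleftrightarrow> y = f (env xs))"
    by (rule bchoice[THEN exE])
  have "evalr (Comp g (map G fs)) xs y \<longleftrightarrow> y = h (env (map (\<lambda>f. f (env xs)) fs))" if "length xs = k" for xs y
    by (rule evalr_Comp_total[of xs _ "map (\<lambda>f. f (env xs)) fs"])
       (use that G in \<open>auto simp: list_all2_conv_all_nth g\<close>)
  then show ?thesis unfolding total_rec_def by blast
qed

lemma total_rec_comp1: "total_rec 1 (\<lambda>e. h (e 0)) \<Longrightarrow> total_rec k f \<Longrightarrow> total_rec k (\<lambda>e. h (f e))"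
  using total_rec_comp[of "[f]" "\<lambda>e. h (e 0)" k] by simp

lemma total_rec_zero: "total_rec k (\<lambda>e. 0)"
  unfolding total_rec_def by (rule exI[of _ Zero]) (auto elim: evalr_Zero intro: evalr.intros)

lemma total_rec_Suc: "total_rec k f \<Longrightarrow> total_rec k (\<lambda>e. Suc (f e))"
proof -
  have "total_rec 1 (\<lambda>e. Suc (e 0))"
    unfolding total_rec_def
    by (rule exI[of _ Succ]) (auto simp: length_Suc_conv elim: evalr_Succ intro: evalr.intros)
  then show "total_rec k f \<Longrightarrow> total_rec k (\<lambda>e. Suc (f e))" by (rule total_rec_comp1)
qed

lemma total_rec_const: "total_rec k (\<lambda>e. c)"
  by (induction c) (auto intro: total_rec_zero total_rec_Suc)

lemma total_rec_var: "total_rec k (\<lambda>e. e i)"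
proof (cases "i < k")
  case True
  then show ?thesis unfolding total_rec_def
    by (intro exI[of _ "Proj i"]) (auto simp: env_def elim: evalr_Proj intro: evalr.intros)
next
  case False
  have "total_rec k (\<lambda>e. 0)" by (rule total_rec_zero)
  then show ?thesis using False by (simp add: total_rec_def env_def)
qed

lemma env_nth: "length xs = k \<Longrightarrow> map (\<lambda>i. env xs i) [0..<k] = xs"
  by (rule nth_equalityI) (auto simp: env_def)

text \<open>\<open>Prec\<close> recurses on its first argument. Composition with the computed bound
  and the \<open>k\<close> projections turns this into recursion up to \<open>b e\<close>; the step
  sees the counter as variable 0, the accumulated value as variable 1 and then the
  parameters.\<close>

lemma total_rec_rec:
  assumes b: "total_rec k b" and f: "total_rec k f"
    and s: "total_rec (Suc (Suc k)) (\<lambda>e. s (e 0) (e (Suc 0)) (\<lambda>i. e (Suc (Suc i))))"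
  shows "total_rec k (\<lambda>e. rec_nat (f e) (\<lambda>m y. s m y e) (b e))"
proof -
  obtain gf where gf: "\<And>xs y. length xs = k \<Longrightarrow> evalr gf xs y \<longleftrightarrow> y = f (env xs)"
    using f unfolding total_rec_def by blast
  obtain gs where gs: "\<And>xs z. length xs = Suc (Suc k) \<Longrightarrow> evalr gs xs z \<longleftrightarrow> z = s (env xs 0) (env xs (Suc 0)) (\<lambda>i. env xs (Suc (Suc i)))"
    using s unfolding total_rec_def by blast
  have gs': "evalr gs (m # y # xs) z \<longleftrightarrow> z = s m y (env xs)" if "length xs = k" for xs m y z
    using gs[of "m # y # xs" z] that by (simp add: env_shift)
  have rec: "evalr (Prec gf gs) (m # xs) y \<longleftrightarrow> y = rec_nat (f (env xs)) (\<lambda>m y. s m y (env xs)) m"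
    if xs: "length xs = k" for xs m y
  proof (induction m arbitrary: y)
    case 0
    show ?case using gf[OF xs] by (auto elim: evalr_Prec0 intro: evalr.intros)
  next
    case (Suc m)
    show ?case
    proof
      assume "evalr (Prec gf gs) (Suc m # xs) y"
      then show "y = rec_nat (f (env xs)) (\<lambda>m y. s m y (env xs)) (Suc m)"
        by (rule evalr_PrecS) (simp add: Suc.IH gs'[OF xs])
    next
      assume "y = rec_nat (f (env xs)) (\<lambda>m y. s m y (env xs)) (Suc m)"
      then show "evalr (Prec gf gs) (Suc m # xs) y"
        by (intro evalr.precS[of _ _ _ _ "rec_nat (f (env xs)) (\<lambda>m y. s m y (env xs)) m"]) (simp_all add: Suc.IH gs'[OF xs])
    qed
  qed
  have "total_rec (Suc k) (\<lambda>e. rec_nat (f (\<lambda>i. e (Suc i))) (\<lambda>m y. s m y (\<lambda>i. e (Suc i))) (e 0))"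
    unfolding total_rec_def
  proof (intro exI allI impI)
    fix ys :: "nat list" and y assume "length ys = Suc k"
    then obtain m xs where "ys = m # xs" "length xs = k" by (auto simp: length_Suc_conv)
    then show "evalr (Prec gf gs) ys y \<longleftrightarrow> y = rec_nat (f (\<lambda>i. env ys (Suc i))) (\<lambda>m y. s m y (\<lambda>i. env ys (Suc i))) (env ys 0)"
      using rec by (simp add: env_shift)
  qed
  then have "total_rec (length (b # map (\<lambda>i e. e i) [0..<k])) (\<lambda>e. rec_nat (f (\<lambda>i. e (Suc i))) (\<lambda>m y. s m y (\<lambda>i. e (Suc i))) (e 0))"
    by simp
  from total_rec_comp[OF this, of k] b total_rec_var
  have "total_rec k (\<lambda>e. (\<lambda>e. rec_nat (f (\<lambda>i. e (Suc i))) (\<lambda>m y. s m y (\<lambda>i. e (Suc i))) (e 0)) (env (map (\<lambda>f. f e) (b # map (\<lambda>i e. e i) [0..<k]))))"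
    by auto
  then show ?thesis
    unfolding total_rec_def by (simp add: env_shift o_def env_nth cong: conj_cong imp_cong)
qed

lemma total_rec_add: "total_rec k f \<Longrightarrow> total_rec k g \<Longrightarrow> total_rec k (\<lambda>e. f e + g e)"
proof -
  assume "total_rec k f" "total_rec k g"
  then have "total_rec k (\<lambda>e. rec_nat (f e) (\<lambda>m y. Suc y) (g e))"
    by (intro total_rec_rec total_rec_Suc total_rec_var)
  moreover have "rec_nat a (\<lambda>m y. Suc y) b = a + b" for a b by (induction b) auto
  ultimately show ?thesis by simp
qed

lemma total_rec_diff: "total_rec k f \<Longrightarrow> total_rec k g \<Longrightarrow> total_rec k (\<lambda>e. f e - g e)"
proof -
  have "total_rec 1 (\<lambda>e. rec_nat 0 (\<lambda>m y. m) (e 0))" by (intro total_rec_rec total_rec_var total_rec_zero)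
  moreover have "rec_nat 0 (\<lambda>m y. m) n = n - 1" for n :: nat by (cases n) auto
  ultimately have pred: "total_rec k f \<Longrightarrow> total_rec k (\<lambda>e. f e - 1)" for k f
    using total_rec_comp1[of "\<lambda>n. n - 1"] by simp
  assume "total_rec k f" "total_rec k g"
  then have "total_rec k (\<lambda>e. rec_nat (f e) (\<lambda>m y. y - 1) (g e))"
    by (intro total_rec_rec pred total_rec_var)
  moreover have "rec_nat a (\<lambda>m y. y - 1) b = a - b" for a b :: nat by (induction b) auto
  ultimately show ?thesis by simp
qed

lemma total_rec_shift: "total_rec k f \<Longrightarrow> total_rec (Suc k) (\<lambda>e. f (\<lambda>i. e (Suc i)))"
proof -
  assume "total_rec k f"
  then have "total_rec (length (map (\<lambda>i e. e (Suc i)) [0..<k])) f" by simp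
  from total_rec_comp[OF this, of "Suc k"] total_rec_var
  have "total_rec (Suc k) (\<lambda>e. f (env (map (\<lambda>f. f e) (map (\<lambda>i e. e (Suc i)) [0..<k]))))"
    by auto
  moreover have "map (\<lambda>i. env xs (Suc i)) [0..<k] = drop 1 xs \<and> env (drop 1 xs) = (\<lambda>i. env xs (Suc i))"
    if "length xs = Suc k" for xs
    using that by (auto simp: env_def intro!: nth_equalityI)
  ultimately show ?thesis
    unfolding total_rec_def by (simp add: o_def cong: conj_cong imp_cong)
qed

text \<open>Bounded sums replace bounded search below: products, bounded quantifiers, quotients and
  the decoding of pairs are all obtained from them. The summand skips variable 1, the accumulator,
  which explains the double shift.\<close>

lemma total_rec_sum:
  assumes "total_rec k b" "total_rec (Suc k) (\<lambda>e. s (e 0) (\<lambda>i. e (Suc i)))"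
  shows "total_rec k (\<lambda>e. \<Sum>i<b e. s i e)"
proof -
  have "total_rec (length ((\<lambda>e. e 0) # map (\<lambda>i e. e (Suc (Suc i))) [0..<k])) (\<lambda>e. s (e 0) (\<lambda>i. e (Suc i)))"
    using assms(2) by simp
  from total_rec_comp[OF this, of "Suc (Suc k)"] total_rec_var
  have "total_rec (Suc (Suc k)) (\<lambda>e. (\<lambda>e. s (e 0) (\<lambda>i. e (Suc i))) (env (map (\<lambda>f. f e) ((\<lambda>e. e 0) # map (\<lambda>i e. e (Suc (Suc i))) [0..<k]))))"
    by auto
  moreover have "map (\<lambda>i. env xs (Suc (Suc i))) [0..<k] = drop 2 xs \<and> env (drop 2 xs) = (\<lambda>i. env xs (Suc (Suc i)))"
    if "length xs = Suc (Suc k)" for xs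
    using that by (auto simp: env_def intro!: nth_equalityI)
  ultimately have "total_rec (Suc (Suc k)) (\<lambda>e. s (e 0) (\<lambda>i. e (Suc (Suc i))))"
    unfolding total_rec_def by (simp add: env_shift o_def cong: conj_cong imp_cong)
  then have "total_rec k (\<lambda>e. rec_nat 0 (\<lambda>m y. y + s m e) (b e))"
    by (intro total_rec_rec total_rec_add total_rec_var total_rec_zero assms)
  moreover have "rec_nat 0 (\<lambda>m y. y + t m) n = (\<Sum>i<n. t i)" for t :: "nat \<Rightarrow> nat" and n
    by (induction n) auto
  ultimately show ?thesis by simp
qed

lemma total_rec_mult: "total_rec k f \<Longrightarrow> total_rec k g \<Longrightarrow> total_rec k (\<lambda>e. f e * g e)"
proof -
  assume "total_rec k f" "total_rec k g"
  then have "total_rec k (\<lambda>e. \<Sum>i<f e. g e)" by (intro total_rec_sum total_rec_shift)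
  then show ?thesis by simp
qed

section \<open>Decidable predicates, finite tables and arithmetic\<close>

definition rec_predicate :: "nat \<Rightarrow> ((nat \<Rightarrow> nat) \<Rightarrow> bool) \<Rightarrow> bool" where
  "rec_predicate k P \<longleftrightarrow> total_rec k (\<lambda>e. of_bool (P e))"

lemma rec_predicate_const: "rec_predicate k (\<lambda>e. c)"
  unfolding rec_predicate_def by (rule total_rec_const)

lemma rec_predicate_not: "rec_predicate k P \<Longrightarrow> rec_predicate k (\<lambda>e. \<not> P e)"
proof -
  assume "rec_predicate k P"
  then have "total_rec k (\<lambda>e. 1 - of_bool (P e))" unfolding rec_predicate_def by (intro total_rec_diff total_rec_const)
  moreover have "1 - of_bool p = (of_bool (\<not> p) :: nat)" for p by simp
  ultimately show ?thesis unfolding rec_predicate_def by simp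
qed

lemma rec_predicate_conj: "rec_predicate k P \<Longrightarrow> rec_predicate k Q \<Longrightarrow> rec_predicate k (\<lambda>e. P e \<and> Q e)"
  unfolding rec_predicate_def of_bool_conj by (rule total_rec_mult)

lemma rec_predicate_imp: "rec_predicate k P \<Longrightarrow> rec_predicate k Q \<Longrightarrow> rec_predicate k (\<lambda>e. P e \<longrightarrow> Q e)"
  using rec_predicate_not[OF rec_predicate_conj[OF _ rec_predicate_not], of k P Q] by simp

lemma rec_predicate_le: "total_rec k f \<Longrightarrow> total_rec k g \<Longrightarrow> rec_predicate k (\<lambda>e. f e \<le> g e)"
proof -
  assume "total_rec k f" "total_rec k g"
  then have "total_rec k (\<lambda>e. 1 - (f e - g e))" by (intro total_rec_diff total_rec_const)
  moreover have "1 - (a - b) = (of_bool (a \<le> b) :: nat)" for a b :: nat by auto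
  ultimately show ?thesis unfolding rec_predicate_def by simp
qed

lemma rec_predicate_less: "total_rec k f \<Longrightarrow> total_rec k g \<Longrightarrow> rec_predicate k (\<lambda>e. f e < g e)"
  using rec_predicate_le[OF total_rec_Suc, of k f g] by (simp add: Suc_le_eq)

lemma rec_predicate_eq: "total_rec k f \<Longrightarrow> total_rec k g \<Longrightarrow> rec_predicate k (\<lambda>e. f e = g e)"
  using rec_predicate_conj[OF rec_predicate_le rec_predicate_le, of k f g g f] by (simp add: eq_iff)

lemma rec_predicate_all:
  assumes "total_rec k b" "rec_predicate (Suc k) (\<lambda>e. P (e 0) (\<lambda>i. e (Suc i)))"
  shows "rec_predicate k (\<lambda>e. \<forall>i<b e. P i e)"
proof -
  have "total_rec k (\<lambda>e. \<Sum>i<b e. of_bool (\<not> P i e))"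
    using rec_predicate_not[OF assms(2)] unfolding rec_predicate_def by (intro total_rec_sum assms(1))
  then have "rec_predicate k (\<lambda>e. (\<Sum>i<b e. of_bool (\<not> P i e)) \<le> (0::nat))"
    by (intro rec_predicate_le total_rec_const)
  moreover have "(\<Sum>i<n. of_bool (\<not> Q i)) \<le> (0::nat) \<longleftrightarrow> (\<forall>i<n. Q i)" for n :: nat and Q
    by auto
  ultimately show ?thesis by (simp only:)
qed

lemma rec_predicate_finite_all:
  assumes "finite A" "\<And>a. a \<in> A \<Longrightarrow> rec_predicate k (P a)"
  shows "rec_predicate k (\<lambda>e. \<forall>a\<in>A. P a e)"
  using assms by (induction A rule: finite_induct) (auto intro: rec_predicate_const rec_predicate_conj)

lemma rec_predicate_all_le: "(\<And>i. i \<le> N \<Longrightarrow> rec_predicate k (P i)) \<Longrightarrow> rec_predicate k (\<lambda>e. \<forall>i\<le>N. P i e)" for N :: nat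
  using rec_predicate_finite_all[of "{..N}" k P] by (simp only: finite_atMost atMost_iff Ball_def)

lemma rec_predicate_all_less: "(\<And>i. i < N \<Longrightarrow> rec_predicate k (P i)) \<Longrightarrow> rec_predicate k (\<lambda>e. \<forall>i<N. P i e)" for N :: nat
  using rec_predicate_finite_all[of "{..<N}" k P] by (simp only: finite_lessThan lessThan_iff Ball_def)

text \<open>However a relation on numbers below \<open>v\<close> arose, it is a finite disjunction
  of equalities with constants. This is how closeness in \<open>M\<close> enters a recursive
  test.\<close>

lemma rec_predicate_finite_relation:
  assumes "\<And>u u'. r u u' \<Longrightarrow> u < v \<and> u' < (v::nat)" "total_rec k f" "total_rec k g"
  shows "rec_predicate k (\<lambda>e. r (f e) (g e))"
proof -
  have "rec_predicate k (\<lambda>e. \<not> (\<forall>u<v. \<forall>u'<v. \<not> (r u u' \<and> f e = u \<and> g e = u')))"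
    by (intro rec_predicate_not rec_predicate_all_less rec_predicate_conj rec_predicate_const rec_predicate_eq total_rec_const assms(2,3))
  moreover have "\<not> (\<forall>u<v. \<forall>u'<v. \<not> (r u u' \<and> a = u \<and> b = u')) \<longleftrightarrow> r a b" for a b
    using assms(1) by auto
  ultimately show ?thesis by simp
qed

lemma total_rec_of_bool: "rec_predicate k P \<Longrightarrow> total_rec k (\<lambda>e. of_bool (P e))"
  by (simp add: rec_predicate_def)

lemma total_rec_if:
  assumes "rec_predicate k P" "total_rec k f" "total_rec k g"
  shows "total_rec k (\<lambda>e. if P e then f e else g e)"
proof -
  have "total_rec k (\<lambda>e. of_bool (P e) * f e + of_bool (\<not> P e) * g e)"
    by (intro total_rec_add total_rec_mult total_rec_of_bool rec_predicate_not assms)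
  moreover have "of_bool p * a + of_bool (\<not> p) * b = (if p then a else b)" for p and a b :: nat by simp
  ultimately show ?thesis by simp
qed

lemma total_rec_finite_sum:
  assumes "finite A" "\<And>a. a \<in> A \<Longrightarrow> total_rec k (f a)"
  shows "total_rec k (\<lambda>e. \<Sum>a\<in>A. f a e)"
  using assms by (induction A rule: finite_induct) (auto intro: total_rec_const total_rec_add)

lemma total_rec_table:
  assumes "\<And>x. x \<ge> N \<Longrightarrow> T x = (0::nat)" "total_rec k f"
  shows "total_rec k (\<lambda>e. T (f e))"
proof -
  have "total_rec k (\<lambda>e. \<Sum>x\<in>{..<N}. if f e = x then T x else 0)"
    by (intro total_rec_finite_sum total_rec_if rec_predicate_eq total_rec_const assms(2)) simp
  moreover have "(\<Sum>x\<in>{..<N}. if a = x then T x else 0) = T a" for a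
    using assms(1)[of a] by (cases "a < N") auto
  ultimately show ?thesis by simp
qed

lemma total_rec_power: "total_rec k f \<Longrightarrow> total_rec k g \<Longrightarrow> total_rec k (\<lambda>e. f e ^ g e)"
proof -
  assume f: "total_rec k f" and g: "total_rec k g"
  have "total_rec k (\<lambda>e. rec_nat 1 (\<lambda>m y. y * f e) (g e))"
    by (intro total_rec_rec total_rec_mult total_rec_var total_rec_const g total_rec_shift[OF total_rec_shift, OF f])
  moreover have "rec_nat 1 (\<lambda>m y. y * a) n = a ^ n" for a n :: nat by (induction n) auto
  ultimately show ?thesis by simp
qed

lemma total_rec_comp2:
  assumes "total_rec 2 (\<lambda>e. h (e 0) (e 1))" "total_rec k f" "total_rec k g"
  shows "total_rec k (\<lambda>e. h (f e) (g e))"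
proof -
  have "total_rec (length [f, g]) (\<lambda>e. h (e 0) (e 1))" using assms(1) by (simp add: numeral_2_eq_2)
  from total_rec_comp[OF this, of k] assms(2,3) show ?thesis by auto
qed

text \<open>For a nonzero divisor the quotient is the number of i < a with (i + 1) b \<le> a;
  division by 0 gives 0.\<close>

lemma total_rec_div: "total_rec k f \<Longrightarrow> total_rec k g \<Longrightarrow> total_rec k (\<lambda>e. f e div g e)"
proof -
  have "total_rec 2 (\<lambda>e. if e 1 = 0 then 0 else \<Sum>i<e 0. of_bool (Suc i * e 1 \<le> e 0))"
    by (intro total_rec_if total_rec_sum total_rec_of_bool rec_predicate_le rec_predicate_eq total_rec_mult total_rec_Suc total_rec_var total_rec_const)
  moreover have "(\<Sum>i<a. of_bool (Suc i * b \<le> a)) = a div b" if "b \<noteq> 0" for a b :: nat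
  proof -
    have "i < a \<and> Suc i * b \<le> a \<longleftrightarrow> i < a div b" for i
    proof -
      have "Suc i \<le> a div b \<longleftrightarrow> Suc i * b \<le> a"
        using that by (intro less_eq_div_iff_mult_less_eq) simp
      moreover have "a div b \<le> a" by (rule div_le_dividend)
      ultimately show ?thesis by linarith
    qed
    then have "{i. i < a \<and> Suc i * b \<le> a} = {..<a div b}" by blast
    then show ?thesis using that by (simp add: sum.If_cases of_bool_def lessThan_def Int_def)
  qed
  then have "(if b = 0 then 0 else \<Sum>i<a. of_bool (Suc i * b \<le> a)) = a div b" for a b :: nat
    by simp
  ultimately have "total_rec 2 (\<lambda>e. e 0 div e 1)" by (simp only:)
  then show "total_rec k f \<Longrightarrow> total_rec k g \<Longrightarrow> total_rec k (\<lambda>e. f e div g e)" by (rule total_rec_comp2)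
qed

lemma total_rec_mod: "total_rec k f \<Longrightarrow> total_rec k g \<Longrightarrow> total_rec k (\<lambda>e. f e mod g e)"
  unfolding minus_div_mult_eq_mod[symmetric] by (intro total_rec_diff total_rec_mult total_rec_div)

text \<open>Both components are at most the code, so each is a bounded double sum with exactly one
  term selected by the computable encoding.\<close>

lemma total_rec_prod_decode:
  assumes "total_rec k f"
  shows "total_rec k (\<lambda>e. fst (prod_decode (f e)))" "total_rec k (\<lambda>e. snd (prod_decode (f e)))"
proof -
  have enc: "rec_predicate k (\<lambda>e. prod_encode (f e, g e) = h e)"
    if "total_rec k f" "total_rec k g" "total_rec k h" for k f g h
    unfolding prod_encode_def triangle_def prod.case
    by (intro rec_predicate_eq total_rec_add total_rec_div total_rec_mult total_rec_Suc total_rec_const that)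
  have pick: "(\<Sum>a<Suc x. \<Sum>b<Suc x. if prod_encode (a, b) = x then h a b else 0) = h (fst (prod_decode x)) (snd (prod_decode x))"
    for h :: "nat \<Rightarrow> nat \<Rightarrow> nat" and x
  proof -
    obtain a0 b0 where ab: "prod_decode x = (a0, b0)" by (cases "prod_decode x")
    then have x: "x = prod_encode (a0, b0)" by (metis prod_decode_inverse)
    have le: "a0 < Suc x" "b0 < Suc x" unfolding x using le_prod_encode_1 le_prod_encode_2 by (auto simp: less_Suc_eq_le)
    have "(\<Sum>a<Suc x. \<Sum>b<Suc x. if prod_encode (a, b) = x then h a b else 0)
        = (\<Sum>a<Suc x. if a = a0 then \<Sum>b<Suc x. if b = b0 then h a b else 0 else 0)"
      unfolding x by (intro sum.cong refl) (auto simp: prod_encode_eq intro!: sum.cong)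
    then show ?thesis using le ab by (simp del: sum.lessThan_Suc)
  qed
  have "total_rec 1 (\<lambda>e. \<Sum>a<Suc (e 0). \<Sum>b<Suc (e 0). if prod_encode (a, b) = e 0 then a else 0)"
    by (intro total_rec_sum total_rec_if enc total_rec_Suc total_rec_var total_rec_const)
  then have 1: "total_rec 1 (\<lambda>e. fst (prod_decode (e 0)))" unfolding pick .
  have "total_rec 1 (\<lambda>e. \<Sum>a<Suc (e 0). \<Sum>b<Suc (e 0). if prod_encode (a, b) = e 0 then b else 0)"
    by (intro total_rec_sum total_rec_if enc total_rec_Suc total_rec_var total_rec_const)
  then have 2: "total_rec 1 (\<lambda>e. snd (prod_decode (e 0)))" unfolding pick .
  show "total_rec k (\<lambda>e. fst (prod_decode (f e)))" using total_rec_comp1[OF 1 assms] .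
  show "total_rec k (\<lambda>e. snd (prod_decode (f e)))" using total_rec_comp1[OF 2 assms] .
qed

text \<open>Minimisation of the characteristic function of \<not> P: it is 0 exactly at witnesses
  and 1, a successor as \<open>Mu\<close> demands, before the first one. The search variable comes
  first in the argument list.\<close>

lemma rec_enum_exists:
  assumes "rec_predicate 2 (\<lambda>e. P (e 1) (e 0))"
  shows "rec_enum {x. \<exists>y. P x y}"
proof -
  have "total_rec 2 (\<lambda>e. of_bool (\<not> P (e 1) (e 0)))" using rec_predicate_not[OF assms] by (simp add: rec_predicate_def)
  then obtain g where g: "\<And>xs y. length xs = 2 \<Longrightarrow> evalr g xs y \<longleftrightarrow> y = of_bool (\<not> P (env xs 1) (env xs 0))"
    unfolding total_rec_def by blast
  have g': "evalr g [m, x] y \<longleftrightarrow> y = of_bool (\<not> P x m)" for m x y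
    using g[of "[m, x]" y] by (simp add: env_def)
  have "(\<exists>y. evalr (Mu g) [x] y) \<longleftrightarrow> (\<exists>y. P x y)" for x
  proof
    assume "\<exists>y. evalr (Mu g) [x] y"
    then obtain y where "evalr (Mu g) [x] y" by blast
    then have "evalr g [y, x] 0" by (rule evalr_Mu)
    then have "P x y" using g'[of y x 0] by (cases "P x y") simp_all
    then show "\<exists>y. P x y" by blast
  next
    assume ex: "\<exists>y. P x y"
    let ?y = "LEAST y. P x y"
    have "evalr (Mu g) [x] ?y"
    proof (rule evalr.mu)
      show "evalr g [?y, x] 0" using LeastI_ex[OF ex] by (simp add: g')
      show "\<forall>k<?y. \<exists>z. evalr g [k, x] (Suc z)"
        using not_less_Least by (auto simp: g')
    qed
    then show "\<exists>y. evalr (Mu g) [x] y" by blast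
  qed
  then show ?thesis unfolding rec_enum_def by blast
qed

section \<open>Coding finite sequences by single numbers\<close>

definition digit :: "nat \<Rightarrow> nat \<Rightarrow> nat \<Rightarrow> nat" where
  "digit B q i = q div B ^ i mod B"

lemma digit_sum:
  assumes "\<And>i. i < N \<Longrightarrow> f i < B"
  shows "digit B (\<Sum>i<N. f i * B ^ i) j = (if j < N then f j else 0)"
  using assms
proof (induction j arbitrary: f N)
  case 0
  show ?case
  proof (cases N)
    case (Suc N')
    have "(\<Sum>i<N. f i * B ^ i) = f 0 + B * (\<Sum>i<N'. f (Suc i) * B ^ i)"
      unfolding Suc by (simp add: sum.lessThan_Suc_shift sum_distrib_left mult.left_commute del: sum.lessThan_Suc)
    then show ?thesis using 0[of 0] Suc by (simp add: digit_def)
  qed (simp add: digit_def)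
next
  case (Suc j)
  show ?case
  proof (cases N)
    case (Suc N')
    have eq: "(\<Sum>i<N. f i * B ^ i) = f 0 + B * (\<Sum>i<N'. f (Suc i) * B ^ i)"
      unfolding Suc by (simp add: sum.lessThan_Suc_shift sum_distrib_left mult.left_commute del: sum.lessThan_Suc)
    have "f 0 < B" using Suc.prems[of 0] Suc by simp
    then have "(\<Sum>i<N. f i * B ^ i) div B = (\<Sum>i<N'. f (Suc i) * B ^ i)" unfolding eq by simp
    then have "digit B (\<Sum>i<N. f i * B ^ i) (Suc j) = digit B (\<Sum>i<N'. f (Suc i) * B ^ i) j"
      by (simp add: digit_def div_mult2_eq)
    also have "\<dots> = (if j < N' then f (Suc j) else 0)"
      by (rule Suc.IH) (use Suc.prems Suc in simp)
    finally show ?thesis using Suc by simp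
  qed (simp add: digit_def)
qed

text \<open>The base is stored beside the digits, so sequences with arbitrarily large entries have
  codes.\<close>

definition seq_nth :: "nat \<Rightarrow> nat \<Rightarrow> nat" where
  "seq_nth y i = digit (fst (prod_decode y)) (snd (prod_decode y)) i"

lemma seq_exists: "\<exists>y. \<forall>i<N. seq_nth y i = f i"
proof -
  define B where "B = Suc (\<Sum>i<N. f i)"
  have "f i < B" if "i < N" for i
    using member_le_sum[of i "{..<N}" f] that by (simp add: B_def less_Suc_eq_le)
  then have "digit B (\<Sum>i<N. f i * B ^ i) i = f i" if "i < N" for i
    using digit_sum[of N f B i] that by simp
  then show ?thesis
    by (intro exI[of _ "prod_encode (B, \<Sum>i<N. f i * B ^ i)"]) (simp add: seq_nth_def)
qed

lemma total_rec_digit: "total_rec k B \<Longrightarrow> total_rec k q \<Longrightarrow> total_rec k i \<Longrightarrow> total_rec k (\<lambda>e. digit (B e) (q e) (i e))"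
  unfolding digit_def by (intro total_rec_mod total_rec_div total_rec_power)

lemma total_rec_seq_nth: "total_rec k f \<Longrightarrow> total_rec k i \<Longrightarrow> total_rec k (\<lambda>e. seq_nth (f e) (i e))"
  unfolding seq_nth_def by (intro total_rec_digit total_rec_prod_decode)

section \<open>Enumerating certificates\<close>

text \<open>Coordinates of a grid point are at most \<open>m\<close>, so base m + 1 determines the
  point; \<open>digit (Suc m)\<close> is the decoding.\<close>

definition grid_code :: "nat \<Rightarrow> nat \<Rightarrow> (nat \<Rightarrow> nat) \<Rightarrow> nat" where
  "grid_code B p \<alpha> = (\<Sum>i<Suc p. \<alpha> i * B ^ i)"

lemma sum_powers_less: "(\<And>i. i < N \<Longrightarrow> f i < B) \<Longrightarrow> (\<Sum>i<N. f i * B ^ i) < B ^ N" for f :: "nat \<Rightarrow> nat"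
proof (induction N)
  case (Suc N)
  have "(\<Sum>i<Suc N. f i * B ^ i) < B ^ N + f N * B ^ N" using Suc by simp
  also have "\<dots> = Suc (f N) * B ^ N" by simp
  also have "\<dots> \<le> B * B ^ N" using Suc.prems[of N] by (intro mult_right_mono) auto
  finally show ?case by simp
qed simp

lemma digit_grid_code:
  assumes "\<alpha> \<in> grid p m"
  shows "digit (Suc m) (grid_code (Suc m) p \<alpha>) = \<alpha>" "grid_code (Suc m) p \<alpha> < Suc m ^ Suc p"
proof -
  have lt: "\<alpha> i < Suc m" for i using grid_le[OF assms, of i] by simp
  show "grid_code (Suc m) p \<alpha> < Suc m ^ Suc p" unfolding grid_code_def by (rule sum_powers_less) (rule lt)
  show "digit (Suc m) (grid_code (Suc m) p \<alpha>) = \<alpha>"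
  proof
    fix i
    have "digit (Suc m) (grid_code (Suc m) p \<alpha>) i = (if i < Suc p then \<alpha> i else 0)"
      unfolding grid_code_def by (rule digit_sum) (rule lt)
    then show "digit (Suc m) (grid_code (Suc m) p \<alpha>) i = \<alpha> i" using assms by (simp add: grid_def)
  qed
qed

lemma digit_grid:
  assumes "q < Suc m ^ Suc p" "(\<Sum>i\<le>p. digit (Suc m) q i) = m"
  shows "digit (Suc m) q \<in> grid p m"
proof -
  have "digit (Suc m) q i = 0" if "i > p" for i
  proof -
    have "Suc m ^ Suc p \<le> Suc m ^ i" using that by (intro power_increasing) auto
    then show ?thesis using assms(1) by (simp add: digit_def)
  qed
  then show ?thesis using assms(2) by (simp add: grid_def)
qed

text \<open>As \<open>m\<close> is part of the search, the grid is not a fixed finite set; its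
  quantifier becomes a numerical one with computable bound.\<close>

lemma ball_grid_iff:
  "(\<forall>\<alpha>\<in>grid p m. P \<alpha>) \<longleftrightarrow> (\<forall>q<Suc m ^ Suc p. (\<Sum>i\<in>{..p}. digit (Suc m) q i) = m \<longrightarrow> P (digit (Suc m) q))" (is "?l \<longleftrightarrow> ?r")
proof
  assume ?l
  then show ?r using digit_grid by blast
next
  assume r: ?r
  show ?l
  proof
    fix \<alpha> assume a: "\<alpha> \<in> grid p m"
    have "(\<Sum>i\<in>{..p}. digit (Suc m) (grid_code (Suc m) p \<alpha>) i) = m"
      unfolding digit_grid_code(1)[OF a] using a by (simp add: grid_def)
    from r[rule_format, OF digit_grid_code(2)[OF a] this] show "P \<alpha>"
      unfolding digit_grid_code(1)[OF a] .
  qed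
qed

lemma rec_predicate_grid:
  assumes m: "total_rec k m" and P: "rec_predicate (Suc k) (\<lambda>e. P (digit (Suc (m (\<lambda>i. e (Suc i)))) (e 0)) (\<lambda>i. e (Suc i)))"
  shows "rec_predicate k (\<lambda>e. \<forall>\<alpha>\<in>grid p (m e). P \<alpha> e)"
  unfolding ball_grid_iff
  by (rule rec_predicate_all, (intro total_rec_power total_rec_Suc total_rec_const m)[1])
     (intro rec_predicate_imp rec_predicate_eq total_rec_finite_sum finite_atMost total_rec_digit total_rec_Suc total_rec_const total_rec_var total_rec_shift[OF m] P)

text \<open>Each labelling occupies a block of length (m + 1)^(p + 1), which exceeds every grid
  code, so blocks do not overlap.\<close>

lemma labels_exist:
  "\<exists>w. \<forall>j<J. \<forall>\<alpha>\<in>grid p m. seq_nth w (j * Suc m ^ Suc p + grid_code (Suc m) p \<alpha>) = \<zeta> j \<alpha>"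
proof -
  define Q where "Q = Suc m ^ Suc p"
  obtain w where w: "\<forall>i<J * Q. seq_nth w i = \<zeta> (i div Q) (digit (Suc m) (i mod Q))"
    using seq_exists[of "J * Q" "\<lambda>i. \<zeta> (i div Q) (digit (Suc m) (i mod Q))"] by blast
  have "seq_nth w (j * Q + grid_code (Suc m) p \<alpha>) = \<zeta> j \<alpha>" if j: "j < J" and \<alpha>: "\<alpha> \<in> grid p m" for j \<alpha>
  proof -
    have c: "grid_code (Suc m) p \<alpha> < Q" using digit_grid_code(2)[OF \<alpha>] by (simp add: Q_def)
    have "j * Q + grid_code (Suc m) p \<alpha> < Suc j * Q" using c by simp
    also have "\<dots> \<le> J * Q" using j by (intro mult_le_mono1) simp
    finally have "j * Q + grid_code (Suc m) p \<alpha> < J * Q" .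
    moreover have "(j * Q + grid_code (Suc m) p \<alpha>) div Q = j" "(j * Q + grid_code (Suc m) p \<alpha>) mod Q = grid_code (Suc m) p \<alpha>"
      using c by auto
    ultimately show ?thesis using w digit_grid_code(1)[OF \<alpha>] by simp
  qed
  then show ?thesis unfolding Q_def by blast
qed

text \<open>Only finitely many values of the functions matter, so they may be exchanged for
  functions decoded from numbers.\<close>

lemma chain_certificate_cong:
  assumes cert: "chain_certificate n v cl J m0 lam con m R \<zeta> \<tau> cls"
    and \<zeta>: "\<And>j \<alpha>. j < J \<Longrightarrow> \<alpha> \<in> grid n m \<Longrightarrow> \<zeta>' j \<alpha> = \<zeta> j \<alpha>"
    and \<tau>: "\<And>i \<alpha>. i < R \<Longrightarrow> \<alpha> \<in> grid (Suc n) m \<Longrightarrow> \<tau>' i \<alpha> = \<tau> i \<alpha>"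
    and cls: "\<And>r. r < J + R * (n + 2) \<Longrightarrow> cls' r = cls r"
  shows "chain_certificate n v cl J m0 lam con m R \<zeta>' \<tau>' cls'"
proof -
  have el: "entry_label n J \<zeta>' \<tau>' r \<alpha> = entry_label n J \<zeta> \<tau> r \<alpha>" if r: "r < J + R * (n + 2)" and \<alpha>: "\<alpha> \<in> grid n m" for r \<alpha>
  proof (cases "r < J")
    case False
    let ?k = "(r - J) mod (n + 2)"
    have "(r - J) div (n + 2) < R" using r False by (simp add: less_mult_imp_div_less)
    moreover have "?k \<le> Suc n" using mod_less_divisor[of "n + 2" "r - J"] by linarith
    then have "simplical_face ?k \<alpha> \<in> grid (Suc n) m" using grid_face_iff \<alpha> by blast
    ultimately show ?thesis using False by (simp add: entry_label_def \<tau>)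
  qed (simp add: entry_label_def \<zeta> \<alpha>)
  have fc: "\<zeta>' j (simplical_face k \<alpha>) = \<zeta> j (simplical_face k \<alpha>)" if "n \<noteq> 0" "j < J" "k \<le> n" "\<alpha> \<in> grid (n - 1) m" for j k \<alpha>
  proof -
    have "simplical_face k \<alpha> \<in> grid n m" using grid_face_iff[of k "n - 1" \<alpha> m] that by simp
    then show ?thesis using \<zeta> that by simp
  qed
  note c' = cert[unfolded chain_certificate_def]
  show ?thesis
    unfolding chain_certificate_def
  proof (intro conjI allI impI ballI)
    show "m0 \<le> m" using c' by (elim conjE)
  next
    fix i \<alpha> assume i: "i < R" and \<alpha>: "\<alpha> \<in> grid (Suc n) m"
    show "\<tau>' i \<alpha> < v" unfolding \<tau>[OF i \<alpha>] using c' i \<alpha> by (elim conjE) simp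
    fix \<beta> assume \<beta>: "\<beta> \<in> grid (Suc n) m" "\<forall>l\<le>Suc n. \<alpha> l \<le> \<beta> l + 1 \<and> \<beta> l \<le> \<alpha> l + 1"
    show "cl (\<tau>' i \<alpha>) (\<tau>' i \<beta>)" unfolding \<tau>[OF i \<alpha>] \<tau>[OF i \<beta>(1)] using c' i \<alpha> \<beta> by (elim conjE) simp
  next
    fix j \<alpha> assume j: "j < J" and \<alpha>: "\<alpha> \<in> grid n m"
    show "\<zeta>' j \<alpha> < v" unfolding \<zeta>[OF j \<alpha>] using c' j \<alpha> by (elim conjE) simp
    fix \<beta> assume \<beta>: "\<beta> \<in> grid n m0" "\<forall>l\<le>n. m0 * \<alpha> l \<le> m * \<beta> l + 3 * m \<and> m * \<beta> l \<le> m0 * \<alpha> l + 3 * m"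
    show "cl (lam j \<beta>) (\<zeta>' j \<alpha>)" unfolding \<zeta>[OF j \<alpha>] using c' j \<alpha> \<beta> by (elim conjE) simp
  next
    fix j k j' k' \<alpha> assume a: "n \<noteq> 0" "j < J" "k \<le> n" "j' < J" "k' \<le> n" "con j k j' k'" "\<alpha> \<in> grid (n - 1) m"
    show "\<zeta>' j (simplical_face k \<alpha>) = \<zeta>' j' (simplical_face k' \<alpha>)"
      unfolding fc[OF a(1,2,3,7)] fc[OF a(1,4,5,7)] using c' a by (elim conjE) simp
  next
    have all: "\<forall>r<J + R * (n + 2). cls r < J + R * (n + 2) \<and> (\<forall>s<J + R * (n + 2). cls r = cls s \<longrightarrow>
        (\<forall>\<alpha>\<in>grid n m. entry_label n J \<zeta> \<tau> r \<alpha> = entry_label n J \<zeta> \<tau> s \<alpha>))"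
      using c' by (elim conjE) assumption
    fix r assume r: "r < J + R * (n + 2)"
    show "cls' r < J + R * (n + 2)" unfolding cls[OF r] using all r by simp
    fix s \<alpha> assume s: "s < J + R * (n + 2)" "cls' r = cls' s" and \<alpha>: "\<alpha> \<in> grid n m"
    then have "cls r = cls s" using cls r by simp
    then show "entry_label n J \<zeta>' \<tau>' r \<alpha> = entry_label n J \<zeta>' \<tau>' s \<alpha>"
      unfolding el[OF r \<alpha>] el[OF s(1) \<alpha>] using all[rule_format, OF r, THEN conjunct2, rule_format, OF s(1) _ \<alpha>] by blast
  qed
qed

text \<open>Integer coefficients are differences of naturals. The sign of an odd face exchanges the
  two parts, so the negative part is the same formula with the roles of \<open>ep\<close> and
  \<open>en\<close> swapped and \<open>b\<close> replaced by the negative part of the cycle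
  coefficients.\<close>

definition pos_part :: "nat \<Rightarrow> nat \<Rightarrow> nat \<Rightarrow> (nat \<Rightarrow> nat) \<Rightarrow> (nat \<Rightarrow> nat) \<Rightarrow> (nat \<Rightarrow> nat) \<Rightarrow> nat \<Rightarrow> nat" where
  "pos_part n J D b ep en r = (if r < J then D * b r
     else if (r - J) mod (n + 2) mod 2 = 0 then ep ((r - J) div (n + 2)) else en ((r - J) div (n + 2)))"

text \<open>Truncated subtraction both ways gives the absolute value: (x - y) + (y - x) = \<bar>x -
  y\<bar>.\<close>

definition nat_cost :: "nat \<Rightarrow> nat \<Rightarrow> nat \<Rightarrow> (nat \<Rightarrow> nat) \<Rightarrow> (nat \<Rightarrow> nat) \<Rightarrow> (nat \<Rightarrow> nat) \<Rightarrow> (nat \<Rightarrow> nat) \<Rightarrow> nat \<Rightarrow> (nat \<Rightarrow> nat) \<Rightarrow> nat" where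
  "nat_cost n J D bp bn ep en R cls = (\<Sum>d<J + R * (n + 2).
     ((\<Sum>r<J + R * (n + 2). if cls r = d then pos_part n J D bp ep en r else 0)
       - (\<Sum>r<J + R * (n + 2). if cls r = d then pos_part n J D bn en ep r else 0))
     + ((\<Sum>r<J + R * (n + 2). if cls r = d then pos_part n J D bn en ep r else 0)
       - (\<Sum>r<J + R * (n + 2). if cls r = d then pos_part n J D bp ep en r else 0)))"

lemma class_cost_nat:
  assumes "\<And>j. j < J \<Longrightarrow> b j = int (bp j) - int (bn j)"
    and "\<And>i. i < R \<Longrightarrow> e i = int (ep i) - int (en i)"
  shows "class_cost n J D b e R cls = int (nat_cost n J D bp bn ep en R cls)"
proof -
  let ?L = "J + R * (n + 2)"
  let ?p = "pos_part n J D bp ep en" and ?q = "pos_part n J D bn en ep"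
  have coeff: "entry_coeff n J D b e r = int (?p r) - int (?q r)" if r: "r < ?L" for r
  proof (cases "r < J")
    case True
    then show ?thesis using assms(1) by (simp add: entry_coeff_def pos_part_def right_diff_distrib)
  next
    case False
    then have "(r - J) div (n + 2) < R" using r by (simp add: less_mult_imp_div_less)
    from assms(2)[OF this] show ?thesis
      using False by (cases "even ((r - J) mod (n + 2))") (simp_all add: entry_coeff_def pos_part_def even_iff_mod_2_eq_zero[symmetric])
  qed
  have "\<bar>\<Sum>r\<in>{r. r < ?L \<and> cls r = d}. entry_coeff n J D b e r\<bar> =
    int (((\<Sum>r<?L. if cls r = d then ?p r else 0) - (\<Sum>r<?L. if cls r = d then ?q r else 0))
      + ((\<Sum>r<?L. if cls r = d then ?q r else 0) - (\<Sum>r<?L. if cls r = d then ?p r else 0)))" for d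
  proof -
    have "(\<Sum>r\<in>{r. r < ?L \<and> cls r = d}. entry_coeff n J D b e r) = (\<Sum>r<?L. if cls r = d then int (?p r) - int (?q r) else 0)"
      by (rule sum.mono_neutral_cong_left) (auto simp: coeff)
    also have "\<dots> = (\<Sum>r<?L. int (if cls r = d then ?p r else 0) - int (if cls r = d then ?q r else 0))"
      by (intro sum.cong) auto
    also have "\<dots> = int (\<Sum>r<?L. if cls r = d then ?p r else 0) - int (\<Sum>r<?L. if cls r = d then ?q r else 0)"
      by (simp only: sum_subtractf of_nat_sum)
    finally have "(\<Sum>r\<in>{r. r < ?L \<and> cls r = d}. entry_coeff n J D b e r)
       = int (\<Sum>r<?L. if cls r = d then ?p r else 0) - int (\<Sum>r<?L. if cls r = d then ?q r else 0)" .
    moreover have "\<bar>int x - int y\<bar> = int ((x - y) + (y - x))" for x y by linarith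
    ultimately show ?thesis by (simp only:)
  qed
  then show ?thesis by (simp only: class_cost_def nat_cost_def of_nat_sum)
qed

text \<open>\<open>int_decode\<close> sends even codes to the nonnegative integers a div 2 and odd
  codes to negative ones; the latter never exceed a cost, which is nonnegative.\<close>

lemma rat_of_code_compare:
  assumes "0 < D"
  shows "real_of_int (int c) < real D * real_of_rat (rat_of_code x) \<longleftrightarrow>
    fst (prod_decode x) mod 2 = 0 \<and> c * Suc (snd (prod_decode x)) < D * (fst (prod_decode x) div 2)"
proof -
  obtain a b where ab: "prod_decode x = (a, b)" by (cases "prod_decode x")
  have "real_of_rat (rat_of_code x) = real_of_int (int_decode a) / real (Suc b)"
    by (simp add: rat_of_code_def ab of_rat_divide del: of_nat_Suc)
  then have "real_of_int (int c) < real D * real_of_rat (rat_of_code x) \<longleftrightarrow> real c * real (Suc b) < real D * real_of_int (int_decode a)"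
    by (simp add: pos_less_divide_eq del: of_nat_Suc)
  also have "\<dots> \<longleftrightarrow> a mod 2 = 0 \<and> c * Suc b < D * (a div 2)"
  proof (cases "even a")
    case True
    then have "int_decode a = int (a div 2)" by (simp add: int_decode_def sum_decode_def)
    then have "real c * real (Suc b) < real D * real_of_int (int_decode a) \<longleftrightarrow> real (c * Suc b) < real (D * (a div 2))"
      by (simp only: of_nat_mult of_int_of_nat_eq)
    then show ?thesis using True by (simp only: of_nat_less_iff even_iff_mod_2_eq_zero simp_thms)
  next
    case False
    then have "int_decode a < 0" by (simp add: int_decode_def sum_decode_def)
    then have "real D * real_of_int (int_decode a) \<le> 0" by (simp add: mult_nonneg_nonpos)
    moreover have "0 \<le> real c * real (Suc b)" by simp
    ultimately have "\<not> real c * real (Suc b) < real D * real_of_int (int_decode a)" by linarith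
    then show ?thesis using False by (simp add: even_iff_mod_2_eq_zero del: of_nat_Suc)
  qed
  finally show ?thesis by (simp add: ab)
qed

definition coded_label :: "nat \<Rightarrow> nat \<Rightarrow> nat \<Rightarrow> nat \<Rightarrow> (nat \<Rightarrow> nat) \<Rightarrow> nat" where
  "coded_label m p w j \<alpha> = seq_nth w (j * Suc m ^ Suc p + grid_code (Suc m) p \<alpha>)"

lemma total_rec_coded_label:
  assumes "total_rec k m" "total_rec k w" "total_rec k j" "\<And>i. total_rec k (\<lambda>e. \<alpha> e i)"
  shows "total_rec k (\<lambda>e. coded_label (m e) p (w e) (j e) (\<alpha> e))"
  unfolding coded_label_def grid_code_def
  by (intro total_rec_seq_nth total_rec_add total_rec_mult total_rec_power total_rec_Suc total_rec_const total_rec_finite_sum finite_lessThan assms)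

lemma total_rec_simplical_face:
  assumes "total_rec k j" "\<And>i. total_rec k (\<lambda>e. \<alpha> e i)"
  shows "total_rec k (\<lambda>e. simplical_face (j e) (\<alpha> e) i)"
  unfolding simplical_face_def
  by (intro total_rec_if rec_predicate_less rec_predicate_eq total_rec_const assms)

lemma rec_predicate_chain_certificate:
  assumes cl: "\<And>u u'. cl u u' \<Longrightarrow> u < v \<and> u' < v"
    and tr: "total_rec k m" "total_rec k R" "total_rec k z" "total_rec k t" "total_rec k c"
  shows "rec_predicate k (\<lambda>e. chain_certificate n v cl J m0 lam con (m e) (R e)
    (coded_label (m e) n (z e)) (coded_label (m e) (Suc n) (t e)) (seq_nth (c e)))"
proof -
  \<comment> \<open>Each numerical quantifier shifts the environment; at most three are nested, such
    as one over chain simplices and two over the grid.\<close>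
  note tr' = tr tr[THEN total_rec_shift] tr[THEN total_rec_shift, THEN total_rec_shift] tr[THEN total_rec_shift, THEN total_rec_shift, THEN total_rec_shift]
  have digit: "total_rec k' (\<lambda>e. digit (Suc (m' e)) (e j) i)" if "total_rec k' m'" for k' m' i j
    by (intro total_rec_digit total_rec_Suc total_rec_const total_rec_var that)
  have "rec_predicate k (\<lambda>e. m0 \<le> m e)"
    by (intro rec_predicate_le total_rec_const tr)
  moreover have "rec_predicate k (\<lambda>e. \<forall>i<R e. \<forall>\<alpha>\<in>grid (Suc n) (m e). coded_label (m e) (Suc n) (t e) i \<alpha> < v \<and>
       (\<forall>\<beta>\<in>grid (Suc n) (m e). (\<forall>l\<le>Suc n. \<alpha> l \<le> \<beta> l + 1 \<and> \<beta> l \<le> \<alpha> l + 1) \<longrightarrow>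
          cl (coded_label (m e) (Suc n) (t e) i \<alpha>) (coded_label (m e) (Suc n) (t e) i \<beta>)))"
    by (intro rec_predicate_all rec_predicate_grid rec_predicate_conj rec_predicate_imp rec_predicate_all_le rec_predicate_less rec_predicate_le rec_predicate_finite_relation[OF cl] total_rec_coded_label total_rec_add total_rec_const
        digit tr' total_rec_var)
  \<comment> \<open>Here j and \<beta> range over fixed finite sets and are expanded into a finite
    conjunction, which turns \<open>lam j \<beta>\<close> into a constant.\<close>
  moreover have "rec_predicate k (\<lambda>e. \<forall>j<J. \<forall>\<alpha>\<in>grid n (m e). coded_label (m e) n (z e) j \<alpha> < v \<and>
       (\<forall>\<beta>\<in>grid n m0. (\<forall>l\<le>n. m0 * \<alpha> l \<le> m e * \<beta> l + 3 * m e \<and> m e * \<beta> l \<le> m0 * \<alpha> l + 3 * m e) \<longrightarrow>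
          cl (lam j \<beta>) (coded_label (m e) n (z e) j \<alpha>)))"
  proof (rule rec_predicate_all_less, rule rec_predicate_grid[OF tr(1)], rule rec_predicate_conj)
    fix j
    let ?m = "\<lambda>e. m (\<lambda>i. e (Suc i))" and ?z = "\<lambda>e. z (\<lambda>i. e (Suc i))"
    show "rec_predicate (Suc k) (\<lambda>e. coded_label (?m e) n (?z e) j (digit (Suc (?m e)) (e 0)) < v)"
      by (intro rec_predicate_less total_rec_coded_label total_rec_const digit tr')
    show "rec_predicate (Suc k) (\<lambda>e. \<forall>\<beta>\<in>grid n m0. (\<forall>l\<le>n. m0 * digit (Suc (?m e)) (e 0) l \<le> ?m e * \<beta> l + 3 * ?m e \<and>
        ?m e * \<beta> l \<le> m0 * digit (Suc (?m e)) (e 0) l + 3 * ?m e) \<longrightarrow>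
          cl (lam j \<beta>) (coded_label (?m e) n (?z e) j (digit (Suc (?m e)) (e 0))))"
      by (intro rec_predicate_finite_all[OF finite_grid] rec_predicate_imp rec_predicate_all_le rec_predicate_conj rec_predicate_le rec_predicate_finite_relation[OF cl] total_rec_coded_label total_rec_add total_rec_mult total_rec_const
        digit tr')
  qed
  moreover have "rec_predicate k (\<lambda>e. n \<noteq> 0 \<longrightarrow> (\<forall>j<J. \<forall>k\<le>n. \<forall>j'<J. \<forall>k'\<le>n. con j k j' k' \<longrightarrow>
       (\<forall>\<alpha>\<in>grid (n - 1) (m e). coded_label (m e) n (z e) j (simplical_face k \<alpha>) = coded_label (m e) n (z e) j' (simplical_face k' \<alpha>))))"
    by (intro rec_predicate_imp rec_predicate_const rec_predicate_all_less rec_predicate_all_le rec_predicate_grid rec_predicate_eq total_rec_coded_label total_rec_simplical_face total_rec_const digit tr')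
  moreover have "rec_predicate k (\<lambda>e. \<forall>r<J + R e * (n + 2). seq_nth (c e) r < J + R e * (n + 2) \<and>
     (\<forall>s<J + R e * (n + 2). seq_nth (c e) r = seq_nth (c e) s \<longrightarrow>
       (\<forall>\<alpha>\<in>grid n (m e). entry_label n J (coded_label (m e) n (z e)) (coded_label (m e) (Suc n) (t e)) r \<alpha>
          = entry_label n J (coded_label (m e) n (z e)) (coded_label (m e) (Suc n) (t e)) s \<alpha>)))"
    unfolding entry_label_def
    by (intro rec_predicate_all rec_predicate_conj rec_predicate_less rec_predicate_imp rec_predicate_eq rec_predicate_grid total_rec_if total_rec_coded_label total_rec_simplical_face total_rec_seq_nth
        total_rec_div total_rec_mod total_rec_diff total_rec_add total_rec_mult total_rec_const digit tr' total_rec_var)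
  ultimately show ?thesis
    unfolding chain_certificate_def by (intro rec_predicate_conj)
qed

lemma total_rec_nat_cost:
  assumes bp: "\<And>x. x \<ge> J \<Longrightarrow> bp x = 0" and bn: "\<And>x. x \<ge> J \<Longrightarrow> bn x = 0"
    and tr: "total_rec k D" "total_rec k R" "total_rec k c" "total_rec k p" "total_rec k q"
  shows "total_rec k (\<lambda>e. nat_cost n J (D e) bp bn (seq_nth (p e)) (seq_nth (q e)) (R e) (seq_nth (c e)))"
proof -
  note tr' = tr tr[THEN total_rec_shift] tr[THEN total_rec_shift, THEN total_rec_shift]
  show ?thesis
    unfolding nat_cost_def pos_part_def
    by (intro total_rec_sum total_rec_add total_rec_diff total_rec_if rec_predicate_eq rec_predicate_less total_rec_mult total_rec_seq_nth total_rec_div total_rec_mod total_rec_const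
        total_rec_table[OF bp] total_rec_table[OF bn] tr' total_rec_var)
qed

lemma rec_enum_certificate_exists:
  assumes cl: "\<And>u u'. cl u u' \<Longrightarrow> u < v \<and> u' < v"
  shows "rec_enum {x. \<exists>D m R \<zeta> \<tau> cls e. 0 < D \<and> chain_certificate n v cl J m0 lam con m R \<zeta> \<tau> cls \<and>
    real_of_int (class_cost n J D b e R cls) < real D * real_of_rat (rat_of_code x)}" (is "rec_enum {x. ?E x}")
proof -
  define bp where "bp = (\<lambda>j. if j < J then nat (b j) else 0)"
  define bn where "bn = (\<lambda>j. if j < J then nat (- b j) else 0)"
  have b: "b j = int (bp j) - int (bn j)" if "j < J" for j using that by (simp add: bp_def bn_def)
  \<comment> \<open>The positions 0 to 7 of y hold D, m, R, codes of \<zeta>, \<tau> and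
    \<open>cls\<close>, and codes of the positive and negative parts of e.\<close>
  define P where "P = (\<lambda>x y. 0 < seq_nth y 0 \<and>
    chain_certificate n v cl J m0 lam con (seq_nth y 1) (seq_nth y 2) (coded_label (seq_nth y 1) n (seq_nth y 3))
      (coded_label (seq_nth y 1) (Suc n) (seq_nth y 4)) (seq_nth (seq_nth y 5)) \<and>
    fst (prod_decode x) mod 2 = 0 \<and>
    nat_cost n J (seq_nth y 0) bp bn (seq_nth (seq_nth y 6)) (seq_nth (seq_nth y 7)) (seq_nth y 2) (seq_nth (seq_nth y 5))
      * Suc (snd (prod_decode x)) < seq_nth y 0 * (fst (prod_decode x) div 2))"
  have "rec_predicate 2 (\<lambda>e. P (e 1) (e 0))"
    unfolding P_def
    by (intro rec_predicate_conj rec_predicate_less rec_predicate_eq rec_predicate_chain_certificate[OF cl] total_rec_nat_cost total_rec_mult total_rec_mod total_rec_div total_rec_Suc total_rec_prod_decode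
        total_rec_seq_nth total_rec_const total_rec_var) (simp_all add: bp_def bn_def)
  then have "rec_enum {x. \<exists>y. P x y}" by (rule rec_enum_exists)
  moreover have "(\<exists>y. P x y) \<longleftrightarrow> ?E x" for x
  proof
    assume "\<exists>y. P x y"
    then obtain y where y: "P x y" by blast
    let ?e = "\<lambda>i. int (seq_nth (seq_nth y 6) i) - int (seq_nth (seq_nth y 7) i)"
    have D: "0 < seq_nth y 0" using y by (simp add: P_def)
    have "class_cost n J (seq_nth y 0) b ?e (seq_nth y 2) (seq_nth (seq_nth y 5))
       = int (nat_cost n J (seq_nth y 0) bp bn (seq_nth (seq_nth y 6)) (seq_nth (seq_nth y 7)) (seq_nth y 2) (seq_nth (seq_nth y 5)))"
      by (rule class_cost_nat) (use b in auto)
    then have "real_of_int (class_cost n J (seq_nth y 0) b ?e (seq_nth y 2) (seq_nth (seq_nth y 5))) < real (seq_nth y 0) * real_of_rat (rat_of_code x)"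
      using y unfolding P_def by (simp only: rat_of_code_compare[OF D] simp_thms)
    then show "?E x" using y D unfolding P_def by blast
  next
    assume "?E x"
    then obtain D m R \<zeta> \<tau> cls e where D: "0 < D" and c: "chain_certificate n v cl J m0 lam con m R \<zeta> \<tau> cls"
      and lt: "real_of_int (class_cost n J D b e R cls) < real D * real_of_rat (rat_of_code x)" by blast
    obtain z where z: "\<forall>j<J. \<forall>\<alpha>\<in>grid n m. coded_label m n z j \<alpha> = \<zeta> j \<alpha>"
      using labels_exist[of J n m \<zeta>] unfolding coded_label_def by blast
    obtain t where t: "\<forall>i<R. \<forall>\<alpha>\<in>grid (Suc n) m. coded_label m (Suc n) t i \<alpha> = \<tau> i \<alpha>"
      using labels_exist[of R "Suc n" m \<tau>] unfolding coded_label_def by blast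
    obtain s where s: "\<forall>r<J + R * (n + 2). seq_nth s r = cls r"
      using seq_exists[of "J + R * (n + 2)" cls] by blast
    obtain p where p: "\<forall>i<R. seq_nth p i = nat (e i)"
      using seq_exists[of R "\<lambda>i. nat (e i)"] by blast
    obtain q where q: "\<forall>i<R. seq_nth q i = nat (- e i)"
      using seq_exists[of R "\<lambda>i. nat (- e i)"] by blast
    obtain y where y: "\<forall>i<8. seq_nth y i = [D, m, R, z, t, s, p, q] ! i"
      using seq_exists[of 8 "(!) [D, m, R, z, t, s, p, q]"] by blast
    have y': "seq_nth y 0 = D" "seq_nth y 1 = m" "seq_nth y 2 = R" "seq_nth y 3 = z" "seq_nth y 4 = t"
      "seq_nth y 5 = s" "seq_nth y 6 = p" "seq_nth y 7 = q"
      using y by (simp_all add: numeral_eq_Suc)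
    have "chain_certificate n v cl J m0 lam con m R (coded_label m n z) (coded_label m (Suc n) t) (seq_nth s)"
      by (rule chain_certificate_cong[OF c]) (use z t s in auto)
    moreover have "class_cost n J D b e R (seq_nth s) = int (nat_cost n J D bp bn (seq_nth p) (seq_nth q) R (seq_nth s))"
      by (rule class_cost_nat) (use b p q in auto)
    moreover have "class_cost n J D b e R cls = class_cost n J D b e R (seq_nth s)"
    proof -
      have "{r. r < J + R * (n + 2) \<and> cls r = d} = {r. r < J + R * (n + 2) \<and> seq_nth s r = d}" for d
        using s by auto
      then show ?thesis by (simp only: class_cost_def)
    qed
    ultimately have "P x y"
      using lt D unfolding P_def y' by (simp only: rat_of_code_compare[OF D] simp_thms)
    then show "\<exists>y. P x y" by blast
  qed
  ultimately show ?thesis by simp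
qed

theorem theorem1p8:
  fixes M :: "'a topology" and n :: nat and z :: "'a chain"
  assumes "closed_manifold n M"
    and "connected_space M"
    and "fundamental_cycle n M z"
  shows "right_computable (simplicial_volume n M z)"
proof -
  have "singular_relcycle n M {} z" using assms(3) by (simp add: fundamental_cycle_def)
  from simplicial_volume_less_iff_certificate[OF assms(1) this]
  obtain v cl J m0 lam con b where cl: "\<And>u u'. cl u u' \<Longrightarrow> u < v \<and> u' < v" and
    iff: "\<And>x. simplicial_volume n M z < x \<longleftrightarrow>
    (\<exists>D m R \<zeta> \<tau> cls e. 0 < D \<and> chain_certificate n v cl J m0 lam con m R \<zeta> \<tau> cls \<and>
       real_of_int (class_cost n J D b e R cls) < real D * x)"
    by blast
  show ?thesis
    using rec_enum_certificate_exists[where n = n and J = J and ?m0.0 = m0 and lam = lam and con = con and b = b, OF cl]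
    unfolding right_computable_def rec_enum_rat_def mem_Collect_eq iff .
qed

end
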